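(* For any intermediate logic $\mathsf L$ the following are equivalent: (i) $\mathsf L$ has hereditary finitary unification; (ii) $\mathsf L$ has hereditary projective approximation or $\mathsf L$ has hereditary unitary unification; (iii) $\mathsf L$ omits $\mathfrak R_2+$, $\mathfrak G_3$, $\mathfrak G_3+$ and at least one of the frames $\mathfrak F_2$, $\mathfrak R_2$; (iv) $\chi(\mathfrak G_3),\chi(\mathfrak G_3+),\chi(\mathfrak R_2+)\in\mathsf L$ and either $\chi(\mathfrak R_2)\in\mathsf L$ or $\chi(\mathfrak F_2)\in\mathsf L$.
   Context: An intermediate logic is a set of intuitionistic propositional formulas containing $\mathsf{INT}$, closed under modus ponens and substitution. A frame is a finite poset with least element; $\mathsf L$ omits $\mathfrak F$ if $\mathsf L$ is not contained in the logic of $\mathfrak F$ (formulas valid in all Kripke models over $\mathfrak F$). $\chi(\mathfrak F)$ is Jankov's characteristic formula: $\chi(\mathfrak F)\in\mathsf L$ iff $\mathsf L$ omits $\mathfrak F$. Frames: $\mathfrak F_2$ is a root with two incomparable maximal elements; $\mathfrak F+$ is $\mathfrak F$ with a top added; $\mathfrak R_2=\mathfrak F_2+$; $\mathfrak G_3$: elements $r,a,b,c$ with $r<a$, $r<b<c$, no other relations beyond transitivity. Unification types: for a substitution $\varepsilon$ with $\varepsilon(A)\in\mathsf L$ ($\mathsf L$-unifier), $\varepsilon\preccurlyeq\mu$ iff $\alpha\circ\varepsilon=_{\mathsf L}\mu$ for some $\alpha$; unitary: every unifiable formula has a unifier $\preccurlyeq$ all its unifiers; finitary: not unitary and every unifiable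 formula has a finite complete set of unifiers. Projective approximation: for every $A$ a finite set $\Pi(A)$ of formulas $B$ with projective unifiers ($\varepsilon(B)\in\mathsf L$, $B\vdash_{\mathsf L}\varepsilon(x)\leftrightarrow x$ for all $x$), $\mathrm{Var}(B)\subseteq\mathrm{Var}(A)$, $B\vdash_{\mathsf L}A$, such that each unifier of $A$ unifies some $B\in\Pi(A)$. $\mathsf L$ has hereditary finitary unification if every extension of $\mathsf L$ (including $\mathsf L$) has finitary or unitary unification; hereditary unitary unification / hereditary projective approximation if every extension has unitary unification / projective approximation. *)

theory Defs
  imports Main "HOL-Library.Countable"
begin

section \<open>Formulas, substitutions, intermediate logics\<close>

datatype fm =
    Var nat
  | Bot
  | And fm fm
  | Or fm fm
  | Imp fm fm

abbreviation Iff :: "fm \<Rightarrow> fm \<Rightarrow> fm" where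
  "Iff A B \<equiv> And (Imp A B) (Imp B A)"

abbreviation Top :: fm where
  "Top \<equiv> Imp Bot Bot"

primrec vars :: "fm \<Rightarrow> nat set" where
  "vars (Var x) = {x}"
| "vars Bot = {}"
| "vars (And A B) = vars A \<union> vars B"
| "vars (Or A B) = vars A \<union> vars B"
| "vars (Imp A B) = vars A \<union> vars B"

primrec subst :: "(nat \<Rightarrow> fm) \<Rightarrow> fm \<Rightarrow> fm" where
  "subst \<sigma> (Var x) = \<sigma> x"
| "subst \<sigma> Bot = Bot"
| "subst \<sigma> (And A B) = And (subst \<sigma> A) (subst \<sigma> B)"
| "subst \<sigma> (Or A B) = Or (subst \<sigma> A) (subst \<sigma> B)"
| "subst \<sigma> (Imp A B) = Imp (subst \<sigma> A) (subst \<sigma> B)"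

definition subst_comp :: "(nat \<Rightarrow> fm) \<Rightarrow> (nat \<Rightarrow> fm) \<Rightarrow> (nat \<Rightarrow> fm)" where
  "subst_comp \<alpha> \<epsilon> = (\<lambda>x. subst \<alpha> (\<epsilon> x))"

inductive_set IPC :: "fm set" where
  ax_K: "Imp A (Imp B A) \<in> IPC"
| ax_S: "Imp (Imp A (Imp B C)) (Imp (Imp A B) (Imp A C)) \<in> IPC"
| ax_andE1: "Imp (And A B) A \<in> IPC"
| ax_andE2: "Imp (And A B) B \<in> IPC"
| ax_andI: "Imp A (Imp B (And A B)) \<in> IPC"
| ax_orI1: "Imp A (Or A B) \<in> IPC"
| ax_orI2: "Imp B (Or A B) \<in> IPC"
| ax_orE: "Imp (Imp A C) (Imp (Imp B C) (Imp (Or A B) C)) \<in> IPC"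
| ax_botE: "Imp Bot A \<in> IPC"
| MP: "Imp A B \<in> IPC \<Longrightarrow> A \<in> IPC \<Longrightarrow> B \<in> IPC"

text \<open>The inconsistent logic (all formulas) is included.\<close>

definition intermediate_logic :: "fm set \<Rightarrow> bool" where
  "intermediate_logic L \<longleftrightarrow>
     IPC \<subseteq> L \<and>
     (\<forall>A B. Imp A B \<in> L \<longrightarrow> A \<in> L \<longrightarrow> B \<in> L) \<and>
     (\<forall>\<sigma>. \<forall>A\<in>L. subst \<sigma> A \<in> L)"

text \<open>Derivability from hypotheses: modus ponens, but no substitution, may be applied
  to the hypotheses.\<close>

inductive derives :: "fm set \<Rightarrow> fm set \<Rightarrow> fm \<Rightarrow> bool" for L X where
  logic: "A \<in> L \<Longrightarrow> derives L X A"
| hyp: "A \<in> X \<Longrightarrow> derives L X A"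
| mp: "derives L X (Imp A B) \<Longrightarrow> derives L X A \<Longrightarrow> derives L X B"


section \<open>Unification\<close>

definition unifier :: "fm set \<Rightarrow> fm \<Rightarrow> (nat \<Rightarrow> fm) \<Rightarrow> bool" where
  "unifier L A \<epsilon> \<longleftrightarrow> subst \<epsilon> A \<in> L"

definition unifiable :: "fm set \<Rightarrow> fm \<Rightarrow> bool" where
  "unifiable L A \<longleftrightarrow> (\<exists>\<epsilon>. unifier L A \<epsilon>)"

definition subst_eq :: "fm set \<Rightarrow> (nat \<Rightarrow> fm) \<Rightarrow> (nat \<Rightarrow> fm) \<Rightarrow> bool" where
  "subst_eq L \<epsilon> \<mu> \<longleftrightarrow> (\<forall>x. Iff (\<epsilon> x) (\<mu> x) \<in> L)"

text \<open>Substitutions are arbitrary maps on all variables, not only those of finite support.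
  Hence comparing them on all variables gives the same unification types as comparing
  unifiers of a formula on its variables only: outside these, a unifier may be
  redefined as an injective renaming into unused variables.\<close>

definition more_general :: "fm set \<Rightarrow> (nat \<Rightarrow> fm) \<Rightarrow> (nat \<Rightarrow> fm) \<Rightarrow> bool" where
  "more_general L \<epsilon> \<mu> \<longleftrightarrow> (\<exists>\<alpha>. subst_eq L (subst_comp \<alpha> \<epsilon>) \<mu>)"

definition complete_unifiers :: "fm set \<Rightarrow> fm \<Rightarrow> (nat \<Rightarrow> fm) set \<Rightarrow> bool" where
  "complete_unifiers L A S \<longleftrightarrow>
     (\<forall>\<epsilon>\<in>S. unifier L A \<epsilon>) \<and>
     (\<forall>\<mu>. unifier L A \<mu> \<longrightarrow> (\<exists>\<epsilon>\<in>S. more_general L \<epsilon> \<mu>))"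

definition unitary_unification :: "fm set \<Rightarrow> bool" where
  "unitary_unification L \<longleftrightarrow>
     (\<forall>A. unifiable L A \<longrightarrow>
        (\<exists>\<epsilon>. unifier L A \<epsilon> \<and> (\<forall>\<mu>. unifier L A \<mu> \<longrightarrow> more_general L \<epsilon> \<mu>)))"

definition finitary_unification :: "fm set \<Rightarrow> bool" where
  "finitary_unification L \<longleftrightarrow>
     \<not> unitary_unification L \<and>
     (\<forall>A. unifiable L A \<longrightarrow> (\<exists>S. finite S \<and> complete_unifiers L A S))"

definition projective_unifier :: "fm set \<Rightarrow> fm \<Rightarrow> (nat \<Rightarrow> fm) \<Rightarrow> bool" where
  "projective_unifier L B \<epsilon> \<longleftrightarrow>
     unifier L B \<epsilon> \<and> (\<forall>x. derives L {B} (Iff (\<epsilon> x) (Var x)))"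

definition projective_approximation :: "fm set \<Rightarrow> bool" where
  "projective_approximation L \<longleftrightarrow>
     (\<forall>A. \<exists>P. finite P \<and>
        (\<forall>B\<in>P. (\<exists>\<epsilon>. projective_unifier L B \<epsilon>) \<and> vars B \<subseteq> vars A \<and> derives L {B} A) \<and>
        (\<forall>\<mu>. unifier L A \<mu> \<longrightarrow> (\<exists>B\<in>P. unifier L B \<mu>)))"

definition hereditary :: "(fm set \<Rightarrow> bool) \<Rightarrow> fm set \<Rightarrow> bool" where
  "hereditary P L \<longleftrightarrow> (\<forall>L'. intermediate_logic L' \<longrightarrow> L \<subseteq> L' \<longrightarrow> P L')"

definition hereditary_finitary_unification :: "fm set \<Rightarrow> bool" where
  "hereditary_finitary_unification =
     hereditary (\<lambda>L. finitary_unification L \<or> unitary_unification L)"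

definition hereditary_unitary_unification :: "fm set \<Rightarrow> bool" where
  "hereditary_unitary_unification = hereditary unitary_unification"

definition hereditary_projective_approximation :: "fm set \<Rightarrow> bool" where
  "hereditary_projective_approximation = hereditary projective_approximation"


section \<open>Frames\<close>

text \<open>The carrier of a frame is a whole finite type, so that a frame is just its order
  relation.\<close>

type_synonym 'w frame = "'w \<Rightarrow> 'w \<Rightarrow> bool"

definition is_frame :: "('w::finite) frame \<Rightarrow> bool" where
  "is_frame F \<longleftrightarrow> reflp F \<and> transp F \<and> antisymp F \<and> (\<exists>r. \<forall>w. F r w)"

definition upset :: "'w frame \<Rightarrow> 'w set \<Rightarrow> bool" where
  "upset F U \<longleftrightarrow> (\<forall>w v. w \<in> U \<longrightarrow> F w v \<longrightarrow> v \<in> U)"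

primrec forces :: "'w frame \<Rightarrow> (nat \<Rightarrow> 'w set) \<Rightarrow> 'w \<Rightarrow> fm \<Rightarrow> bool" where
  "forces F V w (Var x) \<longleftrightarrow> w \<in> V x"
| "forces F V w Bot \<longleftrightarrow> False"
| "forces F V w (And A B) \<longleftrightarrow> forces F V w A \<and> forces F V w B"
| "forces F V w (Or A B) \<longleftrightarrow> forces F V w A \<or> forces F V w B"
| "forces F V w (Imp A B) \<longleftrightarrow> (\<forall>v. F w v \<longrightarrow> forces F V v A \<longrightarrow> forces F V v B)"

definition logic_of :: "('w::finite) frame \<Rightarrow> fm set" where
  "logic_of F = {A. \<forall>V. (\<forall>x. upset F (V x)) \<longrightarrow> (\<forall>w. forces F V w A)}"

definition omits :: "fm set \<Rightarrow> ('w::finite) frame \<Rightarrow> bool" where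
  "omits L F \<longleftrightarrow> \<not> L \<subseteq> logic_of F"

text \<open>The added top element is \<^term>\<open>None\<close>.\<close>

definition add_top :: "'w frame \<Rightarrow> 'w option frame" where
  "add_top F p q \<longleftrightarrow>
     (case q of None \<Rightarrow> True | Some v \<Rightarrow> (case p of None \<Rightarrow> False | Some w \<Rightarrow> F w v))"

datatype fork = Fork_r | Fork_a | Fork_b

definition F2 :: "fork frame" where
  "F2 p q \<longleftrightarrow> p = q \<or> p = Fork_r"

datatype g3 = G3_r | G3_a | G3_b | G3_c

definition G3 :: "g3 frame" where
  "G3 p q \<longleftrightarrow> p = q \<or> p = G3_r \<or> (p = G3_b \<and> q = G3_c)"

instance fork :: finite
proof
  have "(UNIV :: fork set) = {Fork_r, Fork_a, Fork_b}"
    using fork.exhaust by blast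
  then show "finite (UNIV :: fork set)" by (metis finite.emptyI finite.insertI)
qed

instance g3 :: finite
proof
  have "(UNIV :: g3 set) = {G3_r, G3_a, G3_b, G3_c}"
    using g3.exhaust by blast
  then show "finite (UNIV :: g3 set)" by (metis finite.emptyI finite.insertI)
qed

definition R2 :: "fork option frame" where
  "R2 = add_top F2"

lemma is_frame_F2: "is_frame F2"
  by (auto simp: is_frame_def F2_def reflp_def transp_def antisymp_def)

lemma is_frame_G3: "is_frame G3"
  by (auto simp: is_frame_def G3_def reflp_def transp_def antisymp_def)

lemma is_frame_add_top:
  assumes "is_frame F"
  shows "is_frame (add_top F)"
proof -
  from assms have refl: "\<And>w. F w w"
    and trans: "\<And>u v w. F u v \<Longrightarrow> F v w \<Longrightarrow> F u w"
    and anti: "\<And>u v. F u v \<Longrightarrow> F v u \<Longrightarrow> u = v"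
    by (auto simp: is_frame_def dest: reflpD transpD antisympD)
  from assms obtain r where "\<forall>w. F r w"
    by (auto simp: is_frame_def)
  then have "\<forall>p. add_top F (Some r) p"
    by (simp add: add_top_def split: option.split)
  then show ?thesis
    unfolding is_frame_def reflp_def transp_def antisymp_def
    using refl trans anti
    by (auto simp: add_top_def split: option.splits; blast)
qed


section \<open>Jankov's characteristic formula\<close>


text \<open>Jankov's formula of the finite subdirectly irreducible Heyting algebra of upsets of a
  frame: the diagram of the algebra implies its second greatest element, which is the
  set of all points but the root. The variable naming an upset is given by the injection
  \<^const>\<open>to_nat\<close>; the choice of the injection and the order of the conjuncts are immaterial
  for membership in an intermediate logic.\<close>

definition big_conj :: "fm set \<Rightarrow> fm" where
  "big_conj S = foldr And (SOME As. set As = S) Top"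

definition root :: "('w::finite) frame \<Rightarrow> 'w" where
  "root F = (THE r. \<forall>w. F r w)"

definition upset_imp :: "'w frame \<Rightarrow> 'w set \<Rightarrow> 'w set \<Rightarrow> 'w set" where
  "upset_imp F U V = {w. \<forall>v. F w v \<longrightarrow> v \<in> U \<longrightarrow> v \<in> V}"

definition upset_var :: "('w::finite) set \<Rightarrow> fm" where
  "upset_var U = Var (to_nat U)"

definition diagram :: "('w::finite) frame \<Rightarrow> fm set" where
  "diagram F =
     {Iff (upset_var ({} :: 'w set)) Bot} \<union>
     {Iff (upset_var (U \<inter> V)) (And (upset_var U) (upset_var V)) | U V.
        upset F U \<and> upset F V} \<union>
     {Iff (upset_var (U \<union> V)) (Or (upset_var U) (upset_var V)) | U V.
        upset F U \<and> upset F V} \<union>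
     {Iff (upset_var (upset_imp F U V)) (Imp (upset_var U) (upset_var V)) | U V.
        upset F U \<and> upset F V}"

definition jankov :: "('w::finite) frame \<Rightarrow> fm" where
  "jankov F = Imp (big_conj (diagram F)) (upset_var (UNIV - {root F}))"

end

theory Submission
  imports Defs
begin

text \<open>If \<open>L\<close> omits the required frames, its canonical models over finitely many variables are finite:
  each cone is a chain, topped by an antichain, topped by at most one point. Without the top point,
  the formulas which a substitution makes provable are axiomatized by a single formula with
  Ghilardi's extension property, which is therefore projective. With a top point this holds once
  finitely many variables are added to record which colours occur below a maximal point; the
  resulting finite complete set of unifiers is reduced to one by weak excluded middle.
  Conversely, in the logics of \<open>R2+\<close>, of \<open>G3\<close>, of \<open>G3+\<close> and of \<open>{F2, R2}\<close> the formula
  \<open>(x \<longrightarrow> y) \<or> (y \<longrightarrow> x)\<close> has unifiers that treat forks over the members of arbitrarily large antichains of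
  colours specially. A more general unifier in few variables identifies two of the members, and
  recombining the models over them refutes the formula.\<close>

section \<open>Derivability\<close>

text \<open>An omitted frame is exploited in one way only: a definable p-morphism from a cone of the
  canonical model onto it would turn a refuting valuation into a failing substitution instance of a
  theorem. Finiteness always comes from the fact that bisimilar points are equal. It is used twice:
  up-sets become definable, so recolouring the finite canonical frame amounts to a substitution; and
  the formulas attached to infinitely many unifiers are chosen from the finitely many up-sets. The
  extension property is a problem only at points whose strict successors all satisfy
  \<open>E\<close>, for every other point has a least strict successor and may copy its colour. At
  the critical points a colouring is lifted to the canonical model over the variables of the
  unifier. Without a top the lifts of the antichain members are independent of each other; with a
  top they must all lie below one maximal point, and this is what the recording variables enforce.
  In the negative part, a unifier whose first two components contain \<open>n\<close> variables sees
  at most \<open>2 ^ n\<close> colours, so the pigeonhole principle yields the two members that it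
  confuses.\<close>

lemma intermediate_logic_IPC: "intermediate_logic L \<Longrightarrow> A \<in> IPC \<Longrightarrow> A \<in> L"
  by (auto simp: intermediate_logic_def)

lemma intermediate_logic_MP: "intermediate_logic L \<Longrightarrow> Imp A B \<in> L \<Longrightarrow> A \<in> L \<Longrightarrow> B \<in> L"
  unfolding intermediate_logic_def by blast

lemma intermediate_logic_subst: "intermediate_logic L \<Longrightarrow> A \<in> L \<Longrightarrow> subst \<sigma> A \<in> L"
  unfolding intermediate_logic_def by blast

lemma derives_mono: "derives L \<Gamma> A \<Longrightarrow> \<Gamma> \<subseteq> \<Delta> \<Longrightarrow> derives L \<Delta> A"
  by (induction rule: derives.induct) (auto intro: derives.intros)

lemma derives_cut: "derives L \<Delta> A \<Longrightarrow> (\<And>B. B \<in> \<Delta> \<Longrightarrow> derives L \<Gamma> B) \<Longrightarrow> derives L \<Gamma> A"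
  by (induction rule: derives.induct) (auto intro: derives.intros)

lemma derives_IPC: "intermediate_logic L \<Longrightarrow> A \<in> IPC \<Longrightarrow> derives L \<Gamma> A"
  by (simp add: derives.logic intermediate_logic_IPC)

lemma derives_IPC_mp: "intermediate_logic L \<Longrightarrow> Imp A B \<in> IPC \<Longrightarrow> derives L \<Gamma> A \<Longrightarrow> derives L \<Gamma> B"
  using derives_IPC derives.mp by blast

lemma derives_deduction:
  assumes L: "intermediate_logic L" and "derives L (insert A \<Gamma>) B"
  shows "derives L \<Gamma> (Imp A B)"
  using assms(2)
proof (induction rule: derives.induct)
  case (logic C)
  then show ?case
    using derives_IPC[OF L ax_K] derives.logic derives.mp by metis
next
  case (hyp C)
  have "derives L \<Gamma> (Imp A A)"
    using derives_IPC[OF L ax_K] derives_IPC[OF L ax_S] derives.mp by metis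
  moreover have "C \<in> \<Gamma> \<Longrightarrow> derives L \<Gamma> (Imp A C)"
    using derives_IPC[OF L ax_K] derives.hyp derives.mp by metis
  ultimately show ?case using hyp by blast
next
  case (mp C D)
  then show ?case
    using derives_IPC[OF L ax_S] derives.mp by metis
qed

lemma derives_Imp_iff:
  assumes "intermediate_logic L"
  shows "derives L \<Gamma> (Imp A B) \<longleftrightarrow> derives L (insert A \<Gamma>) B"
proof
  assume "derives L \<Gamma> (Imp A B)"
  then show "derives L (insert A \<Gamma>) B"
    by (meson derives.hyp derives.mp derives_mono insertI1 subset_insertI)
qed (rule derives_deduction[OF assms])

lemma derives_empty_iff:
  assumes "intermediate_logic L"
  shows "derives L {} A \<longleftrightarrow> A \<in> L"
proof
  assume "derives L {} A"
  then show "A \<in> L"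
    by (induction rule: derives.induct) (auto intro: intermediate_logic_MP[OF assms])
qed (rule derives.logic)

lemma derives_OrE:
  assumes L: "intermediate_logic L"
    and "derives L (insert A \<Gamma>) C" "derives L (insert B \<Gamma>) C" "derives L \<Gamma> (Or A B)"
  shows "derives L \<Gamma> C"
  using derives_IPC[OF L ax_orE] assms(2-4) derives_deduction[OF L] derives.mp by metis

text \<open>A derivation uses finitely many hypotheses. This provides the upper bounds of chains in
  the Zorn argument of \<open>prime_extension\<close>.\<close>

lemma derives_chain:
  assumes "derives L (\<Union>\<C>) A" and "subset.chain \<S> \<C>" "\<C> \<noteq> {}"
  shows "\<exists>\<Gamma>\<in>\<C>. derives L \<Gamma> A"
  using assms(1)
proof (induction rule: derives.induct)
  case (logic A)
  then show ?case using assms(3) derives.logic by blast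
next
  case (hyp A)
  then show ?case using derives.hyp by blast
next
  case (mp A B)
  then obtain \<Gamma> \<Delta> where "\<Gamma> \<in> \<C>" "derives L \<Gamma> (Imp A B)" "\<Delta> \<in> \<C>" "derives L \<Delta> A" by blast
  moreover from this have "\<Gamma> \<subseteq> \<Delta> \<or> \<Delta> \<subseteq> \<Gamma>"
    using assms(2) unfolding subset.chain_def by blast
  ultimately show ?case by (metis derives.mp derives_mono)
qed

section \<open>Kripke semantics\<close>

lemma forces_subst:
  "forces F V w (subst \<sigma> A) \<longleftrightarrow> forces F (\<lambda>x. {v. forces F V v (\<sigma> x)}) w A"
  by (induction A arbitrary: w) auto

lemma forces_bisim:
  assumes "vars A \<subseteq> X" "R w w'"
    and "\<And>w w' x. R w w' \<Longrightarrow> x \<in> X \<Longrightarrow> w \<in> V x \<longleftrightarrow> w' \<in> V' x"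
    and "\<And>w w' v. R w w' \<Longrightarrow> F w v \<Longrightarrow> \<exists>v'. F' w' v' \<and> R v v'"
    and "\<And>w w' v'. R w w' \<Longrightarrow> F' w' v' \<Longrightarrow> \<exists>v. F w v \<and> R v v'"
  shows "forces F V w A \<longleftrightarrow> forces F' V' w' A"
  using assms(1,2)
proof (induction A arbitrary: w w')
  case (Imp A B)
  show ?case
  proof
    assume *: "forces F V w (Imp A B)"
    show "forces F' V' w' (Imp A B)"
      unfolding forces.simps
    proof (intro allI impI)
      fix v' assume "F' w' v'" "forces F' V' v' A"
      moreover from this obtain v where "F w v" "R v v'" using assms(5) Imp.prems(2) by blast
      ultimately show "forces F' V' v' B" using * Imp.IH[of v v'] Imp.prems(1) by simp
    qed
  next
    assume *: "forces F' V' w' (Imp A B)"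
    show "forces F V w (Imp A B)"
      unfolding forces.simps
    proof (intro allI impI)
      fix v assume "F w v" "forces F V v A"
      moreover from this obtain v' where "F' w' v'" "R v v'" using assms(4) Imp.prems(2) by blast
      ultimately show "forces F V v B" using * Imp.IH[of v v'] Imp.prems(1) by simp
    qed
  qed
next
  case (Var x)
  then show ?case using assms(3) by simp
qed auto

lemma forces_mono:
  assumes "transp F" "\<And>x. upset F (V x)" "F w v" "forces F V w A"
  shows "forces F V v A"
  using assms(3,4)
proof (induction A arbitrary: w v)
  case (Var x)
  then show ?case using assms(2) by (auto simp: upset_def)
next
  case (Imp A B)
  then show ?case using assms(1) by (auto dest: transpD)
qed auto

text \<open>Reflexive on \<open>W\<close> only.\<close>

definition ord :: "fm set set \<Rightarrow> fm set frame" where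
  "ord W t s \<longleftrightarrow> s \<in> W \<and> t \<subseteq> s"

section \<open>The canonical model\<close>

definition Fm :: "nat set \<Rightarrow> fm set" where
  "Fm X = {A. vars A \<subseteq> X}"

lemma Fm_simps [simp]:
  "Var x \<in> Fm X \<longleftrightarrow> x \<in> X"
  "Bot \<in> Fm X"
  "And A B \<in> Fm X \<longleftrightarrow> A \<in> Fm X \<and> B \<in> Fm X"
  "Or A B \<in> Fm X \<longleftrightarrow> A \<in> Fm X \<and> B \<in> Fm X"
  "Imp A B \<in> Fm X \<longleftrightarrow> A \<in> Fm X \<and> B \<in> Fm X"
  by (auto simp: Fm_def)

lemma subst_in_Fm: "A \<in> Fm X \<Longrightarrow> (\<And>x. x \<in> X \<Longrightarrow> \<sigma> x \<in> Fm Y) \<Longrightarrow> subst \<sigma> A \<in> Fm Y"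
  by (induction A) auto

lemma finite_vars: "finite (vars A)"
  by (induction A) auto

text \<open>The consistent prime theories in the language \<open>X\<close>. Closure concerns
  consequences in \<open>Fm X\<close>, although derivations may pass through other variables. The
  inconsistent logic has no points.\<close>

definition pts :: "fm set \<Rightarrow> nat set \<Rightarrow> fm set set" where
  "pts L X = {t. t \<subseteq> Fm X \<and> (\<forall>A\<in>Fm X. derives L t A \<longrightarrow> A \<in> t) \<and> Bot \<notin> t \<and>
     (\<forall>A B. Or A B \<in> t \<longrightarrow> A \<in> t \<or> B \<in> t)}"

text \<open>Lindenbaum's lemma: a set maximal among those not deriving \<open>B\<close> is closed,
  and it is prime since two excluded disjuncts would both lead to \<open>B\<close>.\<close>

lemma prime_extension:
  assumes L: "intermediate_logic L" and "\<Gamma> \<subseteq> Fm X" "B \<in> Fm X" "\<not> derives L \<Gamma> B"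
  shows "\<exists>t\<in>pts L X. \<Gamma> \<subseteq> t \<and> B \<notin> t"
proof -
  define \<S> where "\<S> = {\<Delta>. \<Gamma> \<subseteq> \<Delta> \<and> \<Delta> \<subseteq> Fm X \<and> \<not> derives L \<Delta> B}"
  have "\<exists>M\<in>\<S>. \<forall>\<Delta>\<in>\<S>. M \<subseteq> \<Delta> \<longrightarrow> \<Delta> = M"
  proof (rule subset_Zorn_nonempty)
    show "\<S> \<noteq> {}" using assms by (auto simp: \<S>_def)
  next
    fix \<C> assume "\<C> \<noteq> {}" "subset.chain \<S> \<C>"
    moreover from this have "\<C> \<subseteq> \<S>" by (simp add: subset.chain_def)
    ultimately have "\<not> derives L (\<Union>\<C>) B" "\<Gamma> \<subseteq> \<Union>\<C>" "\<Union>\<C> \<subseteq> Fm X"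
      using derives_chain[of L \<C> B \<S>] by (auto simp: \<S>_def)
    then show "\<Union>\<C> \<in> \<S>" by (simp add: \<S>_def)
  qed
  then obtain t where t: "t \<in> \<S>" and "\<And>\<Delta>. \<Delta> \<in> \<S> \<Longrightarrow> t \<subseteq> \<Delta> \<Longrightarrow> \<Delta> = t" by blast
  then have max: "derives L (insert A t) B" if "A \<in> Fm X" "A \<notin> t" for A
  proof -
    have "insert A t \<noteq> t" using that by blast
    then have "insert A t \<notin> \<S>" using \<open>\<And>\<Delta>. \<Delta> \<in> \<S> \<Longrightarrow> t \<subseteq> \<Delta> \<Longrightarrow> \<Delta> = t\<close> by blast
    then show ?thesis using that t by (auto simp: \<S>_def)
  qed
  have closed: "A \<in> t" if "A \<in> Fm X" "derives L t A" for A
  proof (rule ccontr)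
    assume "A \<notin> t"
    then have "derives L (insert A t) B" using max that by blast
    then have "derives L t B"
      by (rule derives_cut) (use that derives.hyp in auto)
    then show False using t by (simp add: \<S>_def)
  qed
  have "Bot \<notin> t"
    using t derives_IPC_mp[OF L ax_botE derives.hyp] by (auto simp: \<S>_def)
  moreover have "A \<in> t \<or> C \<in> t" if "Or A C \<in> t" for A C
  proof (rule ccontr)
    assume *: "\<not> (A \<in> t \<or> C \<in> t)"
    have "Or A C \<in> Fm X" using that t by (auto simp: \<S>_def)
    then have "derives L t B"
      using * max[of A] max[of C] derives_OrE[OF L _ _ derives.hyp[OF that]] by simp
    then show False using t by (simp add: \<S>_def)
  qed
  ultimately have "t \<in> pts L X" using t closed by (auto simp: pts_def \<S>_def)
  moreover have "B \<notin> t" using t derives.hyp by (auto simp: \<S>_def)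
  ultimately show ?thesis using t by (auto simp: \<S>_def)
qed

definition col :: "nat set \<Rightarrow> fm set \<Rightarrow> nat set" where
  "col X t = {x\<in>X. Var x \<in> t}"

locale canonical =
  fixes L :: "fm set" and X :: "nat set"
  assumes L: "intermediate_logic L"
begin

abbreviation W :: "fm set set" where "W \<equiv> pts L X"

lemma pts_Fm: "t \<in> pts L X \<Longrightarrow> A \<in> t \<Longrightarrow> A \<in> Fm X"
  by (auto simp: pts_def)

lemma pts_subset: "t \<in> pts L X \<Longrightarrow> t \<subseteq> Fm X"
  unfolding pts_def by blast

lemma pts_closed: "t \<in> pts L X \<Longrightarrow> A \<in> Fm X \<Longrightarrow> derives L t A \<Longrightarrow> A \<in> t"
  by (auto simp: pts_def)

lemma pts_logic: "t \<in> pts L X \<Longrightarrow> A \<in> Fm X \<Longrightarrow> A \<in> L \<Longrightarrow> A \<in> t"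
  using pts_closed derives.logic by blast

lemma pts_Bot [simp]: "t \<in> pts L X \<Longrightarrow> Bot \<notin> t"
  by (auto simp: pts_def)

lemma pts_And [simp]:
  assumes "t \<in> pts L X" "A \<in> Fm X" "B \<in> Fm X"
  shows "And A B \<in> t \<longleftrightarrow> A \<in> t \<and> B \<in> t"
proof
  assume *: "And A B \<in> t"
  show "A \<in> t \<and> B \<in> t"
    using pts_closed[OF assms(1,2) derives_IPC_mp[OF L ax_andE1 derives.hyp[OF *]]]
      pts_closed[OF assms(1,3) derives_IPC_mp[OF L ax_andE2 derives.hyp[OF *]]] by simp
next
  assume *: "A \<in> t \<and> B \<in> t"
  have "derives L t (And A B)"
    by (rule derives.mp[OF derives_IPC_mp[OF L ax_andI derives.hyp] derives.hyp]) (use * in auto)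
  then show "And A B \<in> t" by (rule pts_closed[OF assms(1), rotated]) (simp add: assms)
qed

lemma pts_Or [simp]:
  assumes "t \<in> pts L X" "A \<in> Fm X" "B \<in> Fm X"
  shows "Or A B \<in> t \<longleftrightarrow> A \<in> t \<or> B \<in> t"
proof
  assume "Or A B \<in> t"
  then show "A \<in> t \<or> B \<in> t" using assms(1) unfolding pts_def by blast
next
  assume "A \<in> t \<or> B \<in> t"
  then have "derives L t (Or A B)"
  proof
    assume "A \<in> t"
    then show ?thesis by (rule derives_IPC_mp[OF L ax_orI1 derives.hyp])
  next
    assume "B \<in> t"
    then show ?thesis by (rule derives_IPC_mp[OF L ax_orI2 derives.hyp])
  qed
  then show "Or A B \<in> t" by (rule pts_closed[OF assms(1), rotated]) (simp add: assms)
qed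

lemma pts_Imp:
  assumes t: "t \<in> pts L X" and A: "A \<in> Fm X" and B: "B \<in> Fm X"
  shows "Imp A B \<in> t \<longleftrightarrow> (\<forall>s\<in>pts L X. t \<subseteq> s \<longrightarrow> A \<in> s \<longrightarrow> B \<in> s)"
proof
  assume "Imp A B \<in> t"
  then show "\<forall>s\<in>pts L X. t \<subseteq> s \<longrightarrow> A \<in> s \<longrightarrow> B \<in> s"
    using pts_closed[OF _ B derives.mp[OF derives.hyp derives.hyp]] by blast
next
  assume R: "\<forall>s\<in>pts L X. t \<subseteq> s \<longrightarrow> A \<in> s \<longrightarrow> B \<in> s"
  show "Imp A B \<in> t"
  proof (rule ccontr)
    assume "Imp A B \<notin> t"
    then have "\<not> derives L (insert A t) B"
      using pts_closed[OF t _ derives_deduction[OF L]] A B by auto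
    moreover have "insert A t \<subseteq> Fm X" using A t unfolding pts_def by blast
    ultimately obtain s where "s \<in> pts L X" "insert A t \<subseteq> s" "B \<notin> s"
      using prime_extension[OF L _ B, of "insert A t"] by metis
    then show False using R by blast
  qed
qed

lemma pts_complete: "A \<in> Fm X \<Longrightarrow> (\<And>t. t \<in> pts L X \<Longrightarrow> A \<in> t) \<Longrightarrow> A \<in> L"
  using prime_extension[OF L, of "{}" X A] derives_empty_iff[OF L] by blast

lemma pts_derives:
  assumes "\<Gamma> \<subseteq> Fm X" "A \<in> Fm X" "\<And>t. t \<in> pts L X \<Longrightarrow> \<Gamma> \<subseteq> t \<Longrightarrow> A \<in> t"
  shows "derives L \<Gamma> A"
  using prime_extension[OF L, of \<Gamma> X A] assms by blast

lemma pts_truth: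
  assumes "t \<in> pts L X" "A \<in> Fm X"
  shows "forces (ord (pts L X)) (\<lambda>x. {t. Var x \<in> t}) t A \<longleftrightarrow> A \<in> t"
  using assms
proof (induction A arbitrary: t)
  case (Imp A B)
  have "forces (ord (pts L X)) (\<lambda>x. {t. Var x \<in> t}) t (Imp A B) \<longleftrightarrow>
      (\<forall>s\<in>pts L X. t \<subseteq> s \<longrightarrow> A \<in> s \<longrightarrow> B \<in> s)"
    using Imp.prems by (auto simp: ord_def Imp.IH)
  also have "\<dots> \<longleftrightarrow> Imp A B \<in> t"
    using Imp pts_Imp[of t A B] by simp
  finally show ?case .
next
  case (And A B)
  then show ?case using pts_And[of t A B] by simp
next
  case (Or A B)
  then show ?case using pts_Or[of t A B] by simp
next
  case Bot
  then show ?case using pts_Bot[of t] by simp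
qed simp

text \<open>Bisimilar points force the same formulas, and a point is just the set of formulas that
  it forces. Since \<open>R\<close> is symmetric, \<open>zig\<close> serves both directions.\<close>

lemma pts_bisim:
  assumes t: "t \<in> pts L X" and s: "s \<in> pts L X" and "R t s"
    and sym: "\<And>t s. R t s \<Longrightarrow> R s t"
    and col: "\<And>t s. R t s \<Longrightarrow> col X t = col X s"
    and zig: "\<And>t s t'. t \<in> W \<Longrightarrow> s \<in> W \<Longrightarrow> R t s \<Longrightarrow> t' \<in> W \<Longrightarrow> t \<subseteq> t' \<Longrightarrow> \<exists>s'\<in>W. s \<subseteq> s' \<and> R t' s'"
  shows "t = s"
proof -
  have "A \<in> t \<longleftrightarrow> A \<in> s" if "A \<in> Fm X" for A
    unfolding pts_truth[OF t that, symmetric] pts_truth[OF s that, symmetric]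
  proof (rule forces_bisim[where R = "\<lambda>t s. t \<in> W \<and> s \<in> W \<and> R t s" and X = X])
    show "vars A \<subseteq> X" using that by (simp add: Fm_def)
    show "t \<in> W \<and> s \<in> W \<and> R t s" using assms(3) t s by blast
    show "w \<in> {t. Var x \<in> t} \<longleftrightarrow> w' \<in> {t. Var x \<in> t}"
      if "w \<in> W \<and> w' \<in> W \<and> R w w'" "x \<in> X" for w w' x
      using col[of w w'] that by (auto simp: col_def)
    show "\<exists>v'. ord W w' v' \<and> v \<in> W \<and> v' \<in> W \<and> R v v'"
      if "w \<in> W \<and> w' \<in> W \<and> R w w'" "ord W w v" for w w' v
      using zig[of w w' v] that unfolding ord_def by blast
    show "\<exists>v. ord W w v \<and> v \<in> W \<and> v' \<in> W \<and> R v v'"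
      if "w \<in> W \<and> w' \<in> W \<and> R w w'" "ord W w' v'" for w w' v'
      using zig[of w' w v'] that sym unfolding ord_def by blast
  qed
  then show ?thesis using pts_subset[OF t] pts_subset[OF s] by blast
qed

lemma pts_Imp_D: "Imp A B \<in> t \<Longrightarrow> t \<in> W \<Longrightarrow> A \<in> Fm X \<Longrightarrow> B \<in> Fm X \<Longrightarrow> s \<in> W \<Longrightarrow> t \<subseteq> s \<Longrightarrow> A \<in> s \<Longrightarrow> B \<in> s"
  using pts_Imp by blast

lemma pts_Top: "t \<in> W \<Longrightarrow> Top \<in> t"
  by (simp add: pts_Imp)

lemma pts_neg:
  assumes "t \<in> W" "A \<in> Fm X"
  shows "Imp A Bot \<in> t \<longleftrightarrow> (\<forall>s\<in>W. t \<subseteq> s \<longrightarrow> A \<notin> s)"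
proof -
  have "(\<forall>s\<in>W. t \<subseteq> s \<longrightarrow> A \<in> s \<longrightarrow> Bot \<in> s) \<longleftrightarrow> (\<forall>s\<in>W. t \<subseteq> s \<longrightarrow> A \<notin> s)"
    using pts_Bot by blast
  then show ?thesis using pts_Imp[OF assms Fm_simps(2)] by blast
qed

lemma pts_disj:
  assumes "finite S" "S \<subseteq> Fm X"
  shows "\<exists>A\<in>Fm X. \<forall>t\<in>W. A \<in> t \<longleftrightarrow> (\<exists>B\<in>S. B \<in> t)"
  using assms
proof (induction S)
  case empty
  show ?case by (rule bexI[of _ Bot]) auto
next
  case (insert C S)
  then obtain A where "A \<in> Fm X" "\<forall>t\<in>W. A \<in> t \<longleftrightarrow> (\<exists>B\<in>S. B \<in> t)" by blast
  then show ?case using insert.prems by (intro bexI[of _ "Or C A"]) auto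
qed

lemma pts_disjE:
  assumes "finite S" "S \<subseteq> Fm X"
  obtains A where "A \<in> Fm X" "\<And>t. t \<in> W \<Longrightarrow> A \<in> t \<longleftrightarrow> (\<exists>B\<in>S. B \<in> t)"
  by (rule bexE[OF pts_disj[OF assms]], rule that) blast+

lemma pts_conj:
  assumes "finite S" "S \<subseteq> Fm X"
  shows "\<exists>A\<in>Fm X. \<forall>t\<in>W. A \<in> t \<longleftrightarrow> (\<forall>B\<in>S. B \<in> t)"
  using assms
proof (induction S)
  case empty
  show ?case by (rule bexI[of _ Top]) (auto simp: pts_Top)
next
  case (insert C S)
  then obtain A where "A \<in> Fm X" "\<forall>t\<in>W. A \<in> t \<longleftrightarrow> (\<forall>B\<in>S. B \<in> t)" by blast
  then show ?case using insert.prems by (intro bexI[of _ "And C A"]) auto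
qed

lemma pts_conjE:
  assumes "finite S" "S \<subseteq> Fm X"
  obtains A where "A \<in> Fm X" "\<And>t. t \<in> W \<Longrightarrow> A \<in> t \<longleftrightarrow> (\<forall>B\<in>S. B \<in> t)"
  by (rule bexE[OF pts_conj[OF assms]], rule that) blast+

text \<open>A logic omitting \<open>F\<close> has no definable p-morphism from a cone of its canonical model onto \<open>F\<close>.\<close>

lemma omission:
  fixes F :: "('w::finite) frame"
  assumes om: "omits L F" and F: "reflp F" "transp F" and t: "t \<in> W"
    and zig: "\<And>s s'. s \<in> W \<Longrightarrow> s' \<in> W \<Longrightarrow> t \<subseteq> s \<Longrightarrow> s \<subseteq> s' \<Longrightarrow> F (h s) (h s')"
    and zag: "\<And>s v. s \<in> W \<Longrightarrow> t \<subseteq> s \<Longrightarrow> F (h s) v \<Longrightarrow> \<exists>s'\<in>W. s \<subseteq> s' \<and> h s' = v"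
    and dfn: "\<And>v. \<exists>A\<in>Fm X. \<forall>s\<in>W. t \<subseteq> s \<longrightarrow> (A \<in> s \<longleftrightarrow> F v (h s))"
  shows "\<exists>v. \<not> F (h t) v"
proof (rule ccontr)
  assume "\<not> ?thesis"
  then have root: "F (h t) v" for v by blast
  obtain A V w where A: "A \<in> L" and V: "\<And>x. upset F (V x)" and "\<not> forces F V w A"
    using om by (auto simp: omits_def logic_of_def)
  \<comment> \<open>\<open>h t\<close> is a root of \<open>F\<close> by assumption, so a refutation
    anywhere in \<open>F\<close> is inherited by it.\<close>
  then have nA: "\<not> forces F V (h t) A"
    using forces_mono[of F V "h t" w A] F(2) V root by blast
  obtain \<phi> where \<phi>: "\<And>v. \<phi> v \<in> Fm X" "\<And>v s. s \<in> W \<Longrightarrow> t \<subseteq> s \<Longrightarrow> \<phi> v \<in> s \<longleftrightarrow> F v (h s)"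
    using dfn by metis
  \<comment> \<open>The up-set \<open>V x\<close> is a finite union of cones of \<open>F\<close>,
    and by \<open>dfn\<close> the preimage of a cone is definable above \<open>t\<close>.\<close>
  have "\<exists>A\<in>Fm X. \<forall>s\<in>W. t \<subseteq> s \<longrightarrow> (A \<in> s \<longleftrightarrow> h s \<in> V x)" for x
  proof -
    obtain B where B: "B \<in> Fm X" "\<And>s. s \<in> W \<Longrightarrow> B \<in> s \<longleftrightarrow> (\<exists>C\<in>\<phi> ` V x. C \<in> s)"
      by (rule pts_disjE[of "\<phi> ` V x"]) (use \<phi>(1) in auto)
    moreover have "(\<exists>v\<in>V x. F v (h s)) \<longleftrightarrow> h s \<in> V x" for s
      using V[of x] F(1) by (auto simp: upset_def dest: reflpD)
    ultimately show ?thesis using \<phi>(2) by (intro bexI[of _ B]) auto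
  qed
  then obtain \<sigma> where \<sigma>: "\<And>x. \<sigma> x \<in> Fm X" "\<And>x s. s \<in> W \<Longrightarrow> t \<subseteq> s \<Longrightarrow> \<sigma> x \<in> s \<longleftrightarrow> h s \<in> V x"
    by metis
  let ?V = "\<lambda>x. {s. Var x \<in> s}"
  \<comment> \<open>The graph of \<open>h\<close> is a bisimulation between \<open>V\<close> and the
    valuation that the substitution \<sigma> induces above \<open>t\<close>.\<close>
  have "forces F V (h t) A \<longleftrightarrow> forces (ord W) (\<lambda>x. {s. forces (ord W) ?V s (\<sigma> x)}) t A"
  proof (rule forces_bisim[where X = UNIV and R = "\<lambda>v s. s \<in> W \<and> t \<subseteq> s \<and> v = h s"])
    show "\<exists>v'. ord W w' v' \<and> v' \<in> W \<and> t \<subseteq> v' \<and> v = h v'"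
      if "w' \<in> W \<and> t \<subseteq> w' \<and> w = h w'" "F w v" for w w' v
      using zag[of w' v] that unfolding ord_def by blast
    show "\<exists>v. F w v \<and> v' \<in> W \<and> t \<subseteq> v' \<and> v = h v'"
      if "w' \<in> W \<and> t \<subseteq> w' \<and> w = h w'" "ord W w' v'" for w w' v'
      using zig[of w' v'] that unfolding ord_def by blast
  qed (use t \<sigma> pts_truth in auto)
  also have "\<dots> \<longleftrightarrow> subst \<sigma> A \<in> t"
    unfolding forces_subst[symmetric] using pts_truth[OF t] subst_in_Fm[of A UNIV \<sigma> X] \<sigma>(1)
    by (simp add: Fm_def)
  also have "\<dots>"
    using pts_logic[OF t] subst_in_Fm[of A UNIV \<sigma> X] \<sigma>(1) intermediate_logic_subst[OF L A]
    by (simp add: Fm_def)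
  finally show False using nA by simp
qed

definition is_max :: "fm set \<Rightarrow> bool" where
  "is_max m \<longleftrightarrow> m \<in> W \<and> (\<forall>s\<in>W. m \<subseteq> s \<longrightarrow> s = m)"

lemma is_max_pts: "is_max m \<Longrightarrow> m \<in> W"
  by (simp add: is_max_def)

lemma is_max_eq: "is_max m \<Longrightarrow> s \<in> W \<Longrightarrow> m \<subseteq> s \<Longrightarrow> s = m"
  by (simp add: is_max_def)

lemma is_max_neg: "is_max m \<Longrightarrow> A \<in> Fm X \<Longrightarrow> Imp A Bot \<in> m \<longleftrightarrow> A \<notin> m"
  using pts_Imp[of m A Bot] by (auto simp: is_max_def)

lemma max_col_inj:
  assumes "is_max m" "is_max m'" "col X m = col X m'"
  shows "m = m'"
proof (rule pts_bisim[where R = "\<lambda>t s. is_max t \<and> is_max s \<and> col X t = col X s"])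
  show "m \<in> W" "m' \<in> W" using assms is_max_pts by blast+
  show "\<exists>s'\<in>W. s \<subseteq> s' \<and> is_max t' \<and> is_max s' \<and> col X t' = col X s'"
    if "s \<in> W" "is_max t \<and> is_max s \<and> col X t = col X s" "t' \<in> W" "t \<subseteq> t'" for t s t'
    using that is_max_eq[of t t'] by (intro bexI[of _ s]) auto
qed (use assms in auto)

lemma col_mono: "t \<subseteq> s \<Longrightarrow> col X t \<subseteq> col X s"
  by (auto simp: col_def)

end

section \<open>Maximal points over finitely many variables\<close>

locale finite_canonical = canonical +
  assumes finX: "finite X"
begin

text \<open>Colours are subsets of the finite \<open>X\<close> and grow upwards, so a point with a
  colour of largest cardinality will do.\<close>

lemma ex_maximal_col:
  assumes "t \<in> W" "P t"
  shows "\<exists>s\<in>W. t \<subseteq> s \<and> P s \<and> (\<forall>s'\<in>W. s \<subseteq> s' \<longrightarrow> P s' \<longrightarrow> col X s' = col X s)"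
proof -
  let ?Q = "\<lambda>s. s \<in> W \<and> t \<subseteq> s \<and> P s"
  have fin: "finite (col X s)" for s using finX by (simp add: col_def)
  have "card (col X s) \<le> card X" for s using finX by (auto simp: col_def intro: card_mono)
  then obtain s where s: "?Q s" "\<And>s'. ?Q s' \<Longrightarrow> card (col X s') \<le> card (col X s)"
    using ex_has_greatest_nat[of ?Q t "\<lambda>s. card (col X s)" "Suc (card X)"] assms by (auto simp: less_Suc_eq_le)
  have "col X s' = col X s" if "s' \<in> W" "s \<subseteq> s'" "P s'" for s'
    using s(2)[of s'] s(1) that card_seteq[OF fin col_mono[OF that(2)]] by auto
  then show ?thesis using s(1) by blast
qed

text \<open>The witness is the conjunction of excluded middle over the variables in
  \<open>X\<close>. Where it holds, the colour is constant upwards, so all points above are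
  bisimilar and hence equal.\<close>

lemma ex_max_formula: "\<exists>D\<in>Fm X. \<forall>t\<in>W. D \<in> t \<longleftrightarrow> is_max t"
proof -
  let ?S = "(\<lambda>x. Or (Var x) (Imp (Var x) Bot)) ` X"
  obtain D where D: "D \<in> Fm X" "\<And>t. t \<in> W \<Longrightarrow> D \<in> t \<longleftrightarrow> (\<forall>B\<in>?S. B \<in> t)"
    by (rule pts_conjE[of ?S]) (use finX in auto)
  have ex: "D \<in> t \<longleftrightarrow> (\<forall>s\<in>W. t \<subseteq> s \<longrightarrow> col X s = col X t)" if "t \<in> W" for t
  proof -
    have "Var x \<in> t \<or> Imp (Var x) Bot \<in> t \<longleftrightarrow> (\<forall>s\<in>W. t \<subseteq> s \<longrightarrow> Var x \<in> s \<longrightarrow> Var x \<in> t)"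
      if "x \<in> X" for x
      using pts_neg[OF \<open>t \<in> W\<close>, of "Var x"] that by fastforce
    then have "D \<in> t \<longleftrightarrow> (\<forall>x\<in>X. \<forall>s\<in>W. t \<subseteq> s \<longrightarrow> Var x \<in> s \<longrightarrow> Var x \<in> t)"
      using D(2)[OF that] that by simp
    then show ?thesis by (fastforce simp: col_def)
  qed
  have "is_max t" if "t \<in> W" "D \<in> t" for t
    unfolding is_max_def
  proof (intro conjI ballI impI)
    fix s assume s: "s \<in> W" "t \<subseteq> s"
    show "s = t"
    proof (rule pts_bisim[where R = "\<lambda>t s. D \<in> t \<and> D \<in> s \<and> col X t = col X s"])
      show "D \<in> s \<and> D \<in> t \<and> col X s = col X t" using s that ex[of t] by blast
      show "\<exists>s''\<in>W. s \<subseteq> s'' \<and> D \<in> t' \<and> D \<in> s'' \<and> col X t' = col X s''"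
        if "t \<in> W" "s \<in> W" "D \<in> t \<and> D \<in> s \<and> col X t = col X s" "t' \<in> W" "t \<subseteq> t'" for t s t'
        using that ex[of t] by (intro bexI[of _ s]) auto
    qed (use s that in auto)
  qed fact
  moreover have "D \<in> t" if "is_max t" for t
    using ex[of t] that by (auto simp: is_max_def)
  ultimately show ?thesis using D(1) by blast
qed

text \<open>Above a point whose colour can no longer grow, all points are bisimilar.\<close>

lemma max_above:
  assumes "t \<in> W"
  shows "\<exists>m. is_max m \<and> t \<subseteq> m"
proof -
  obtain m where m: "m \<in> W" "t \<subseteq> m" "\<And>s. s \<in> W \<Longrightarrow> m \<subseteq> s \<Longrightarrow> col X s = col X m"
    using ex_maximal_col[of t "\<lambda>_. True"] assms by metis
  have "s = m" if "s \<in> W" "m \<subseteq> s" for s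
  proof (rule pts_bisim[where R = "\<lambda>t s. t \<in> W \<and> s \<in> W \<and> m \<subseteq> t \<and> m \<subseteq> s"])
    show "col X t = col X s" if "t \<in> W \<and> s \<in> W \<and> m \<subseteq> t \<and> m \<subseteq> s" for t s
      using m(3) that by metis
    show "\<exists>s'\<in>W. s \<subseteq> s' \<and> t' \<in> W \<and> s' \<in> W \<and> m \<subseteq> t' \<and> m \<subseteq> s'"
      if "t \<in> W \<and> s \<in> W \<and> m \<subseteq> t \<and> m \<subseteq> s" "t' \<in> W" "t \<subseteq> t'" for t s t'
      using that by (intro bexI[of _ s]) blast+
  qed (use m that in blast)+
  then show ?thesis using m by (auto simp: is_max_def)
qed

lemma finite_max: "finite {m. is_max m}"
proof (rule finite_imageD)
  show "finite (col X ` {m. is_max m})"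
    by (rule finite_subset[of _ "Pow X"]) (auto simp: col_def finX)
  show "inj_on (col X) {m. is_max m}"
    using max_col_inj by (auto simp: inj_on_def)
qed

text \<open>A maximal point is determined by its colour, and negation is complementation at maximal
  points, so the conjunction of literals describing the colour of \<open>m\<close> isolates
  it.\<close>

lemma max_isolated:
  assumes "is_max m"
  shows "\<exists>\<gamma>\<in>Fm X. \<forall>m'. is_max m' \<longrightarrow> (\<gamma> \<in> m' \<longleftrightarrow> m' = m)"
proof -
  let ?S = "Var ` col X m \<union> (\<lambda>x. Imp (Var x) Bot) ` (X - col X m)"
  obtain \<gamma> where \<gamma>: "\<gamma> \<in> Fm X" "\<And>t. t \<in> W \<Longrightarrow> \<gamma> \<in> t \<longleftrightarrow> (\<forall>B\<in>?S. B \<in> t)"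
    by (rule pts_conjE[of ?S]) (use finX in \<open>auto simp: col_def\<close>)
  have "\<gamma> \<in> m' \<longleftrightarrow> m' = m" if "is_max m'" for m'
  proof -
    have "\<gamma> \<in> m' \<longleftrightarrow> col X m' = col X m"
      using \<gamma>(2)[OF is_max_pts[OF that]] is_max_neg[OF that, of "Var _"]
      by (fastforce simp: col_def)
    then show ?thesis using max_col_inj[OF that assms] by auto
  qed
  then show ?thesis using \<gamma>(1) by blast
qed

text \<open>Otherwise a formula \<gamma> isolating \<open>m\<close> maps the cone of
  \<open>t\<close> onto the fork: points forcing the negation of \<gamma> go to one leaf, those
  forcing its double negation to the other, the rest to the root.\<close>

lemma unique_max_above:
  assumes "omits L F2" "t \<in> W" "is_max m" "is_max m'" "t \<subseteq> m" "t \<subseteq> m'"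
  shows "m' = m"
proof (rule ccontr)
  assume "m' \<noteq> m"
  obtain \<gamma> where \<gamma>: "\<gamma> \<in> Fm X" "\<And>m'. is_max m' \<Longrightarrow> \<gamma> \<in> m' \<longleftrightarrow> m' = m"
    using max_isolated[OF assms(3)] by blast
  let ?n = "Imp \<gamma> Bot" and ?nn = "Imp (Imp \<gamma> Bot) Bot"
  have n: "?n \<in> s \<longleftrightarrow> (\<forall>s'\<in>W. s \<subseteq> s' \<longrightarrow> \<gamma> \<notin> s')" if "s \<in> W" for s
    using pts_neg[OF that \<gamma>(1)] .
  have nn: "?nn \<in> s \<longleftrightarrow> (\<forall>s'\<in>W. s \<subseteq> s' \<longrightarrow> ?n \<notin> s')" if "s \<in> W" for s
    using pts_neg[OF that, of ?n] \<gamma>(1) by simp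
  define h where "h s = (if ?n \<in> s then Fork_b else if ?nn \<in> s then Fork_a else Fork_r)" for s
  have "\<exists>v. \<not> F2 (h t) v"
  proof (rule omission[OF assms(1) _ _ assms(2)])
    show "reflp F2" "transp F2" using is_frame_F2 by (auto simp: is_frame_def)
    show "F2 (h s) (h s')" if "s \<in> W" "s' \<in> W" "s \<subseteq> s'" for s s'
    proof -
      have "?n \<in> s \<Longrightarrow> ?n \<in> s'" "?nn \<in> s \<Longrightarrow> ?nn \<in> s'" using that by auto
      moreover have "?nn \<in> s' \<Longrightarrow> ?n \<notin> s'" using nn[of s'] that by auto
      ultimately show ?thesis by (auto simp: h_def F2_def)
    qed
    show "\<exists>s'\<in>W. s \<subseteq> s' \<and> h s' = v" if s: "s \<in> W" "F2 (h s) v" for s v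
    proof (cases "v = h s")
      case False
      then have r: "h s = Fork_r" and v: "v = Fork_a \<or> v = Fork_b" using s fork.exhaust[of v] by (auto simp: F2_def)
      then have "?n \<notin> s" "?nn \<notin> s" by (auto simp: h_def split: if_splits)
      then obtain s1 s2 where *: "s1 \<in> W" "s \<subseteq> s1" "\<gamma> \<in> s1" "s2 \<in> W" "s \<subseteq> s2" "?n \<in> s2"
        using n[OF s(1)] nn[OF s(1)] by blast
      then have "?n \<notin> s1" "?nn \<in> s1" using n[of s1] nn[of s1] n by blast+
      then have "h s1 = Fork_a" "h s2 = Fork_b" using * by (auto simp: h_def)
      then show ?thesis using v * by blast
    qed (use s in auto)
    show "\<exists>A\<in>Fm X. \<forall>s\<in>W. t \<subseteq> s \<longrightarrow> (A \<in> s \<longleftrightarrow> F2 v (h s))" for v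
    proof (cases v)
      case Fork_r
      then show ?thesis by (intro bexI[of _ Top]) (auto simp: pts_Top F2_def)
    next
      case Fork_a
      then show ?thesis using \<gamma>(1) nn by (intro bexI[of _ ?nn]) (auto simp: F2_def h_def)
    next
      case Fork_b
      then show ?thesis using \<gamma>(1) nn by (intro bexI[of _ ?n]) (auto simp: F2_def h_def)
    qed
  qed
  moreover have "\<gamma> \<in> m" using \<gamma>(2) assms(3) by blast
  then have "?n \<notin> t" using n[OF assms(2)] assms(3,5) is_max_pts by blast
  moreover have "?n \<in> m'"
    using \<gamma>(2)[OF assms(4)] \<open>m' \<noteq> m\<close> is_max_neg[OF assms(4) \<gamma>(1)] by simp
  then have "?nn \<notin> t" using nn[OF assms(2)] assms(4,6) is_max_pts by blast
  ultimately show False by (auto simp: h_def F2_def)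
qed

end

section \<open>Stratified canonical models\<close>

text \<open>Two cases are treated at once. If \<open>L\<close> omits \<open>R2\<close> and \<open>G3\<close>, then \<open>Z\<close> is falsity and \<open>E\<close> defines the
  maximal points. If \<open>L\<close> omits \<open>F2\<close>, \<open>R2+\<close> and \<open>G3+\<close>, then \<open>Z\<close> defines the maximal points and \<open>E\<close> the
  points of depth at most two. Either way each cone is a chain, on top of it an antichain (the points
  satisfying \<open>E\<close> but not \<open>Z\<close>), on top of it at most one point (satisfying \<open>Z\<close>).\<close>

locale stratified = finite_canonical +
  fixes Z E :: fm
  assumes Z_Fm [simp]: "Z \<in> Fm X" and E_Fm [simp]: "E \<in> Fm X"
    and Z_E: "t \<in> W \<Longrightarrow> Z \<in> t \<Longrightarrow> E \<in> t"
    and omits_cases: "(\<forall>t\<in>W. Z \<notin> t) \<and> omits L R2 \<and> omits L G3 \<or>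
      (\<forall>t\<in>W. \<exists>s\<in>W. t \<subseteq> s \<and> Z \<in> s) \<and> omits L (add_top R2) \<and> omits L (add_top G3)"
    and Z_unique: "t \<in> W \<Longrightarrow> u \<in> W \<Longrightarrow> u' \<in> W \<Longrightarrow> t \<subseteq> u \<Longrightarrow> t \<subseteq> u' \<Longrightarrow> Z \<in> u \<Longrightarrow> Z \<in> u' \<Longrightarrow> u' = u"
    and mid_above: "t \<in> W \<Longrightarrow> Z \<notin> t \<Longrightarrow> \<exists>v\<in>W. t \<subseteq> v \<and> E \<in> v \<and> Z \<notin> v"
    and mid_antichain: "v \<in> W \<Longrightarrow> v' \<in> W \<Longrightarrow> v \<subseteq> v' \<Longrightarrow> E \<in> v \<Longrightarrow> Z \<notin> v' \<Longrightarrow> v' = v"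
    and mid_isolated: "t \<in> W \<Longrightarrow> a \<in> W \<Longrightarrow> t \<subseteq> a \<Longrightarrow> E \<in> a \<Longrightarrow> Z \<notin> a \<Longrightarrow>
      \<exists>\<gamma>\<in>Fm X. \<forall>v\<in>W. t \<subseteq> v \<longrightarrow> E \<in> v \<longrightarrow> Z \<notin> v \<longrightarrow> (\<gamma> \<in> v \<longleftrightarrow> v = a)"
    and finite_E: "finite {u\<in>W. E \<in> u}"
begin

text \<open>Lets one map serve both cases: \<open>h\<close> matters only off \<open>Z\<close>, and
  in the second case the points satisfying \<open>Z\<close> are sent to the added top.\<close>

lemma stratified_omission:
  fixes G :: "('w::finite) frame"
  assumes om: "(\<forall>t\<in>W. Z \<notin> t) \<and> omits L G \<or> (\<forall>t\<in>W. \<exists>s\<in>W. t \<subseteq> s \<and> Z \<in> s) \<and> omits L (add_top G)"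
    and G: "is_frame G" and t: "t \<in> W" "Z \<notin> t"
    and zig: "\<And>s s'. s \<in> W \<Longrightarrow> s' \<in> W \<Longrightarrow> t \<subseteq> s \<Longrightarrow> s \<subseteq> s' \<Longrightarrow> Z \<notin> s' \<Longrightarrow> G (h s) (h s')"
    and zag: "\<And>s v. s \<in> W \<Longrightarrow> t \<subseteq> s \<Longrightarrow> Z \<notin> s \<Longrightarrow> G (h s) v \<Longrightarrow> \<exists>s'\<in>W. s \<subseteq> s' \<and> Z \<notin> s' \<and> h s' = v"
    and dfn: "\<And>v. \<exists>A\<in>Fm X. \<forall>s\<in>W. t \<subseteq> s \<longrightarrow> (A \<in> s \<longleftrightarrow> Z \<in> s \<or> G v (h s))"
  shows "\<exists>v. \<not> G (h t) v"
  using om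
proof
  assume *: "(\<forall>t\<in>W. Z \<notin> t) \<and> omits L G"
  show ?thesis
  proof (rule omission[where h = h])
    show "omits L G" "reflp G" "transp G" "t \<in> W" using * G t by (auto simp: is_frame_def)
    show "G (h s) (h s')" if "s \<in> W" "s' \<in> W" "t \<subseteq> s" "s \<subseteq> s'" for s s'
      using zig[OF that] * that by blast
    show "\<exists>s'\<in>W. s \<subseteq> s' \<and> h s' = v" if "s \<in> W" "t \<subseteq> s" "G (h s) v" for s v
    proof -
      have "Z \<notin> s" using * that(1) by blast
      then show ?thesis using zag[OF that(1,2) _ that(3)] by blast
    qed
    show "\<exists>A\<in>Fm X. \<forall>s\<in>W. t \<subseteq> s \<longrightarrow> (A \<in> s \<longleftrightarrow> G v (h s))" for v
    proof -
      obtain A where A: "A \<in> Fm X" "\<forall>s\<in>W. t \<subseteq> s \<longrightarrow> (A \<in> s \<longleftrightarrow> Z \<in> s \<or> G v (h s))"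
        using dfn[of v] by blast
      have "\<forall>s\<in>W. t \<subseteq> s \<longrightarrow> (A \<in> s \<longleftrightarrow> G v (h s))"
        using A(2) conjunct1[OF *] by simp
      then show ?thesis using A(1) by blast
    qed
  qed
next
  assume *: "(\<forall>t\<in>W. \<exists>s\<in>W. t \<subseteq> s \<and> Z \<in> s) \<and> omits L (add_top G)"
  define k where "k s = (if Z \<in> s then None else Some (h s))" for s
  have "\<exists>v. \<not> add_top G (k t) v"
  proof (rule omission[where h = k])
    show "omits L (add_top G)" "reflp (add_top G)" "transp (add_top G)" "t \<in> W"
      using * is_frame_add_top[OF G] t by (auto simp: is_frame_def)
    show "add_top G (k s) (k s')" if "s \<in> W" "s' \<in> W" "t \<subseteq> s" "s \<subseteq> s'" for s s'
      using zig[OF that] that(4) by (auto simp: k_def add_top_def)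
    show "\<exists>s'\<in>W. s \<subseteq> s' \<and> k s' = v" if s: "s \<in> W" "t \<subseteq> s" "add_top G (k s) v" for s v
    proof (cases v)
      case None
      then show ?thesis using * s(1) by (auto simp: k_def)
    next
      case (Some u)
      then have "Z \<notin> s" "G (h s) u" using s(3) by (auto simp: k_def add_top_def split: if_splits)
      then show ?thesis using zag[OF s(1,2), of u] Some by (auto simp: k_def)
    qed
    show "\<exists>A\<in>Fm X. \<forall>s\<in>W. t \<subseteq> s \<longrightarrow> (A \<in> s \<longleftrightarrow> add_top G v (k s))" for v
    proof (cases v)
      case None
      then show ?thesis by (intro bexI[of _ Z]) (auto simp: k_def add_top_def)
    next
      case (Some u)
      then have "add_top G v (k s) \<longleftrightarrow> Z \<in> s \<or> G u (h s)" for s by (auto simp: k_def add_top_def)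
      then show ?thesis using dfn[of u] by simp
    qed
  qed
  then obtain v where "\<not> add_top G (k t) v" by blast
  then show ?thesis using t by (auto simp: k_def add_top_def split: option.splits)
qed

text \<open>Two incomparable lower points are separated by formulas in both directions. Classifying
  points by which of the implications \<open>I1\<close>, \<open>I2\<close> they force would then
  give a p-morphism onto \<open>R2\<close>.\<close>

lemma lower_chain:
  assumes t: "t \<in> W" and s: "s \<in> W" "t \<subseteq> s" "E \<notin> s" and s': "s' \<in> W" "t \<subseteq> s'" "E \<notin> s'"
  shows "s \<subseteq> s' \<or> s' \<subseteq> s"
proof (rule ccontr)
  assume "\<not> ?thesis"
  then obtain A B where A: "A \<in> s" "A \<notin> s'" and B: "B \<in> s'" "B \<notin> s" by blast
  have AB: "A \<in> Fm X" "B \<in> Fm X" using A(1) B(1) s(1) s'(1) pts_Fm by blast+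
  \<comment> \<open>The disjunct \<open>E\<close> makes both implications true at all points
    satisfying \<open>E\<close>; these supply the preimages of the top of \<open>R2\<close>.\<close>
  define P where "P = Or A E"
  define Q where "Q = Or B E"
  have PQ: "P \<in> Fm X" "Q \<in> Fm X" by (auto simp: P_def Q_def AB)
  have E_PQ: "P \<in> u" "Q \<in> u" if "u \<in> W" "E \<in> u" for u
    using that by (simp_all add: P_def Q_def AB)
  define I1 where "I1 = Imp P Q"
  define I2 where "I2 = Imp Q P"
  have I_Fm: "I1 \<in> Fm X" "I2 \<in> Fm X" by (auto simp: I1_def I2_def PQ)
  have I1: "I1 \<in> u \<longleftrightarrow> (\<forall>v\<in>W. u \<subseteq> v \<longrightarrow> P \<in> v \<longrightarrow> Q \<in> v)" if "u \<in> W" for u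
    unfolding I1_def using pts_Imp[OF that PQ] .
  have I2: "I2 \<in> u \<longleftrightarrow> (\<forall>v\<in>W. u \<subseteq> v \<longrightarrow> Q \<in> v \<longrightarrow> P \<in> v)" if "u \<in> W" for u
    unfolding I2_def using pts_Imp[OF that PQ(2,1)] .
  have E_I: "I1 \<in> u" "I2 \<in> u" if "u \<in> W" "E \<in> u" for u
    using I1[OF that(1)] I2[OF that(1)] E_PQ that by blast+
  define h where "h u = (if I1 \<in> u then if I2 \<in> u then None else Some Fork_a
     else if I2 \<in> u then Some Fork_b else Some Fork_r)" for u
  have "\<exists>v. \<not> R2 (h t) v"
  proof (rule stratified_omission)
    show "is_frame R2" by (simp add: R2_def is_frame_add_top is_frame_F2)
    show "t \<in> W" by fact
    show "Z \<notin> t" using Z_E[OF t] s by blast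
    show "R2 (h u) (h u')" if "u \<subseteq> u'" for u u'
    proof -
      have "I1 \<in> u \<Longrightarrow> I1 \<in> u'" "I2 \<in> u \<Longrightarrow> I2 \<in> u'" using that by auto
      then show ?thesis by (auto simp: h_def R2_def F2_def add_top_def)
    qed
    show "\<exists>u'\<in>W. u \<subseteq> u' \<and> Z \<notin> u' \<and> h u' = v" if u: "u \<in> W" "Z \<notin> u" "R2 (h u) v" for u v
    proof (cases "v = h u")
      case False
      then consider "v = None" | "h u = Some Fork_r" "v = Some Fork_a" | "h u = Some Fork_r" "v = Some Fork_b"
        using u(3) fork.exhaust by (auto simp: R2_def F2_def add_top_def split: option.splits)
      then show ?thesis
      proof cases
        case 1
        obtain u' where "u' \<in> W" "u \<subseteq> u'" "E \<in> u'" "Z \<notin> u'" using mid_above[OF u(1,2)] by blast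
        then show ?thesis using E_I[of u'] 1 by (intro bexI[of _ u']) (auto simp: h_def)
      next
        case 2
        then have "I2 \<notin> u" by (auto simp: h_def split: if_splits)
        then obtain u' where u': "u' \<in> W" "u \<subseteq> u'" "Q \<in> u'" "P \<notin> u'" using I2[OF u(1)] by blast
        have "I1 \<in> u'" "I2 \<notin> u'" using I1[OF u'(1)] I2[OF u'(1)] u' by blast+
        moreover have "Z \<notin> u'" using u'(1,4) E_PQ Z_E by blast
        ultimately show ?thesis using u' 2 by (intro bexI[of _ u']) (auto simp: h_def)
      next
        case 3
        then have "I1 \<notin> u" by (auto simp: h_def split: if_splits)
        then obtain u' where u': "u' \<in> W" "u \<subseteq> u'" "P \<in> u'" "Q \<notin> u'" using I1[OF u(1)] by blast
        have "I2 \<in> u'" "I1 \<notin> u'" using I1[OF u'(1)] I2[OF u'(1)] u' by blast+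
        moreover have "Z \<notin> u'" using u'(1,4) E_PQ Z_E by blast
        ultimately show ?thesis using u' 3 by (intro bexI[of _ u']) (auto simp: h_def)
      qed
    qed (use u in auto)
    have ZI: "I1 \<in> u" "I2 \<in> u" if "u \<in> W" "Z \<in> u" for u using E_I Z_E that by blast+
    show "\<exists>A\<in>Fm X. \<forall>u\<in>W. t \<subseteq> u \<longrightarrow> (A \<in> u \<longleftrightarrow> Z \<in> u \<or> R2 v (h u))" for v
    proof (cases v)
      case None
      then show ?thesis using ZI I_Fm
        by (intro bexI[of _ "And I1 I2"]) (auto simp: R2_def F2_def add_top_def h_def)
    next
      case (Some w)
      show ?thesis
      proof (cases w)
        case Fork_r
        then show ?thesis using Some
          by (intro bexI[of _ Top]) (auto simp: pts_Top R2_def F2_def add_top_def split: option.splits)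
      next
        case Fork_a
        then show ?thesis using Some ZI I_Fm
          by (intro bexI[of _ I1]) (auto simp: R2_def F2_def add_top_def h_def)
      next
        case Fork_b
        then show ?thesis using Some ZI I_Fm
          by (intro bexI[of _ I2]) (auto simp: R2_def F2_def add_top_def h_def)
      qed
    qed
  qed (use omits_cases in blast)
  moreover have "R2 (Some Fork_r) v" for v by (auto simp: R2_def F2_def add_top_def split: option.splits)
  ultimately have "h t \<noteq> Some Fork_r" by metis
  then have "I1 \<in> t \<or> I2 \<in> t" by (auto simp: h_def split: if_splits)
  moreover have "P \<in> s" "Q \<notin> s" "P \<notin> s'" "Q \<in> s'"
    using A B AB s s' by (simp_all add: P_def Q_def)
  ultimately show False using I1[OF t] I2[OF t] s s' by blast
qed

text \<open>If \<open>a\<close> were not above \<open>s\<close>, a formula isolating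
  \<open>a\<close> would yield a map onto \<open>G3\<close> that sends \<open>a\<close> to
  \<open>G3_a\<close> and \<open>s\<close> to \<open>G3_b\<close>.\<close>

lemma upper_above_lower:
  assumes t: "t \<in> W" and s: "s \<in> W" "t \<subseteq> s" "E \<notin> s" and a: "a \<in> W" "t \<subseteq> a" "E \<in> a" "Z \<notin> a"
  shows "s \<subseteq> a"
proof (rule ccontr)
  assume sa: "\<not> s \<subseteq> a"
  obtain \<gamma> where \<gamma>: "\<gamma> \<in> Fm X"
      "\<And>v. v \<in> W \<Longrightarrow> t \<subseteq> v \<Longrightarrow> E \<in> v \<Longrightarrow> Z \<notin> v \<Longrightarrow> \<gamma> \<in> v \<longleftrightarrow> v = a"
    using mid_isolated[OF t a] by blast
  \<comment> \<open>Negation and double negation of \<gamma> with \<open>Z\<close> in the place of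
    falsity. Above \<open>t\<close>, \<alpha> says that \<open>a\<close> cannot be reached, and
    \<beta> that no other member of the antichain can.\<close>
  define \<alpha> where "\<alpha> = Imp \<gamma> Z"
  define \<beta> where "\<beta> = Imp \<alpha> Z"
  have Fm: "\<alpha> \<in> Fm X" "\<beta> \<in> Fm X" by (auto simp: \<alpha>_def \<beta>_def \<gamma>(1))
  have \<alpha>: "\<alpha> \<in> u \<longleftrightarrow> (\<forall>v\<in>W. u \<subseteq> v \<longrightarrow> \<gamma> \<in> v \<longrightarrow> Z \<in> v)" if "u \<in> W" for u
    unfolding \<alpha>_def using pts_Imp[OF that \<gamma>(1) Z_Fm] .
  have \<beta>: "\<beta> \<in> u \<longleftrightarrow> (\<forall>v\<in>W. u \<subseteq> v \<longrightarrow> \<alpha> \<in> v \<longrightarrow> Z \<in> v)" if "u \<in> W" for u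
    unfolding \<beta>_def using pts_Imp[OF that Fm(1) Z_Fm] .
  have not_both: "\<not> (\<alpha> \<in> u \<and> \<beta> \<in> u)" if "u \<in> W" "Z \<notin> u" for u
    using \<beta>[OF that(1)] that by blast
  have mid_\<alpha>: "\<alpha> \<in> v \<longleftrightarrow> v \<noteq> a" if v: "v \<in> W" "t \<subseteq> v" "E \<in> v" "Z \<notin> v" for v
  proof -
    have "\<alpha> \<in> v \<longleftrightarrow> \<gamma> \<notin> v"
      using \<alpha>[OF v(1)] mid_antichain[OF v(1) _ _ v(3)] v(1,4) by blast
    then show ?thesis using \<gamma>(2)[OF v] by blast
  qed
  have mid_\<beta>: "\<beta> \<in> v \<longleftrightarrow> v = a" if v: "v \<in> W" "t \<subseteq> v" "E \<in> v" "Z \<notin> v" for v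
  proof -
    have "\<beta> \<in> v \<longleftrightarrow> \<alpha> \<notin> v"
      using \<beta>[OF v(1)] mid_antichain[OF v(1) _ _ v(3)] v(1,4) by blast
    then show ?thesis using mid_\<alpha>[OF v] by blast
  qed
  have Z\<alpha>: "\<alpha> \<in> u" "\<beta> \<in> u" if "u \<in> W" "Z \<in> u" for u
    using \<alpha>[OF that(1)] \<beta>[OF that(1)] that(2) by blast+
  have \<alpha>s: "\<alpha> \<in> s"
  proof -
    have "Z \<in> v" if v: "v \<in> W" "s \<subseteq> v" "\<gamma> \<in> v" for v
    proof (rule ccontr)
      assume "Z \<notin> v"
      then obtain v' where v': "v' \<in> W" "v \<subseteq> v'" "E \<in> v'" "Z \<notin> v'" using mid_above[OF v(1)] by blast
      then have "v' = a" using \<gamma>(2)[of v'] v s by blast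
      then show False using v v' sa by blast
    qed
    then show ?thesis using \<alpha>[OF s(1)] by blast
  qed
  have Zs: "Z \<notin> s" using Z_E s by blast
  define h where "h u = (if \<beta> \<in> u then G3_a else if \<alpha> \<in> u then if E \<in> u then G3_c else G3_b else G3_r)" for u
  have hs: "h s = G3_b" using \<alpha>s not_both[OF s(1) Zs] s by (auto simp: h_def)
  have ha: "h a = G3_a" using mid_\<beta>[OF a] by (auto simp: h_def)
  have "\<exists>v. \<not> G3 (h t) v"
  proof (rule stratified_omission)
    show "is_frame G3" by (rule is_frame_G3)
    show "t \<in> W" by fact
    show "Z \<notin> t" using Zs s by blast
    show "G3 (h u) (h u')" if "u \<in> W" "u' \<in> W" "t \<subseteq> u" "u \<subseteq> u'" "Z \<notin> u'" for u u'
    proof -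
      have "\<alpha> \<in> u \<Longrightarrow> \<alpha> \<in> u'" "\<beta> \<in> u \<Longrightarrow> \<beta> \<in> u'" "E \<in> u \<Longrightarrow> E \<in> u'" using that by auto
      then show ?thesis using not_both[of u'] that by (auto simp: h_def G3_def)
    qed
    show "\<exists>u'\<in>W. u \<subseteq> u' \<and> Z \<notin> u' \<and> h u' = v"
      if u: "u \<in> W" "t \<subseteq> u" "Z \<notin> u" "G3 (h u) v" for u v
    proof (cases "v = h u")
      case False
      have c: "\<exists>u'\<in>W. u' \<supseteq> w \<and> Z \<notin> u' \<and> h u' = G3_c" if w: "w \<in> W" "Z \<notin> w" "\<alpha> \<in> w" for w
      proof -
        obtain u' where u': "u' \<in> W" "w \<subseteq> u'" "E \<in> u'" "Z \<notin> u'" using mid_above[OF w(1,2)] by blast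
        have "\<alpha> \<in> u'" using w u' by blast
        then show ?thesis using u' not_both[OF u'(1,4)] by (intro bexI[of _ u']) (auto simp: h_def)
      qed
      show ?thesis
      proof (cases "h u = G3_b")
        case True
        then have "v = G3_c" using False u(4) by (auto simp: G3_def)
        moreover have "\<alpha> \<in> u" using True by (auto simp: h_def split: if_splits)
        ultimately show ?thesis using c[OF u(1,3)] by blast
      next
        case b: False
        then have r: "h u = G3_r" using False u(4) by (auto simp: G3_def)
        then have nu: "\<alpha> \<notin> u" "\<beta> \<notin> u" by (auto simp: h_def split: if_splits)
        have "E \<notin> u" using mid_\<alpha>[OF u(1,2) _ u(3)] mid_\<beta>[OF u(1,2) _ u(3)] nu by blast
        \<comment> \<open>\<open>s\<close> forces \<alpha> and \<open>u\<close> does not, so among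
          the two comparable lower points \<open>u\<close> is the lower one.\<close>
        then have us: "u \<subseteq> s" using lower_chain[OF t u(1,2) _ s] \<alpha>s nu(1) by blast
        obtain w where w: "w \<in> W" "u \<subseteq> w" "\<gamma> \<in> w" "Z \<notin> w" using \<alpha>[OF u(1)] nu by blast
        obtain w' where w': "w' \<in> W" "w \<subseteq> w'" "E \<in> w'" "Z \<notin> w'" using mid_above[OF w(1,4)] by blast
        have "w' = a" using \<gamma>(2)[of w'] w w' u by blast
        then have "u \<subseteq> a" using w w' by blast
        moreover obtain u' where "u' \<in> W" "s \<subseteq> u'" "Z \<notin> u'" "h u' = G3_c" using c[OF s(1) Zs \<alpha>s] by blast
        moreover have "v = G3_a \<or> v = G3_b \<or> v = G3_c" using False r g3.exhaust by metis
        ultimately show ?thesis using us hs ha s a Zs by blast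
      qed
    qed (use u in auto)
    show "\<exists>A\<in>Fm X. \<forall>u\<in>W. t \<subseteq> u \<longrightarrow> (A \<in> u \<longleftrightarrow> Z \<in> u \<or> G3 v (h u))" for v
    proof (cases v)
      case G3_r
      then show ?thesis by (intro bexI[of _ Top]) (auto simp: pts_Top G3_def)
    next
      case G3_a
      then show ?thesis using Z\<alpha> Fm by (intro bexI[of _ \<beta>]) (auto simp: G3_def h_def)
    next
      case G3_b
      then show ?thesis using Z\<alpha> Fm not_both by (intro bexI[of _ \<alpha>]) (auto simp: G3_def h_def)
    next
      case G3_c
      then show ?thesis using Z\<alpha> Z_E Fm not_both
        by (intro bexI[of _ "And \<alpha> E"]) (auto simp: G3_def h_def)
    qed
  qed (use omits_cases in blast)
  moreover have "\<alpha> \<notin> t" using \<alpha>[OF t] \<gamma>(2)[OF a] a by blast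
  moreover have "\<beta> \<notin> t" using \<beta>[OF t] \<alpha>s s Zs by blast
  ultimately show False by (auto simp: h_def G3_def)
qed

lemma Z_notin_lower: "t \<in> W \<Longrightarrow> E \<notin> t \<Longrightarrow> Z \<notin> t"
  using Z_E by blast

definition upper :: "fm set \<Rightarrow> fm set set" where
  "upper t = {u\<in>W. t \<subseteq> u \<and> E \<in> u \<and> Z \<notin> u}"

definition lower_cols :: "fm set \<Rightarrow> nat set set" where
  "lower_cols t = col X ` {s\<in>W. t \<subseteq> s \<and> E \<notin> s}"

lemma upper_lower_eq:
  assumes "t \<in> W" "s \<in> W" "t \<subseteq> s" "E \<notin> s"
  shows "upper s = upper t"
proof (intro equalityI subsetI)
  fix u assume "u \<in> upper s"
  then show "u \<in> upper t" using assms(3) unfolding upper_def by blast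
next
  fix u assume "u \<in> upper t"
  then show "u \<in> upper s" using upper_above_lower[OF assms] unfolding upper_def by blast
qed

text \<open>The lower points above \<open>t\<close> form a chain, so a point whose colour includes
  that of \<open>s\<close> lies above \<open>s\<close> or has the same colour as
  \<open>s\<close>.\<close>

lemma lower_cols_above:
  assumes "t \<in> W" "s \<in> W" "t \<subseteq> s" "E \<notin> s"
  shows "lower_cols s = {c\<in>lower_cols t. col X s \<subseteq> c}"
proof (intro equalityI subsetI)
  fix c assume "c \<in> lower_cols s"
  then obtain u where "u \<in> W" "s \<subseteq> u" "E \<notin> u" "c = col X u"
    by (auto simp: lower_cols_def)
  moreover from this have "col X s \<subseteq> c" using col_mono by simp
  moreover have "t \<subseteq> u" using assms(3) calculation by simp
  ultimately show "c \<in> {c\<in>lower_cols t. col X s \<subseteq> c}"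
    by (auto simp: lower_cols_def)
next
  fix c assume "c \<in> {c\<in>lower_cols t. col X s \<subseteq> c}"
  then obtain u where u: "u \<in> W" "t \<subseteq> u" "E \<notin> u" "c = col X u" "col X s \<subseteq> col X u"
    by (auto simp: lower_cols_def)
  show "c \<in> lower_cols s"
  proof (cases "s \<subseteq> u")
    case True
    then show ?thesis using u by (auto simp: lower_cols_def)
  next
    case False
    then have "col X u \<subseteq> col X s"
      using lower_chain[OF assms(1,2,3,4) u(1,2,3)] by (intro col_mono) blast
    then have "c = col X s" using u by blast
    then show ?thesis using assms by (auto simp: lower_cols_def)
  qed
qed

text \<open>Agreement in the three data is a bisimulation on lower points: by the two preceding
  lemmas, the data of a lower point above \<open>t\<close> are determined by its colour and the data
  of \<open>t\<close>.\<close>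

lemma lower_eqI:
  assumes t: "t \<in> W" "E \<notin> t" and s: "s \<in> W" "E \<notin> s"
    and eq: "col X t = col X s" "lower_cols t = lower_cols s" "upper t = upper s"
  shows "t = s"
proof -
  define R where "R t s \<longleftrightarrow> (t = s \<or> E \<notin> t \<and> E \<notin> s \<and> col X t = col X s \<and>
    lower_cols t = lower_cols s \<and> upper t = upper s)" for t s
  have zig: "\<exists>s'\<in>W. s \<subseteq> s' \<and> R t' s'"
    if ts: "t \<in> W" "s \<in> W" and R: "R t s" and t': "t' \<in> W" "t \<subseteq> t'" for t s t'
  proof (cases "t = s")
    case True
    then show ?thesis using t' by (auto simp: R_def)
  next
    case False
    then have l: "t \<in> W" "s \<in> W" "E \<notin> t" "E \<notin> s" "col X t = col X s"
      "lower_cols t = lower_cols s" "upper t = upper s"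
      using R ts by (auto simp: R_def)
    show ?thesis
    proof (cases "E \<in> t'")
      case E: True
      have "s \<subseteq> t'"
      proof (cases "Z \<in> t'")
        case False
        then have "t' \<in> upper t" using t' E by (auto simp: upper_def)
        then show ?thesis using l by (auto simp: upper_def)
      next
        case True
        \<comment> \<open>A point satisfying \<open>Z\<close> is reached from \<open>s\<close>
          through an antichain member \<open>v\<close> common to both cones; uniqueness above
          \<open>t\<close> identifies it.\<close>
        obtain v where v: "v \<in> W" "t \<subseteq> v" "E \<in> v" "Z \<notin> v"
          using mid_above[OF l(1)] Z_notin_lower l by blast
        then have "v \<in> upper s" using l(7) by (auto simp: upper_def)
        then have "s \<subseteq> v" by (auto simp: upper_def)
        moreover obtain u where u: "u \<in> W" "v \<subseteq> u" "Z \<in> u"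
          using omits_cases True t'(1) v(1) by blast
        moreover have "u = t'" using Z_unique[OF l(1) t'(1) u(1) t'(2) _ True u(3)] v u by blast
        ultimately show ?thesis by blast
      qed
      then show ?thesis using t' by (auto simp: R_def)
    next
      case E: False
      then have "col X t' \<in> lower_cols s" using t' l(6) by (auto simp: lower_cols_def)
      then obtain s' where s': "s' \<in> W" "s \<subseteq> s'" "E \<notin> s'" "col X t' = col X s'"
        by (auto simp: lower_cols_def)
      have "lower_cols t' = lower_cols s'"
        using lower_cols_above[OF l(1) t' E] lower_cols_above[OF l(2) s'(1,2,3)] s'(4) l(6) by simp
      moreover have "upper t' = upper s'"
        using upper_lower_eq[OF l(1) t' E] upper_lower_eq[OF l(2) s'(1,2,3)] l(7) by simp
      ultimately have "R t' s'" using t' s' E by (simp add: R_def)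
      then show ?thesis using s' by blast
    qed
  qed
  show ?thesis
  proof (rule pts_bisim[where R = R])
    show "col X t = col X s" if "R t s" for t s
      using that unfolding R_def by metis
  qed (use assms zig in \<open>auto simp: R_def\<close>)
qed

lemma finite_pts: "finite W"
proof -
  have "finite {t\<in>W. E \<notin> t}"
  proof (rule finite_imageD)
    let ?f = "\<lambda>t. (col X t, lower_cols t, upper t)"
    show "inj_on ?f {t\<in>W. E \<notin> t}"
      using lower_eqI by (intro inj_onI) simp
    show "finite (?f ` {t\<in>W. E \<notin> t})"
    proof (rule finite_subset)
      show "?f ` {t\<in>W. E \<notin> t} \<subseteq> Pow X \<times> Pow (Pow X) \<times> Pow {u\<in>W. E \<in> u}"
        by (auto simp: col_def lower_cols_def upper_def)
      show "finite (Pow X \<times> Pow (Pow X) \<times> Pow {u\<in>W. E \<in> u})"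
        using finX finite_E by simp
    qed
  qed
  then have "finite ({t\<in>W. E \<notin> t} \<union> {t\<in>W. E \<in> t})" using finite_E by simp
  moreover have "{t\<in>W. E \<notin> t} \<union> {t\<in>W. E \<in> t} = W" by blast
  ultimately show ?thesis by simp
qed

text \<open>The cover is the least of the lower points strictly above \<open>w\<close>. The
  antichain lies above it by \<open>upper_above_lower\<close>, a point satisfying \<open>Z\<close>
  by uniqueness.\<close>

lemma lower_unique_cover:
  assumes w: "w \<in> W" "E \<notin> w" and ex: "v0 \<in> W" "w \<subset> v0" "E \<notin> v0"
  shows "\<exists>v\<in>W. w \<subset> v \<and> (\<forall>u\<in>W. w \<subset> u \<longrightarrow> v \<subseteq> u)"
proof -
  let ?S = "{v\<in>W. w \<subset> v \<and> E \<notin> v}"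
  have "finite ?S" "?S \<noteq> {}" using finite_pts ex by auto
  from finite_has_minimal[OF this] obtain v
    where v: "v \<in> ?S" and "\<forall>u\<in>?S. u \<subseteq> v \<longrightarrow> v = u" by (rule bexE)
  then have v_min: "u = v" if "u \<in> ?S" "u \<subseteq> v" for u using that by blast
  have "v \<subseteq> u" if u: "u \<in> W" "w \<subset> u" for u
  proof (cases "E \<in> u")
    case False
    then show ?thesis using lower_chain[OF w(1), of v u] v v_min[of u] u by blast
  next
    case True
    have "s \<in> upper v \<Longrightarrow> v \<subseteq> s" for s by (auto simp: upper_def)
    show ?thesis
    proof (cases "Z \<in> u")
      case False
      then show ?thesis using upper_above_lower[OF w(1), of v u] v u True by blast
    next
      case Z: True
      obtain s where s: "s \<in> W" "v \<subseteq> s" "Z \<in> s" using omits_cases Z u(1) v(1) by blast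
      then show ?thesis using Z_unique[OF w(1) u(1) s(1) _ _ Z s(3)] u v by blast
    qed
  qed
  then show ?thesis using v by blast
qed

end

section \<open>Projective formulas\<close>

locale tabular = canonical +
  assumes finite_W: "finite W"
begin

text \<open>Each point not above \<open>w\<close> lacks some member of \<open>w\<close>; finitely
  many such members have to be conjoined.\<close>

lemma principal_formula:
  assumes w: "w \<in> W"
  shows "\<exists>\<phi>\<in>Fm X. \<forall>t\<in>W. \<phi> \<in> t \<longleftrightarrow> w \<subseteq> t"
proof -
  have "\<forall>v. \<exists>A. v \<in> W \<longrightarrow> \<not> w \<subseteq> v \<longrightarrow> A \<in> w \<and> A \<notin> v" by blast
  then obtain C where C: "\<And>v. v \<in> W \<Longrightarrow> \<not> w \<subseteq> v \<Longrightarrow> C v \<in> w \<and> C v \<notin> v" by metis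
  let ?S = "C ` {v\<in>W. \<not> w \<subseteq> v}"
  have "?S \<subseteq> Fm X" using C pts_Fm[OF w] by blast
  then obtain \<phi> where \<phi>: "\<phi> \<in> Fm X" "\<And>t. t \<in> W \<Longrightarrow> \<phi> \<in> t \<longleftrightarrow> (\<forall>B\<in>?S. B \<in> t)"
    by (rule pts_conjE[rotated]) (use finite_W in auto)
  have "\<phi> \<in> t \<longleftrightarrow> w \<subseteq> t" if "t \<in> W" for t
    using \<phi>(2)[OF that] C that by auto
  then show ?thesis using \<phi>(1) by blast
qed

lemma definable_upset:
  assumes "U \<subseteq> W" and up: "\<And>t s. t \<in> U \<Longrightarrow> s \<in> W \<Longrightarrow> t \<subseteq> s \<Longrightarrow> s \<in> U"
  shows "\<exists>A\<in>Fm X. \<forall>t\<in>W. A \<in> t \<longleftrightarrow> t \<in> U"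
proof -
  have "\<forall>w\<in>W. \<exists>\<phi>. \<phi> \<in> Fm X \<and> (\<forall>t\<in>W. \<phi> \<in> t \<longleftrightarrow> w \<subseteq> t)" using principal_formula by blast
  then obtain \<phi> where \<phi>: "\<And>w. w \<in> W \<Longrightarrow> \<phi> w \<in> Fm X" "\<And>w t. w \<in> W \<Longrightarrow> t \<in> W \<Longrightarrow> \<phi> w \<in> t \<longleftrightarrow> w \<subseteq> t"
    by metis
  have "finite (\<phi> ` U)" "\<phi> ` U \<subseteq> Fm X"
    using finite_W assms(1) \<phi>(1) by (auto intro: finite_subset)
  then obtain A where A: "A \<in> Fm X" "\<And>t. t \<in> W \<Longrightarrow> A \<in> t \<longleftrightarrow> (\<exists>B\<in>\<phi> ` U. B \<in> t)"
    using pts_disjE by metis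
  have "A \<in> t \<longleftrightarrow> t \<in> U" if "t \<in> W" for t
  proof -
    have "A \<in> t \<longleftrightarrow> (\<exists>u\<in>U. u \<subseteq> t)" using A(2)[OF that] \<phi>(2)[OF _ that] assms(1) by auto
    then show ?thesis using up[OF _ that] by blast
  qed
  then show ?thesis using A(1) by blast
qed

text \<open>Fixing one representative for each up-set keeps the stock of formulas finite when they
  arise from infinitely many unifiers.\<close>

definition definer :: "fm set set \<Rightarrow> fm" where
  "definer U = (SOME A. A \<in> Fm X \<and> (\<forall>t\<in>W. A \<in> t \<longleftrightarrow> t \<in> U))"

lemma definer:
  assumes "U \<subseteq> W" "\<And>t s. t \<in> U \<Longrightarrow> s \<in> W \<Longrightarrow> t \<subseteq> s \<Longrightarrow> s \<in> U"
  shows "definer U \<in> Fm X" "\<And>t. t \<in> W \<Longrightarrow> definer U \<in> t \<longleftrightarrow> t \<in> U"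
proof -
  have "\<exists>A. A \<in> Fm X \<and> (\<forall>t\<in>W. A \<in> t \<longleftrightarrow> t \<in> U)"
    using definable_upset[of U] assms by blast
  then have "definer U \<in> Fm X \<and> (\<forall>t\<in>W. definer U \<in> t \<longleftrightarrow> t \<in> U)"
    unfolding definer_def by (rule someI_ex)
  then show "definer U \<in> Fm X" "\<And>t. t \<in> W \<Longrightarrow> definer U \<in> t \<longleftrightarrow> t \<in> U" by blast+
qed

text \<open>The canonical frame is kept and only its colouring replaced. A colouring is built point
  by point from the top, so monotonicity is required on cones only, by
  \<open>mono_above\<close>.\<close>

definition sat :: "(fm set \<Rightarrow> nat set) \<Rightarrow> fm set \<Rightarrow> fm \<Rightarrow> bool" where
  "sat k t A \<longleftrightarrow> forces (ord W) (\<lambda>x. {v. x \<in> k v}) t A"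

definition mono_above :: "fm set \<Rightarrow> (fm set \<Rightarrow> nat set) \<Rightarrow> bool" where
  "mono_above w k \<longleftrightarrow> (\<forall>u\<in>W. \<forall>v\<in>W. w \<subseteq> u \<longrightarrow> u \<subseteq> v \<longrightarrow> k u \<subseteq> k v)"

lemma mono_aboveD: "mono_above w k \<Longrightarrow> u \<in> W \<Longrightarrow> v \<in> W \<Longrightarrow> w \<subseteq> u \<Longrightarrow> u \<subseteq> v \<Longrightarrow> k u \<subseteq> k v"
  by (simp add: mono_above_def)

lemma mono_above_trans:
  assumes "mono_above w k" "w \<subseteq> v"
  shows "mono_above v k"
  unfolding mono_above_def
proof (intro ballI impI)
  fix u u' assume u: "u \<in> W" "u' \<in> W" "v \<subseteq> u" "u \<subseteq> u'"
  then have "w \<subseteq> u" using assms(2) by simp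
  then show "k u \<subseteq> k u'" using mono_aboveD[OF assms(1)] u by simp
qed

lemma sat_simps [simp]:
  "sat k t (Var x) \<longleftrightarrow> x \<in> k t"
  "\<not> sat k t Bot"
  "sat k t (And A B) \<longleftrightarrow> sat k t A \<and> sat k t B"
  "sat k t (Or A B) \<longleftrightarrow> sat k t A \<or> sat k t B"
  by (auto simp: sat_def)

lemma sat_Imp: "sat k t (Imp A B) \<longleftrightarrow> (\<forall>s\<in>W. t \<subseteq> s \<longrightarrow> sat k s A \<longrightarrow> sat k s B)"
  unfolding sat_def forces.simps ord_def by blast

lemma sat_subst: "sat k t (subst \<sigma> A) \<longleftrightarrow> sat (\<lambda>v. {x. sat k v (\<sigma> x)}) t A"
  by (simp add: sat_def forces_subst)

lemma sat_cong:
  assumes "A \<in> Fm Y" "t \<in> W" "\<And>v x. v \<in> W \<Longrightarrow> t \<subseteq> v \<Longrightarrow> x \<in> Y \<Longrightarrow> x \<in> k v \<longleftrightarrow> x \<in> k' v"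
  shows "sat k t A \<longleftrightarrow> sat k' t A"
  using assms
proof (induction A arbitrary: t)
  case (Imp A B)
  have "sat k s A \<longleftrightarrow> sat k' s A" "sat k s B \<longleftrightarrow> sat k' s B" if s: "s \<in> W" "t \<subseteq> s" for s
  proof -
    have "x \<in> k v \<longleftrightarrow> x \<in> k' v" if "v \<in> W" "s \<subseteq> v" "x \<in> Y" for v x
      using Imp.prems(3) that s by blast
    then show "sat k s A \<longleftrightarrow> sat k' s A" "sat k s B \<longleftrightarrow> sat k' s B"
      using Imp.IH[OF _ s(1)] Imp.prems(1) by simp_all
  qed
  then show ?case unfolding sat_Imp by blast
qed simp_all

lemma sat_col: "t \<in> W \<Longrightarrow> A \<in> Fm X \<Longrightarrow> sat (col X) t A \<longleftrightarrow> A \<in> t"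
proof (induction A arbitrary: t)
  case (Imp A B)
  have "(\<forall>s\<in>W. t \<subseteq> s \<longrightarrow> sat (col X) s A \<longrightarrow> sat (col X) s B) \<longleftrightarrow>
      (\<forall>s\<in>W. t \<subseteq> s \<longrightarrow> A \<in> s \<longrightarrow> B \<in> s)"
    using Imp.IH Imp.prems(2) by simp
  then show ?case using pts_Imp[OF Imp.prems(1)] Imp.prems(2) by (simp add: sat_Imp)
qed (simp_all add: col_def)

lemma sat_mono:
  assumes "mono_above w k" "t \<in> W" "w \<subseteq> t" "s \<in> W" "t \<subseteq> s" "sat k t A"
  shows "sat k s A"
  using assms(2-)
proof (induction A)
  case (Var x)
  then show ?case using mono_aboveD[OF assms(1), of t s] by auto
next
  case (Imp A B)
  then show ?case unfolding sat_Imp by blast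
qed auto

text \<open>A colouring monotone above \<open>w\<close> is definable there, hence is the effect of a
  substitution, and \<open>L\<close> is closed under substitution.\<close>

lemma sat_valid:
  assumes A: "A \<in> L" and w: "w \<in> W" and k: "mono_above w k"
  shows "sat k w A"
proof -
  have "\<exists>B\<in>Fm X. \<forall>t\<in>W. B \<in> t \<longleftrightarrow> t \<in> {v\<in>W. w \<subseteq> v \<and> x \<in> k v}" for x
    by (rule definable_upset) (use mono_aboveD[OF k] in blast)+
  then obtain \<sigma> where \<sigma>: "\<And>x. \<sigma> x \<in> Fm X" "\<And>x t. t \<in> W \<Longrightarrow> \<sigma> x \<in> t \<longleftrightarrow> w \<subseteq> t \<and> x \<in> k t"
    by simp metis
  have "subst \<sigma> A \<in> w"
    using pts_logic[OF w] subst_in_Fm[of A UNIV \<sigma> X] \<sigma>(1) intermediate_logic_subst[OF L A]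
    by (simp add: Fm_def)
  then have "sat (col X) w (subst \<sigma> A)"
    using sat_col[OF w] subst_in_Fm[of A UNIV \<sigma> X] \<sigma>(1) by (simp add: Fm_def)
  then have "sat (\<lambda>v. {x. sat (col X) v (\<sigma> x)}) w A" by (simp add: sat_subst)
  moreover have "x \<in> {x. sat (col X) v (\<sigma> x)} \<longleftrightarrow> x \<in> k v" if "v \<in> W" "w \<subseteq> v" for v x
    using sat_col[OF that(1) \<sigma>(1)] \<sigma>(2)[OF that(1)] that by simp
  ultimately show ?thesis
    using sat_cong[of A UNIV w "\<lambda>v. {x. sat (col X) v (\<sigma> x)}" k] w by (simp add: Fm_def)
qed

lemma sat_theory:
  assumes w: "w \<in> W" and k: "mono_above w k"
  shows "{A\<in>Fm Y. sat k w A} \<in> pts L Y"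
proof -
  have "sat k w A" if "derives L {A\<in>Fm Y. sat k w A} A" for A
    using that
  proof (induction rule: derives.induct)
    case (logic A)
    then show ?case using sat_valid w k by blast
  next
    case (mp A B)
    then show ?case unfolding sat_Imp using w by blast
  qed simp
  then show ?thesis unfolding pts_def by auto
qed

text \<open>With \<open>sat_theory\<close> this makes the passage from a point to its theory under
  \<open>k\<close> a p-morphism into the canonical model.\<close>

lemma sat_theory_zag:
  assumes w: "w \<in> W" and k: "mono_above w k" and u: "u \<in> W" "{A\<in>Fm X. sat k w A} \<subseteq> u"
  shows "\<exists>v\<in>W. w \<subseteq> v \<and> {A\<in>Fm X. sat k v A} = u"
proof (rule ccontr)
  assume *: "\<not> ?thesis"
  obtain \<phi> where \<phi>: "\<phi> \<in> Fm X" "\<And>t. t \<in> W \<Longrightarrow> \<phi> \<in> t \<longleftrightarrow> u \<subseteq> t"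
    using principal_formula[OF u(1)] by blast
  have "\<exists>\<psi>\<in>Fm X. \<forall>t\<in>W. \<psi> \<in> t \<longleftrightarrow> t \<in> {t\<in>W. \<not> t \<subseteq> u}"
    by (rule definable_upset) auto
  then obtain \<psi> where \<psi>: "\<psi> \<in> Fm X" "\<And>t. t \<in> W \<Longrightarrow> \<psi> \<in> t \<longleftrightarrow> \<not> t \<subseteq> u"
    by (metis (no_types, lifting) mem_Collect_eq)
  \<comment> \<open>A canonical point lacks this implication exactly if it lies below
    \<open>u\<close>. If no point above \<open>w\<close> had theory \<open>u\<close>, the
    implication would hold at \<open>w\<close> and so belong to \<open>u\<close>.\<close>
  have "sat k w (Imp \<phi> \<psi>)"
    unfolding sat_Imp
  proof (intro ballI impI)
    fix v assume v: "v \<in> W" "w \<subseteq> v" "sat k v \<phi>"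
    let ?v = "{A\<in>Fm X. sat k v A}"
    have W: "?v \<in> W" using sat_theory[OF v(1) mono_above_trans[OF k v(2)]] .
    have "u \<subseteq> ?v" using \<phi>(2)[OF W] \<phi>(1) v(3) by blast
    moreover have "?v \<noteq> u" using * v by blast
    ultimately have "\<psi> \<in> ?v" using \<psi>(2)[OF W] by blast
    then show "sat k v \<psi>" by simp
  qed
  then have "Imp \<phi> \<psi> \<in> u" using u(2) \<phi>(1) \<psi>(1) by auto
  then have "\<psi> \<in> u" using pts_Imp_D[OF _ u(1) \<phi>(1) \<psi>(1) u(1)] \<phi>(2)[OF u(1)] by blast
  then show False using \<psi>(2)[OF u(1)] by blast
qed

text \<open>Ghilardi's extension property, localized at one point of the canonical frame.\<close>

definition ext_at :: "fm \<Rightarrow> fm set \<Rightarrow> bool" where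
  "ext_at B w \<longleftrightarrow> (\<forall>k. (\<forall>v\<in>W. w \<subset> v \<longrightarrow> mono_above v k \<and> sat k v B) \<longrightarrow>
     (\<exists>c. (\<forall>v\<in>W. w \<subset> v \<longrightarrow> c \<subseteq> k v) \<and> sat (k(w := c)) w B))"

text \<open>Giving \<open>w\<close> the colour of its cover makes the two bisimilar, whatever
  \<open>B\<close> is.\<close>

lemma ext_at_unique_cover:
  assumes w: "w \<in> W" and v: "v \<in> W" "w \<subset> v" "\<And>u. u \<in> W \<Longrightarrow> w \<subset> u \<Longrightarrow> v \<subseteq> u"
  shows "ext_at B w"
  unfolding ext_at_def
proof (intro allI impI)
  fix k assume k: "\<forall>v\<in>W. w \<subset> v \<longrightarrow> mono_above v k \<and> sat k v B"
  have "forces (ord W) (\<lambda>x. {u. x \<in> (k(w := k v)) u}) w B \<longleftrightarrow> forces (ord W) (\<lambda>x. {u. x \<in> k u}) v B"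
  proof (rule forces_bisim[where X = UNIV and R = "\<lambda>a b. a = w \<and> b = v \<or> a = b \<and> v \<subseteq> a"])
    show "\<exists>b'. ord W b b' \<and> (a' = w \<and> b' = v \<or> a' = b' \<and> v \<subseteq> a')"
      if "a = w \<and> b = v \<or> a = b \<and> v \<subseteq> a" "ord W a a'" for a b a'
    proof (cases "a' = w")
      case True
      then show ?thesis using that v by (auto simp: ord_def)
    next
      case False
      then have "v \<subseteq> a'" using that v(3)[of a'] by (auto simp: ord_def)
      then show ?thesis using that by (auto simp: ord_def)
    qed
    show "\<exists>a'. ord W a a' \<and> (a' = w \<and> b' = v \<or> a' = b' \<and> v \<subseteq> a')"
      if "a = w \<and> b = v \<or> a = b \<and> v \<subseteq> a" "ord W b b'" for a b b'
      using that v(2) by (intro exI[of _ b']) (auto simp: ord_def)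
  qed (use v(2) in auto)
  then have "sat (k(w := k v)) w B" using k v by (auto simp: sat_def)
  moreover have "\<forall>u\<in>W. w \<subset> u \<longrightarrow> k v \<subseteq> k u"
  proof (intro ballI impI)
    fix u assume u: "u \<in> W" "w \<subset> u"
    have "mono_above v k" using k v(1,2) by simp
    then show "k v \<subseteq> k u" using mono_aboveD[of v k v u] v u by simp
  qed
  ultimately show "\<exists>c. (\<forall>v\<in>W. w \<subset> v \<longrightarrow> c \<subseteq> k v) \<and> sat (k(w := c)) w B" by blast
qed

text \<open>Ghilardi's argument: the valuation is corrected to a model of \<open>B\<close> from the top of the finite
  canonical model downwards, leaving it unchanged where \<open>B\<close> holds already.\<close>

lemma projective_if_ext_at:
  assumes B: "B \<in> Fm X" and ext: "\<And>w. w \<in> W \<Longrightarrow> ext_at B w"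
  shows "\<exists>\<epsilon>. projective_unifier L B \<epsilon> \<and> (\<forall>x\<in>X. \<epsilon> x \<in> Fm X)"
proof -
  \<comment> \<open>The domain of the colouring is an up-set \<open>U\<close>. A minimal point of
    \<open>U\<close> is added last, because what holds at the other points does not depend on its
    colour.\<close>
  have "\<exists>k. (\<forall>w\<in>U. mono_above w k \<and> sat k w B \<and> (B \<in> w \<longrightarrow> k w = col X w))"
    if "U \<subseteq> W" "\<And>t s. t \<in> U \<Longrightarrow> s \<in> W \<Longrightarrow> t \<subseteq> s \<Longrightarrow> s \<in> U" for U
    using finite_subset[OF that(1) finite_W] that
  proof (induction U rule: finite_psubset_induct)
    case (psubset U)
    show ?case
    proof (cases "U = {}")
      case False
      obtain w where w: "w \<in> U" "\<And>t. t \<in> U \<Longrightarrow> t \<subseteq> w \<Longrightarrow> t = w"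
        using finite_has_minimal[OF psubset.hyps False] by blast
      have wW: "w \<in> W" using w(1) psubset.prems(1) by blast
      let ?U = "U - {w}"
      have up: "s \<in> ?U" if "t \<in> ?U" "s \<in> W" "t \<subseteq> s" for t s
        using psubset.prems(2)[of t s] w(2)[of t] that by blast
      have "\<exists>k. \<forall>v\<in>?U. mono_above v k \<and> sat k v B \<and> (B \<in> v \<longrightarrow> k v = col X v)"
      proof (rule psubset.IH)
        show "?U \<subset> U" "?U \<subseteq> W" using psubset.prems(1) w(1) by auto
      qed (rule up)
      then obtain k where k: "\<And>v. v \<in> ?U \<Longrightarrow> mono_above v k \<and> sat k v B \<and> (B \<in> v \<longrightarrow> k v = col X v)"
        by metis
      have above: "v \<in> ?U" if "v \<in> W" "w \<subset> v" for v
        using psubset.prems(2)[OF w(1), of v] that by blast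
      have "\<exists>c. (\<forall>v\<in>W. w \<subset> v \<longrightarrow> c \<subseteq> k v) \<and> sat (k(w := c)) w B \<and> (B \<in> w \<longrightarrow> c = col X w)"
      proof (cases "B \<in> w")
        case False
        have "\<forall>v\<in>W. w \<subset> v \<longrightarrow> mono_above v k \<and> sat k v B" using k above by blast
        from ext[OF wW, unfolded ext_at_def, THEN spec, THEN HOL.mp, OF this] False
        show ?thesis by simp
      next
        case True
        \<comment> \<open>\<open>B\<close> persists upwards, so the colouring above \<open>w\<close>
          is still the canonical one, and \<open>w\<close> can keep its own colour.\<close>
        have kv: "k v = col X v" if "v \<in> W" "w \<subset> v" for v
          using k[OF above[OF that]] True that by blast
        have "x \<in> (k(w := col X w)) v \<longleftrightarrow> x \<in> col X v" if "v \<in> W" "w \<subseteq> v" for v x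
          using kv[of v] that by (cases "v = w") auto
        then have "sat (k(w := col X w)) w B \<longleftrightarrow> sat (col X) w B"
          using sat_cong[OF B wW] by blast
        then have "sat (k(w := col X w)) w B" using sat_col[OF wW B] True by simp
        moreover have "\<forall>v\<in>W. w \<subset> v \<longrightarrow> col X w \<subseteq> k v" using kv col_mono by auto
        ultimately show ?thesis by blast
      qed
      then obtain c where c: "\<And>v. v \<in> W \<Longrightarrow> w \<subset> v \<Longrightarrow> c \<subseteq> k v" "sat (k(w := c)) w B" "B \<in> w \<Longrightarrow> c = col X w"
        by metis
      let ?k = "k(w := c)"
      have "mono_above v ?k \<and> sat ?k v B \<and> (B \<in> v \<longrightarrow> ?k v = col X v)" if v: "v \<in> U" for v
      proof (cases "v = w")
        case True
        have "?k a \<subseteq> ?k b" if "a \<in> W" "b \<in> W" "w \<subseteq> a" "a \<subseteq> b" for a b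
        proof (cases "a = w")
          case True
          then show ?thesis using c(1)[OF that(2)] that by (cases "b = w") auto
        next
          case False
          then have "b \<noteq> w" "w \<subset> a" using that by auto
          then show ?thesis
            using mono_aboveD[of a k a b] k[OF above[OF that(1)]] that False by simp
        qed
        then have "mono_above w ?k" unfolding mono_above_def by blast
        then show ?thesis using True c by simp
      next
        case False
        then have vU: "v \<in> ?U" and vW: "v \<in> W" using v psubset.prems(1) by auto
        have ne: "a \<noteq> w" if "v \<subseteq> a" for a using w(2)[OF v] False that by blast
        have "mono_above v k" using k[OF vU] by blast
        then have "mono_above v ?k" using ne unfolding mono_above_def by auto
        moreover have "sat ?k v B \<longleftrightarrow> sat k v B"
          by (rule sat_cong[OF B vW]) (use ne in auto)
        ultimately show ?thesis using k[OF vU] False by simp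
      qed
      then show ?thesis by blast
    qed simp
  qed
  from this[of W] obtain k where k: "\<And>w. w \<in> W \<Longrightarrow> mono_above w k"
      "\<And>w. w \<in> W \<Longrightarrow> sat k w B" "\<And>w. w \<in> W \<Longrightarrow> B \<in> w \<Longrightarrow> k w = col X w" by blast
  have "\<exists>A\<in>Fm X. \<forall>t\<in>W. A \<in> t \<longleftrightarrow> t \<in> {v\<in>W. x \<in> k v}" for x
    by (rule definable_upset) (use mono_aboveD[OF k(1)] in blast)+
  then obtain \<sigma> where \<sigma>: "\<And>x. \<sigma> x \<in> Fm X" "\<And>x t. t \<in> W \<Longrightarrow> \<sigma> x \<in> t \<longleftrightarrow> x \<in> k t"
    by simp metis
  \<comment> \<open>Reads the corrected colouring as a substitution. It was left canonical where
    \<open>B\<close> holds, so modulo \<open>B\<close> this is the identity on \<open>X\<close>; off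
    \<open>X\<close> it is the identity outright.\<close>
  define \<epsilon> where "\<epsilon> x = (if x \<in> X then \<sigma> x else Var x)" for x
  have \<epsilon>B: "subst \<epsilon> B \<in> Fm X" using subst_in_Fm[OF B] \<sigma>(1) by (simp add: \<epsilon>_def)
  have "subst \<epsilon> B \<in> w" if w: "w \<in> W" for w
  proof -
    have "x \<in> {x. sat (col X) v (\<epsilon> x)} \<longleftrightarrow> x \<in> k v" if "v \<in> W" "x \<in> X" for v x
      using that \<sigma>(2) sat_col[OF that(1) \<sigma>(1)] by (simp add: \<epsilon>_def)
    then have "sat (\<lambda>v. {x. sat (col X) v (\<epsilon> x)}) w B \<longleftrightarrow> sat k w B"
      by (intro sat_cong[OF B w])
    then show ?thesis using k(2)[OF w] sat_col[OF w \<epsilon>B] by (simp add: sat_subst)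
  qed
  then have "unifier L B \<epsilon>" using pts_complete[OF \<epsilon>B] by (simp add: unifier_def)
  moreover have "derives L {B} (Iff (\<epsilon> x) (Var x))" for x
  proof (cases "x \<in> X")
    case True
    show ?thesis
    proof (rule pts_derives)
      show "{B} \<subseteq> Fm X" "Iff (\<epsilon> x) (Var x) \<in> Fm X" using B True \<sigma>(1) by (auto simp: \<epsilon>_def)
      fix t assume t: "t \<in> W" "{B} \<subseteq> t"
      have "\<sigma> x \<in> s \<longleftrightarrow> Var x \<in> s" if "s \<in> W" "t \<subseteq> s" for s
        using \<sigma>(2)[OF that(1)] k(3)[OF that(1)] that t True by (auto simp: col_def)
      then show "Iff (\<epsilon> x) (Var x) \<in> t"
        using t True \<sigma>(1) by (simp add: \<epsilon>_def pts_Imp)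
    qed
  next
    case False
    have "Imp (Var x) (Var x) \<in> L"
      using derives_Imp_iff[OF L] derives_empty_iff[OF L] derives.hyp by blast
    then have "derives L {B} (Imp (Var x) (Var x))" by (rule derives.logic)
    then have "derives L {B} (Iff (Var x) (Var x))"
      using derives_IPC_mp[OF L ax_andI] derives.mp by blast
    then show ?thesis using False by (simp add: \<epsilon>_def)
  qed
  ultimately show ?thesis
    unfolding projective_unifier_def using \<sigma>(1) by (intro exI[of _ \<epsilon>]) (simp add: \<epsilon>_def)
qed

end

context stratified
begin

sublocale tabular
  by unfold_locales (rule finite_pts)

text \<open>A point excluded by the restriction has a lower point strictly above it, hence a least
  strict successor whose colour it can copy.\<close>

lemma ext_at_stratified:
  assumes "\<And>w. w \<in> W \<Longrightarrow> (\<And>v. v \<in> W \<Longrightarrow> w \<subset> v \<Longrightarrow> E \<in> v) \<Longrightarrow> ext_at B w" and w: "w \<in> W"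
  shows "ext_at B w"
proof (cases "\<exists>v\<in>W. w \<subset> v \<and> E \<notin> v")
  case True
  then obtain v0 where v0: "v0 \<in> W" "w \<subset> v0" "E \<notin> v0" by blast
  then have "E \<notin> w" by blast
  from lower_unique_cover[OF w this v0] obtain v
    where "v \<in> W" "w \<subset> v" and v: "\<forall>u\<in>W. w \<subset> u \<longrightarrow> v \<subseteq> u" by blast
  then show ?thesis using ext_at_unique_cover[OF w, of v] by simp
next
  case False
  then show ?thesis using assms by blast
qed

end

section \<open>Stratifications from omitted frames\<close>

context finite_canonical
begin

lemma stratified_antichain_top:
  assumes "omits L R2" "omits L G3"
  shows "\<exists>D. stratified L X Bot D \<and> (\<forall>t\<in>W. D \<in> t \<longleftrightarrow> is_max t)"
proof -
  obtain D where D: "D \<in> Fm X" "\<And>t. t \<in> W \<Longrightarrow> D \<in> t \<longleftrightarrow> is_max t"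
    using ex_max_formula by metis
  have "stratified L X Bot D"
  proof unfold_locales
    show "\<exists>v\<in>W. t \<subseteq> v \<and> D \<in> v \<and> Bot \<notin> v" if "t \<in> W" for t
      using max_above[OF that] D(2) is_max_pts by auto
    show "v' = v" if "v \<in> W" "v' \<in> W" "v \<subseteq> v'" "D \<in> v" for v v'
      using that D(2) is_max_eq by auto
    show "\<exists>\<gamma>\<in>Fm X. \<forall>v\<in>W. t \<subseteq> v \<longrightarrow> D \<in> v \<longrightarrow> Bot \<notin> v \<longrightarrow> (\<gamma> \<in> v) = (v = a)"
      if "a \<in> W" "D \<in> a" for t a
    proof -
      have "is_max a" using D(2) that by blast
      from max_isolated[OF this]
      obtain \<gamma> where "\<gamma> \<in> Fm X" "\<And>m'. is_max m' \<Longrightarrow> \<gamma> \<in> m' \<longleftrightarrow> m' = a" by blast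
      then show ?thesis using D(2) by (intro bexI[of _ \<gamma>]) auto
    qed
    show "finite {u \<in> W. D \<in> u}"
      by (rule finite_subset[OF _ finite_max]) (auto simp: D(2))
  qed (use assms D(1) pts_Bot in auto)
  then show ?thesis using D(2) by blast
qed

text \<open>The recipe for maximality one level down: excluded middle for the variables, with
  \<open>D\<close> in the place of falsity.\<close>

lemma ex_depth_two_formula:
  assumes D: "D \<in> Fm X" "\<And>t. t \<in> W \<Longrightarrow> D \<in> t \<longleftrightarrow> is_max t"
  shows "\<exists>E\<in>Fm X. \<forall>t\<in>W. E \<in> t \<longleftrightarrow> (\<forall>s\<in>W. t \<subseteq> s \<longrightarrow> is_max s \<or> col X s = col X t)"
proof -
  let ?S = "(\<lambda>x. Or (Var x) (Imp (Var x) D)) ` X"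
  obtain E where E: "E \<in> Fm X" "\<And>t. t \<in> W \<Longrightarrow> E \<in> t \<longleftrightarrow> (\<forall>B\<in>?S. B \<in> t)"
    by (rule pts_conjE[of ?S]) (use finX D(1) in auto)
  have "E \<in> t \<longleftrightarrow> (\<forall>s\<in>W. t \<subseteq> s \<longrightarrow> is_max s \<or> col X s = col X t)" if t: "t \<in> W" for t
  proof -
    have "Or (Var x) (Imp (Var x) D) \<in> t \<longleftrightarrow>
        Var x \<in> t \<or> (\<forall>s\<in>W. t \<subseteq> s \<longrightarrow> Var x \<in> s \<longrightarrow> is_max s)" if "x \<in> X" for x
      using pts_Imp[OF t, of "Var x" D] pts_Or[OF t, of "Var x" "Imp (Var x) D"] D that by simp
    then have "E \<in> t \<longleftrightarrow> (\<forall>x\<in>X. Var x \<in> t \<or> (\<forall>s\<in>W. t \<subseteq> s \<longrightarrow> Var x \<in> s \<longrightarrow> is_max s))"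
      using E(2)[OF t] by simp
    also have "\<dots> \<longleftrightarrow> (\<forall>s\<in>W. t \<subseteq> s \<longrightarrow> is_max s \<or> col X s \<subseteq> col X t)"
      by (auto simp: col_def)
    also have "\<dots> \<longleftrightarrow> (\<forall>s\<in>W. t \<subseteq> s \<longrightarrow> is_max s \<or> col X s = col X t)"
      using col_mono[of t] by (auto intro: subset_antisym)
    finally show ?thesis .
  qed
  then show ?thesis using E(1) by blast
qed

text \<open>Omitting \<open>F2\<close> leaves one maximal point above each point. Hence non-maximal
  points satisfying \<open>E\<close> that agree in colour and in maximal points above are bisimilar;
  the antichain property, isolation and finiteness all rest on this.\<close>

lemma stratified_top:
  assumes om: "omits L F2" "omits L (add_top R2)" "omits L (add_top G3)"
  shows "\<exists>D E. stratified L X D E \<and> (\<forall>t\<in>W. D \<in> t \<longleftrightarrow> is_max t)"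
proof -
  obtain D where D: "D \<in> Fm X" "\<And>t. t \<in> W \<Longrightarrow> D \<in> t \<longleftrightarrow> is_max t"
    using ex_max_formula by metis
  obtain E where E: "E \<in> Fm X"
      "\<And>t. t \<in> W \<Longrightarrow> E \<in> t \<longleftrightarrow> (\<forall>s\<in>W. t \<subseteq> s \<longrightarrow> is_max s \<or> col X s = col X t)"
    using ex_depth_two_formula[OF D] by metis
  define R where "R t s \<longleftrightarrow> E \<in> t \<and> E \<in> s \<and> \<not> is_max t \<and> \<not> is_max s \<and> col X t = col X s \<and>
    (\<forall>m. is_max m \<longrightarrow> (t \<subseteq> m \<longleftrightarrow> s \<subseteq> m))" for t s
  have same_max: "t \<subseteq> m \<longleftrightarrow> s \<subseteq> m" if "t \<in> W" "s \<in> W" "t \<subseteq> s" "is_max m" for t s m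
    using unique_max_above[OF om(1) that(1,4)] max_above[OF that(2)] that(3) by blast
  have zig: "\<exists>s'\<in>W. s \<subseteq> s' \<and> (t' = s' \<or> R t' s')"
    if "t \<in> W" "s \<in> W" "t = s \<or> R t s" "t' \<in> W" "t \<subseteq> t'" for t s t'
  proof (cases "t = s")
    case True
    then show ?thesis using that by blast
  next
    case False
    then have R: "R t s" using that by blast
    show ?thesis
    proof (cases "is_max t'")
      case True
      then show ?thesis using R that by (intro bexI[of _ t']) (auto simp: R_def)
    next
      case False
      have "col X t' = col X t" using E(2)[OF that(1)] R that False by (auto simp: R_def)
      moreover have "E \<in> t'" using R that by (auto simp: R_def)
      ultimately have "R t' s" using R same_max[OF that(1,4,5)] False by (auto simp: R_def)
      then show ?thesis using that by blast
    qed
  qed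
  have R_eq: "t = s" if "t \<in> W" "s \<in> W" "R t s" for t s
  proof (rule pts_bisim[where R = "\<lambda>t s. t = s \<or> R t s"])
    show "\<exists>s'\<in>W. s \<subseteq> s' \<and> (t' = s' \<or> R t' s')"
      if "t \<in> W" "s \<in> W" "t = s \<or> R t s" "t' \<in> W" "t \<subseteq> t'" for t s t'
      by (rule zig[OF that])
  qed (use that in \<open>auto simp: R_def\<close>)
  have nonmax: "\<not> is_max t" if "t \<subseteq> s" "s \<in> W" "\<not> is_max s" for t s
    using is_max_eq that by blast
  have "stratified L X D E"
  proof unfold_locales
    show "D \<in> Fm X" "E \<in> Fm X" by fact+
    show "E \<in> t" if "t \<in> W" "D \<in> t" for t
      using that D(2) E(2) is_max_eq by blast
    show "(\<forall>t\<in>W. D \<notin> t) \<and> omits L R2 \<and> omits L G3 \<or>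
        (\<forall>t\<in>W. \<exists>s\<in>W. t \<subseteq> s \<and> D \<in> s) \<and> omits L (add_top R2) \<and> omits L (add_top G3)"
      using om max_above is_max_pts D(2) by metis
    show "u' = u" if "t \<in> W" "u \<in> W" "u' \<in> W" "t \<subseteq> u" "t \<subseteq> u'" "D \<in> u" "D \<in> u'" for t u u'
      using unique_max_above[OF om(1) that(1)] that D(2) by blast
    show "\<exists>v\<in>W. t \<subseteq> v \<and> E \<in> v \<and> D \<notin> v" if t: "t \<in> W" "D \<notin> t" for t
    proof -
      have "\<not> is_max t" using t D(2) by blast
      from ex_maximal_col[of t "\<lambda>s. \<not> is_max s", OF t(1) this]
      obtain v where v: "v \<in> W" "t \<subseteq> v" "\<not> is_max v"
          "\<forall>s'\<in>W. v \<subseteq> s' \<longrightarrow> \<not> is_max s' \<longrightarrow> col X s' = col X v"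
        by blast
      have "E \<in> v" unfolding E(2)[OF v(1)] using v(4) by blast
      moreover have "D \<notin> v" using D(2)[OF v(1)] v(3) by simp
      ultimately show ?thesis using v by blast
    qed
    show "v' = v" if v: "v \<in> W" "v' \<in> W" "v \<subseteq> v'" "E \<in> v" "D \<notin> v'" for v v'
    proof -
      have n: "\<not> is_max v'" "\<not> is_max v" using v D(2)[OF v(2)] nonmax[OF v(3,2)] by simp_all
      have "col X v' = col X v" using E(2)[OF v(1)] v n by blast
      then have "R v v'" using n v same_max[OF v(1,2,3)] by (auto simp: R_def)
      then show ?thesis using R_eq v by blast
    qed
    show "\<exists>\<gamma>\<in>Fm X. \<forall>v\<in>W. t \<subseteq> v \<longrightarrow> E \<in> v \<longrightarrow> D \<notin> v \<longrightarrow> (\<gamma> \<in> v) = (v = a)"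
      if t: "t \<in> W" and a: "a \<in> W" "t \<subseteq> a" "E \<in> a" "D \<notin> a" for t a
    proof -
      let ?S = "Var ` col X a \<union> (\<lambda>x. Imp (Var x) D) ` (X - col X a)"
      obtain \<gamma> where \<gamma>: "\<gamma> \<in> Fm X" "\<And>t. t \<in> W \<Longrightarrow> \<gamma> \<in> t \<longleftrightarrow> (\<forall>B\<in>?S. B \<in> t)"
        by (rule pts_conjE[of ?S]) (use finX D(1) in \<open>auto simp: col_def\<close>)
      have na: "\<not> is_max a" using a D(2) by blast
      have "v = a" if v: "v \<in> W" "t \<subseteq> v" "E \<in> v" "D \<notin> v" "\<gamma> \<in> v" for v
      proof -
        have "Var x \<notin> v" if x: "x \<in> X" "x \<notin> col X a" for x
        proof
          assume "Var x \<in> v"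
          moreover have "Imp (Var x) D \<in> v" using \<gamma>(2)[OF v(1)] v(5) x by auto
          ultimately show False using pts_Imp_D[of "Var x" D v v] D(1) x v by auto
        qed
        moreover have "Var x \<in> v" if "x \<in> col X a" for x using \<gamma>(2)[OF v(1)] v(5) that by auto
        ultimately have "col X v = col X a" by (auto simp: col_def)
        moreover have "v \<subseteq> m \<longleftrightarrow> a \<subseteq> m" if "is_max m" for m
          using same_max[OF t v(1,2) that] same_max[OF t a(1,2) that] by blast
        ultimately have "R v a" using v a na D(2) by (auto simp: R_def)
        then show ?thesis using R_eq v a by blast
      qed
      moreover have "\<gamma> \<in> a"
      proof -
        have "Imp (Var x) D \<in> a" if x: "x \<in> X - col X a" for x
        proof -
          have "D \<in> s" if s: "s \<in> W" "a \<subseteq> s" "Var x \<in> s" for s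
          proof (rule ccontr)
            assume "D \<notin> s"
            then have "col X s = col X a" using E(2)[OF a(1)] a(3) s D(2) by blast
            then show False using x s by (auto simp: col_def)
          qed
          then show ?thesis using pts_Imp[OF a(1), of "Var x" D] D(1) x by auto
        qed
        then show ?thesis using \<gamma>(2)[OF a(1)] by (auto simp: col_def)
      qed
      ultimately show ?thesis using \<gamma>(1) by (intro bexI[of _ \<gamma>]) blast+
    qed
    show "finite {u \<in> W. E \<in> u}"
    proof -
      have "finite {u \<in> W. E \<in> u \<and> \<not> is_max u}"
      proof (rule finite_imageD)
        let ?f = "\<lambda>u. (col X u, {m. is_max m \<and> u \<subseteq> m})"
        show "finite (?f ` {u \<in> W. E \<in> u \<and> \<not> is_max u})"
        proof (rule finite_subset)
          show "?f ` {u \<in> W. E \<in> u \<and> \<not> is_max u} \<subseteq> Pow X \<times> Pow {m. is_max m}"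
            by (auto simp: col_def)
          show "finite (Pow X \<times> Pow {m. is_max m})" using finX finite_max by simp
        qed
        show "inj_on ?f {u \<in> W. E \<in> u \<and> \<not> is_max u}"
        proof (rule inj_onI)
          fix u v assume "u \<in> {u \<in> W. E \<in> u \<and> \<not> is_max u}" "v \<in> {u \<in> W. E \<in> u \<and> \<not> is_max u}"
            "?f u = ?f v"
          then show "u = v" by (intro R_eq) (auto simp: R_def)
        qed
      qed
      then have "finite ({u \<in> W. E \<in> u \<and> \<not> is_max u} \<union> {m. is_max m})" using finite_max by simp
      then show ?thesis by (rule finite_subset[rotated]) auto
    qed
  qed
  then show ?thesis using D(2) by blast
qed

end

text \<open>A substitution \<open>\<alpha>\<close> from the variables \<open>X\<close> to formulas over \<open>Y\<close> induces a p-morphism \<open>pb\<close> between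
  the canonical models in the opposite direction. The formula defining its image has as
  consequences exactly the \<open>C\<close> with \<open>\<alpha>(C) \<in> L\<close>.\<close>

locale substitution = src: tabular L X + tgt: tabular L Y for L X Y +
  fixes \<alpha> :: "nat \<Rightarrow> fm"
  assumes \<alpha>_Fm: "x \<in> X \<Longrightarrow> \<alpha> x \<in> Fm Y"
begin

definition pb :: "fm set \<Rightarrow> fm set" where
  "pb s = {C\<in>Fm X. subst \<alpha> C \<in> s}"

definition \<Theta> :: "fm set" where
  "\<Theta> = {C\<in>Fm X. subst \<alpha> C \<in> L}"

lemma subst_Fm: "C \<in> Fm X \<Longrightarrow> subst \<alpha> C \<in> Fm Y"
  using subst_in_Fm \<alpha>_Fm by blast

lemma pb_mono: "s \<subseteq> s' \<Longrightarrow> pb s \<subseteq> pb s'"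
  by (auto simp: pb_def)

lemma pb_Var: "x \<in> X \<Longrightarrow> Var x \<in> pb s \<longleftrightarrow> \<alpha> x \<in> s"
  by (simp add: pb_def)

lemma pb_pts:
  assumes s: "s \<in> tgt.W"
  shows "pb s \<in> src.W"
proof -
  have "derives L s (subst \<alpha> A)" if "derives L (pb s) A" for A
    using that
  proof (induction rule: derives.induct)
    case (logic A)
    then show ?case by (intro derives.logic intermediate_logic_subst[OF src.L])
  next
    case (hyp A)
    then show ?case by (intro derives.hyp) (simp add: pb_def)
  next
    case (mp A B)
    then show ?case using derives.mp by simp
  qed
  then have "A \<in> pb s" if "A \<in> Fm X" "derives L (pb s) A" for A
    using that tgt.pts_closed[OF s subst_Fm] by (simp add: pb_def)
  moreover have "A \<in> pb s \<or> B \<in> pb s" if "Or A B \<in> pb s" for A B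
    using that tgt.pts_Or[OF s subst_Fm subst_Fm, of A B] by (simp add: pb_def)
  moreover have "pb s \<subseteq> Fm X" "Bot \<notin> pb s"
    using tgt.pts_Bot[OF s] by (auto simp: pb_def)
  ultimately show ?thesis unfolding pts_def by blast
qed

text \<open>A maximal point contains every formula or its negation, and pulling back preserves
  this.\<close>

lemma pb_max:
  assumes m: "tgt.is_max m"
  shows "src.is_max (pb m)"
  unfolding src.is_max_def
proof (intro conjI ballI impI)
  have mW: "m \<in> tgt.W" using tgt.is_max_pts[OF m] .
  show "pb m \<in> src.W" by (rule pb_pts[OF mW])
  fix u assume u: "u \<in> src.W" "pb m \<subseteq> u"
  have "C \<in> pb m" if C: "C \<in> u" for C
  proof (rule ccontr)
    assume "C \<notin> pb m"
    have Fm: "C \<in> Fm X" using src.pts_Fm[OF u(1) C] .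
    then have "Imp (subst \<alpha> C) Bot \<in> m"
      using \<open>C \<notin> pb m\<close> tgt.is_max_neg[OF m subst_Fm[OF Fm]] by (simp add: pb_def)
    then have "Imp C Bot \<in> u" using u(2) Fm by (auto simp: pb_def)
    then show False using src.pts_neg[OF u(1) Fm] u(1) C by blast
  qed
  then show "u = pb m" using u(2) by blast
qed

text \<open>If \<open>t\<close> were not in the image, the implication missing exactly from the
  points below \<open>t\<close> would become provable under \<alpha>, hence belong to \<Theta> and
  to \<open>t\<close>.\<close>

lemma pb_surj:
  assumes t: "t \<in> src.W" "\<Theta> \<subseteq> t"
  shows "\<exists>s\<in>tgt.W. pb s = t"
proof (rule ccontr)
  assume *: "\<not> ?thesis"
  obtain \<phi> where \<phi>: "\<phi> \<in> Fm X" "\<And>u. u \<in> src.W \<Longrightarrow> \<phi> \<in> u \<longleftrightarrow> t \<subseteq> u"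
    using src.principal_formula[OF t(1)] by blast
  have "\<exists>\<psi>\<in>Fm X. \<forall>u\<in>src.W. \<psi> \<in> u \<longleftrightarrow> u \<in> {u\<in>src.W. \<not> u \<subseteq> t}"
    by (rule src.definable_upset) auto
  then obtain \<psi> where \<psi>: "\<psi> \<in> Fm X" "\<And>u. u \<in> src.W \<Longrightarrow> \<psi> \<in> u \<longleftrightarrow> \<not> u \<subseteq> t"
    by (metis (no_types, lifting) mem_Collect_eq)
  have "subst \<alpha> (Imp \<phi> \<psi>) \<in> L"
  proof (rule tgt.pts_complete)
    show "subst \<alpha> (Imp \<phi> \<psi>) \<in> Fm Y" using subst_Fm \<phi>(1) \<psi>(1) by simp
    fix s assume s: "s \<in> tgt.W"
    have "subst \<alpha> \<psi> \<in> v" if v: "v \<in> tgt.W" "subst \<alpha> \<phi> \<in> v" for v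
    proof -
      have "t \<subseteq> pb v" using \<phi>(2)[OF pb_pts[OF v(1)]] v(2) \<phi>(1) by (simp add: pb_def)
      moreover have "pb v \<noteq> t" using * v(1) by blast
      ultimately have "\<psi> \<in> pb v" using \<psi>(2)[OF pb_pts[OF v(1)]] by blast
      then show ?thesis by (simp add: pb_def)
    qed
    then show "subst \<alpha> (Imp \<phi> \<psi>) \<in> s"
      using tgt.pts_Imp[OF s] subst_Fm \<phi>(1) \<psi>(1) by simp
  qed
  then have "Imp \<phi> \<psi> \<in> t" using t(2) \<phi>(1) \<psi>(1) by (auto simp: \<Theta>_def)
  then have "\<psi> \<in> t" using src.pts_Imp_D[OF _ t(1) \<phi>(1) \<psi>(1) t(1)] \<phi>(2)[OF t(1)] by blast
  then show False using \<psi>(2)[OF t(1)] by blast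
qed

text \<open>A single formula can replace \<Theta>, since in a finite canonical model the up-set of
  points including \<Theta> is definable.\<close>

definition exact :: fm where
  "exact = src.definer {t\<in>src.W. \<Theta> \<subseteq> t}"

lemma exact_Fm: "exact \<in> Fm X"
  unfolding exact_def by (rule src.definer) auto

lemma exact_iff: "t \<in> src.W \<Longrightarrow> exact \<in> t \<longleftrightarrow> \<Theta> \<subseteq> t"
  unfolding exact_def by (subst src.definer) auto

lemma exact_unified: "subst \<alpha> exact \<in> L"
proof (rule tgt.pts_complete[OF subst_Fm[OF exact_Fm]])
  fix s assume s: "s \<in> tgt.W"
  have "\<Theta> \<subseteq> pb s"
  proof
    fix C assume "C \<in> \<Theta>"
    then show "C \<in> pb s" using tgt.pts_logic[OF s subst_Fm] by (simp add: \<Theta>_def pb_def)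
  qed
  then have "exact \<in> pb s" using exact_iff[OF pb_pts[OF s]] by blast
  then show "subst \<alpha> exact \<in> s" by (simp add: pb_def)
qed

lemma exact_derives:
  assumes "A \<in> \<Theta>"
  shows "derives L {exact} A"
proof (rule src.pts_derives)
  show "A \<in> t" if "t \<in> src.W" "{exact} \<subseteq> t" for t using that exact_iff assms by blast
qed (use exact_Fm assms in \<open>auto simp: \<Theta>_def\<close>)

text \<open>The theory of \<open>v\<close> under \<open>k\<close> is itself a canonical point, so
  \<open>exact_iff\<close> applies to it.\<close>

lemma sat_exact:
  assumes "v \<in> src.W" "src.mono_above v k"
  shows "src.sat k v exact \<longleftrightarrow> (\<forall>C\<in>\<Theta>. src.sat k v C)"
proof -
  let ?t = "{A\<in>Fm X. src.sat k v A}"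
  have "exact \<in> ?t \<longleftrightarrow> \<Theta> \<subseteq> ?t" using exact_iff[OF src.sat_theory[OF assms]] .
  moreover have "\<Theta> \<subseteq> Fm X" by (auto simp: \<Theta>_def)
  ultimately show ?thesis using exact_Fm by blast
qed

text \<open>It suffices to lift a valuation above \<open>w\<close> along \<open>\<alpha>\<close>; the colour of \<open>w\<close> is then dictated by the lift.\<close>

lemma extend_by_lift:
  assumes w: "w \<in> src.W"
    and k: "\<And>v. v \<in> src.W \<Longrightarrow> w \<subset> v \<Longrightarrow> src.mono_above v k"
    and k': "src.mono_above w k'"
    and lift: "\<And>v x. v \<in> src.W \<Longrightarrow> w \<subset> v \<Longrightarrow> x \<in> X \<Longrightarrow> x \<in> k v \<longleftrightarrow> src.sat k' v (\<alpha> x)"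
  shows "\<exists>c. (\<forall>v\<in>src.W. w \<subset> v \<longrightarrow> c \<subseteq> k v) \<and> src.sat (k(w := c)) w exact"
proof -
  define c where "c = {x\<in>X. src.sat k' w (\<alpha> x)}"
  have ck: "c \<subseteq> k v" if v: "v \<in> src.W" "w \<subset> v" for v
  proof
    fix x assume "x \<in> c"
    then have "src.sat k' v (\<alpha> x)" "x \<in> X"
      using src.sat_mono[OF k' w _ v(1)] v(2) by (auto simp: c_def)
    then show "x \<in> k v" using lift[OF v] by blast
  qed
  have "src.mono_above w (k(w := c))"
    unfolding src.mono_above_def
  proof (intro ballI impI)
    fix a b assume ab: "a \<in> src.W" "b \<in> src.W" "w \<subseteq> a" "a \<subseteq> b"
    show "(k(w := c)) a \<subseteq> (k(w := c)) b"
    proof (cases "a = w")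
      case True
      then show ?thesis using ck[OF ab(2)] ab by (cases "b = w") auto
    next
      case False
      then have "b \<noteq> w" "w \<subset> a" using ab by auto
      then show ?thesis using src.mono_aboveD[OF k[OF ab(1)], of a b] ab False by simp
    qed
  qed
  moreover have "src.sat (k(w := c)) w C" if C: "C \<in> \<Theta>" for C
  proof -
    \<comment> \<open>Members of \<Theta> become theorems under \<alpha>, and theorems hold under
      every colouring that is monotone above \<open>w\<close>.\<close>
    have "src.sat k' w (subst \<alpha> C)" using src.sat_valid[OF _ w k'] C by (simp add: \<Theta>_def)
    then have "src.sat (\<lambda>v. {x. src.sat k' v (\<alpha> x)}) w C" by (simp add: src.sat_subst)
    moreover have "C \<in> Fm X" using C by (simp add: \<Theta>_def)
    moreover have "x \<in> {x. src.sat k' v (\<alpha> x)} \<longleftrightarrow> x \<in> (k(w := c)) v"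
      if "v \<in> src.W" "w \<subseteq> v" "x \<in> X" for v x
      using that lift[of v x] by (cases "v = w") (auto simp: c_def)
    ultimately show ?thesis
      using src.sat_cong[of C X w "\<lambda>v. {x. src.sat k' v (\<alpha> x)}" "k(w := c)"] w by simp
  qed
  ultimately have "src.sat (k(w := c)) w exact" using sat_exact[OF w] by blast
  then show ?thesis using ck by blast
qed

text \<open>The cone of \<open>v\<close>, coloured by \<open>s\<close> and \<open>m\<close>, is
  bisimilar to the cone of \<open>s\<close>. Either chain may collapse to a point, which covers
  maximal points and lifts that coincide with \<open>m\<close>.\<close>

lemma sat_chain:
  assumes v: "v \<in> src.W" "t \<in> src.W" "\<And>u. u \<in> src.W \<Longrightarrow> v \<subseteq> u \<longleftrightarrow> u = v \<or> u = t"
      "\<And>u. u \<in> src.W \<Longrightarrow> t \<subseteq> u \<longleftrightarrow> u = t"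
    and s: "s \<in> tgt.W" "m \<in> tgt.W" "\<And>u. u \<in> tgt.W \<Longrightarrow> s \<subseteq> u \<longleftrightarrow> u = s \<or> u = m"
      "\<And>u. u \<in> tgt.W \<Longrightarrow> m \<subseteq> u \<longleftrightarrow> u = m"
    and k: "k v = col Y s" "k t = col Y m" and C: "C \<in> Fm Y"
  shows "src.sat k v C \<longleftrightarrow> C \<in> s"
proof -
  have "forces (ord (src.W)) (\<lambda>x. {u. x \<in> k u}) v C \<longleftrightarrow> forces (ord (tgt.W)) (\<lambda>x. {u. x \<in> col Y u}) s C"
  proof (rule forces_bisim[where X = Y and R = "\<lambda>a b. a = v \<and> b = s \<or> a = t \<and> b = m"])
    show "\<exists>b'. ord (tgt.W) b b' \<and> (a' = v \<and> b' = s \<or> a' = t \<and> b' = m)"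
      if "a = v \<and> b = s \<or> a = t \<and> b = m" "ord (src.W) a a'" for a b a'
    proof -
      note ab = that
      consider "b = s" "a' = v" | "b = s" "a' = t" | "b = m" "a' = t"
        using ab v(3,4) by (auto simp: ord_def)
      then show ?thesis
      proof cases
        case 1
        then show ?thesis using s(1) by (intro exI[of _ s]) (simp add: ord_def)
      next
        case 2
        then show ?thesis using s(2) s(3)[OF s(2)] by (intro exI[of _ m]) (simp add: ord_def)
      next
        case 3
        then show ?thesis using s(2) by (intro exI[of _ m]) (simp add: ord_def)
      qed
    qed
    show "\<exists>a'. ord (src.W) a a' \<and> (a' = v \<and> b' = s \<or> a' = t \<and> b' = m)"
      if "a = v \<and> b = s \<or> a = t \<and> b = m" "ord (tgt.W) b b'" for a b b'
    proof -
      note ab = that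
      consider "a = v" "b' = s" | "a = v" "b' = m" | "a = t" "b' = m"
        using ab s(3,4) by (auto simp: ord_def)
      then show ?thesis
      proof cases
        case 1
        then show ?thesis using v(1) by (intro exI[of _ v]) (simp add: ord_def)
      next
        case 2
        then show ?thesis using v(2) v(3)[OF v(2)] by (intro exI[of _ t]) (simp add: ord_def)
      next
        case 3
        then show ?thesis using v(2) by (intro exI[of _ t]) (simp add: ord_def)
      qed
    qed
  qed (use C k in \<open>auto simp: Fm_def\<close>)
  then show ?thesis using tgt.sat_col[OF s(1) C] by (simp add: src.sat_def tgt.sat_def)
qed

end

section \<open>Projective approximation in the case without top\<close>

theorem projective_approximation_if_omits:
  assumes L: "intermediate_logic L" and om: "omits L R2" "omits L G3"
  shows "projective_approximation L"
  unfolding projective_approximation_def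
proof
  fix A
  let ?X = "vars A"
  interpret X: finite_canonical L ?X by unfold_locales (use L finite_vars in auto)
  obtain D where D: "stratified L ?X Bot D" "\<And>t. t \<in> X.W \<Longrightarrow> D \<in> t \<longleftrightarrow> X.is_max t"
    using X.stratified_antichain_top[OF om] by metis
  interpret X: stratified L ?X Bot D by (rule D(1))
  let ?good = "\<lambda>B. (\<exists>\<epsilon>. projective_unifier L B \<epsilon>) \<and> vars B \<subseteq> ?X \<and> derives L {B} A"
  \<comment> \<open>These candidates do not depend on the unifier: they represent up-sets of the
    finite canonical model over \<open>vars A\<close>.\<close>
  let ?P = "{B\<in>X.definer ` Pow (X.W). ?good B}"
  have "\<exists>B\<in>?P. unifier L B \<mu>" if \<mu>: "unifier L A \<mu>" for \<mu>
  proof -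
    let ?Y = "\<Union>x\<in>?X. vars (\<mu> x)"
    interpret Y: finite_canonical L ?Y by unfold_locales (use L finite_vars in auto)
    obtain DY where DY: "stratified L ?Y Bot DY"
      using Y.stratified_antichain_top[OF om] by metis
    interpret Y: stratified L ?Y Bot DY by (rule DY)
    interpret substitution L ?X ?Y \<mu> by unfold_locales (auto simp: Fm_def)
    have "X.ext_at exact w" if "w \<in> X.W" for w
    proof (rule X.ext_at_stratified[OF _ that])
      fix w assume w: "w \<in> X.W" and up: "\<And>v. v \<in> X.W \<Longrightarrow> w \<subset> v \<Longrightarrow> D \<in> v"
      \<comment> \<open>The points strictly above \<open>w\<close> are maximal, so lifts chosen for
        them separately always form a monotone colouring.\<close>
      have max: "X.is_max v" if "v \<in> X.W" "w \<subset> v" for v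
        using up[OF that] D(2)[OF that(1)] by blast
      show "X.ext_at exact w"
        unfolding X.ext_at_def
      proof (intro allI impI)
        fix k assume k: "\<forall>v\<in>X.W. w \<subset> v \<longrightarrow> X.mono_above v k \<and> X.sat k v exact"
        let ?th = "\<lambda>v. {A\<in>Fm ?X. X.sat k v A}"
        \<comment> \<open>The theory of \<open>v\<close> includes \<Theta> and so is a pull-back of
          some \<open>s\<close>. Going up from \<open>s\<close> to a maximal point changes nothing,
          because \<open>v\<close> has no other point above it.\<close>
        have "\<exists>m. Y.is_max m \<and> pb m = ?th v" if v: "v \<in> X.W" "w \<subset> v" for v
        proof -
          have mono: "X.mono_above v k" using k v by blast
          have th: "?th v \<in> X.W" by (rule X.sat_theory[OF v(1) mono])
          have "exact \<in> ?th v" using k v exact_Fm by blast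
          then obtain s where s: "s \<in> Y.W" "pb s = ?th v"
            using pb_surj[OF th] exact_iff[OF th] by blast
          obtain m where m: "Y.is_max m" "s \<subseteq> m" using Y.max_above[OF s(1)] by blast
          have "?th v \<subseteq> pb m" using pb_mono[OF m(2)] s(2) by simp
          then obtain v' where "v' \<in> X.W" "v \<subseteq> v'" "?th v' = pb m"
            using X.sat_theory_zag[OF v(1) mono pb_pts[OF Y.is_max_pts[OF m(1)]]] by blast
          moreover from this have "v' = v" using X.is_max_eq[OF max[OF v]] by blast
          ultimately show ?thesis using m(1) by blast
        qed
        then obtain m where m: "\<And>v. v \<in> X.W \<Longrightarrow> w \<subset> v \<Longrightarrow> Y.is_max (m v) \<and> pb (m v) = ?th v"
          by metis
        \<comment> \<open>At \<open>w\<close> only monotonicity matters, which the empty colour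
          ensures.\<close>
        define k' where "k' v = (if v = w then {} else col ?Y (m v))" for v
        show "\<exists>c. (\<forall>v\<in>X.W. w \<subset> v \<longrightarrow> c \<subseteq> k v) \<and> X.sat (k(w := c)) w exact"
        proof (rule extend_by_lift[OF w, of k k'])
          show "X.mono_above v k" if "v \<in> X.W" "w \<subset> v" for v using k that by blast
          show "X.mono_above w k'"
            unfolding X.mono_above_def
          proof (intro ballI impI)
            fix a b assume ab: "a \<in> X.W" "b \<in> X.W" "w \<subseteq> a" "a \<subseteq> b"
            show "k' a \<subseteq> k' b"
            proof (cases "a = w")
              case False
              then have "X.is_max a" using max[OF ab(1)] ab(3) by auto
              then have "b = a" using X.is_max_eq[OF _ ab(2,4)] by simp
              then show ?thesis by simp
            qed (simp add: k'_def)
          qed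
          fix v x assume v: "v \<in> X.W" "w \<subset> v" and x: "x \<in> ?X"
          have mv: "Y.is_max (m v)" "pb (m v) = ?th v" using m[OF v] by blast+
          have "X.sat k' v (\<mu> x) \<longleftrightarrow> \<mu> x \<in> m v"
          proof (rule sat_chain)
            show "k' v = col ?Y (m v)" using v by (auto simp: k'_def)
            then show "k' v = col ?Y (m v)" .
            show "v \<subseteq> u \<longleftrightarrow> u = v \<or> u = v" "v \<subseteq> u \<longleftrightarrow> u = v" if "u \<in> X.W" for u
              using X.is_max_eq[OF max[OF v] that] by auto
            show "m v \<subseteq> u \<longleftrightarrow> u = m v \<or> u = m v" "m v \<subseteq> u \<longleftrightarrow> u = m v" if "u \<in> Y.W" for u
              using Y.is_max_eq[OF mv(1) that] by auto
          qed (use v \<alpha>_Fm x Y.is_max_pts[OF mv(1)] in auto)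
          also have "\<dots> \<longleftrightarrow> Var x \<in> ?th v" using pb_Var[OF x, of "m v"] mv(2) by simp
          also have "\<dots> \<longleftrightarrow> x \<in> k v" using x by simp
          finally show "x \<in> k v \<longleftrightarrow> X.sat k' v (\<mu> x)" by blast
        qed
      qed
    qed
    then have "\<exists>\<epsilon>. projective_unifier L exact \<epsilon>" using X.projective_if_ext_at[OF exact_Fm] by blast
    moreover have "A \<in> \<Theta>" using \<mu> by (simp add: \<Theta>_def unifier_def Fm_def)
    then have "derives L {exact} A" using exact_derives by simp
    moreover have "exact \<in> X.definer ` Pow (X.W)" unfolding exact_def by (rule imageI) blast
    moreover have "unifier L exact \<mu>" using exact_unified by (simp add: unifier_def)
    moreover have "vars exact \<subseteq> ?X" using exact_Fm by (simp add: Fm_def)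
    ultimately show ?thesis by blast
  qed
  moreover have "finite ?P" using X.finite_pts by simp
  ultimately show "\<exists>P. finite P \<and> (\<forall>B\<in>P. ?good B) \<and> (\<forall>\<mu>. unifier L A \<mu> \<longrightarrow> (\<exists>B\<in>P. unifier L B \<mu>))"
    by (intro exI[of _ ?P]) blast
qed

section \<open>Unitary unification\<close>

lemma subst_cong: "(\<And>x. x \<in> vars A \<Longrightarrow> \<sigma> x = \<tau> x) \<Longrightarrow> subst \<sigma> A = subst \<tau> A"
  by (induction A) auto

lemma Iff_refl_in: "intermediate_logic L \<Longrightarrow> Iff A A \<in> L"
proof -
  assume L: "intermediate_logic L"
  have "derives L {} (Imp A A)" using derives_Imp_iff[OF L] derives.hyp by blast
  then have "derives L {} (Iff A A)"
    using derives.mp[OF derives_IPC_mp[OF L ax_andI]] by blast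
  then show "Iff A A \<in> L" using derives_empty_iff[OF L] by simp
qed

lemma derives_subst:
  assumes L: "intermediate_logic L" and "derives L {B} A" "subst \<sigma> B \<in> L"
  shows "subst \<sigma> A \<in> L"
proof -
  have "Imp B A \<in> L" using assms(2) derives_Imp_iff[OF L] derives_empty_iff[OF L] by blast
  then have "Imp (subst \<sigma> B) (subst \<sigma> A) \<in> L"
    using intermediate_logic_subst[OF L, of "Imp B A" \<sigma>] by simp
  then show ?thesis using intermediate_logic_MP[OF L] assms(3) by blast
qed

lemma projective_unifier_absorb:
  assumes L: "intermediate_logic L" and "projective_unifier L B \<epsilon>" "unifier L B \<mu>"
  shows "Iff (subst \<mu> (\<epsilon> x)) (\<mu> x) \<in> L"
  using derives_subst[OF L, of B "Iff (\<epsilon> x) (Var x)" \<mu>] assms(2,3)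
  by (simp add: projective_unifier_def unifier_def)

theorem finite_complete_unifiers_if_omits:
  assumes L: "intermediate_logic L" and om: "omits L F2" "omits L (add_top R2)" "omits L (add_top G3)"
  shows "\<exists>S. finite S \<and> complete_unifiers L A S"
proof -
  obtain N where N: "vars A \<subseteq> {..<N}"
    using finite_vars[of A] unfolding finite_nat_set_iff_bounded by auto
  \<comment> \<open>Above the variables of \<open>A\<close>, the numbers \<open>N\<close> and
    \<open>N + 1\<close> are left for the two levels; each colour \<open>u\<close> over the first
    \<open>N\<close> variables has its own variable below \<open>K\<close>.\<close>
  define z where "z u = N + 2 + set_encode u" for u
  obtain K0 where K0: "set_encode ` Pow {..<N} \<subseteq> {..<K0}"
    using finite_nat_set_iff_bounded[of "set_encode ` Pow {..<N}"] by auto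
  define K where "K = N + 2 + K0"
  have zK: "z u < K" if "u \<subseteq> {..<N}" for u
    using K0 that by (auto simp: z_def K_def)
  let ?X = "{..<K}"
  interpret X: finite_canonical L ?X by unfold_locales (use L in auto)
  obtain D E where DE: "stratified L ?X D E" and D: "\<And>t. t \<in> X.W \<Longrightarrow> D \<in> t \<longleftrightarrow> X.is_max t"
    using X.stratified_top[OF om] by metis
  interpret X: stratified L ?X D E by (rule DE)
  let ?pu = "\<lambda>B \<epsilon>. projective_unifier L B \<epsilon> \<and> (\<forall>x\<in>?X. \<epsilon> x \<in> Fm ?X)"
  let ?P = "{B\<in>X.definer ` Pow (X.W). (\<exists>\<epsilon>. ?pu B \<epsilon>) \<and> derives L {B} A}"
  define e where "e B = (SOME \<epsilon>. ?pu B \<epsilon>)" for B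
  have e: "projective_unifier L B (e B)" "\<And>x. x < K \<Longrightarrow> e B x \<in> Fm ?X" if "B \<in> ?P" for B
  proof -
    have "\<exists>\<epsilon>. ?pu B \<epsilon>" using that by blast
    then have "?pu B (e B)" unfolding e_def by (rule someI_ex)
    then show "projective_unifier L B (e B)" "\<And>x. x < K \<Longrightarrow> e B x \<in> Fm ?X" by auto
  qed
  \<comment> \<open>The variables from \<open>N\<close> on are moved to fresh ones beyond
    \<open>K\<close>, so that their values can be prescribed later without disturbing the projective
    part.\<close>
  define e' where "e' B x = (if x < N then e B x else Var (x + K))" for B x
  have "unifier L A (e' B)" if B: "B \<in> ?P" for B
  proof -
    have "subst (e B) A \<in> L"
      using derives_subst[OF L, of B A "e B"] e(1)[OF B] B by (simp add: projective_unifier_def unifier_def)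
    moreover have "subst (e' B) A = subst (e B) A"
      by (rule subst_cong) (use N in \<open>auto simp: e'_def\<close>)
    ultimately show ?thesis by (simp add: unifier_def)
  qed
  moreover have "\<exists>B\<in>?P. more_general L (e' B) \<mu>" if \<mu>: "unifier L A \<mu>" for \<mu>
  proof -
    let ?Y = "\<Union>x<N. vars (\<mu> x)"
    interpret Y: finite_canonical L ?Y by unfold_locales (use L finite_vars in auto)
    obtain DY EY where DEY: "stratified L ?Y DY EY"
      and DY: "\<And>t. t \<in> Y.W \<Longrightarrow> DY \<in> t \<longleftrightarrow> Y.is_max t"
      using Y.stratified_top[OF om] by metis
    interpret Y: stratified L ?Y DY EY by (rule DEY)
    \<comment> \<open>Membership of \<open>s\<close> depends only on its unique maximal point, so
      \<open>Q u\<close> is an up-set and its truth value is the same along each cone.\<close>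
    define Q where "Q u = {s\<in>Y.W. \<exists>m. Y.is_max m \<and> s \<subseteq> m \<and>
      (\<exists>s1\<in>Y.W. s1 \<subseteq> m \<and> EY \<in> s1 \<and> DY \<notin> s1 \<and> {x. x < N \<and> \<mu> x \<in> s1} = u)}" for u
    have Q_top: "s \<in> Q u \<longleftrightarrow> m \<in> Q u" if "s \<in> Y.W" "Y.is_max m" "s \<subseteq> m" for s m u
    proof -
      have "x \<in> Q u \<longleftrightarrow> (\<exists>s1\<in>Y.W. s1 \<subseteq> m \<and> EY \<in> s1 \<and> DY \<notin> s1 \<and> {x. x < N \<and> \<mu> x \<in> s1} = u)"
        if x: "x \<in> Y.W" "x \<subseteq> m" for x
      proof -
        have "Y.is_max m' \<and> x \<subseteq> m' \<longleftrightarrow> m' = m" for m'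
          using Y.unique_max_above[OF om(1) x(1) \<open>Y.is_max m\<close> _ x(2)] \<open>Y.is_max m\<close> x(2) by blast
        then show ?thesis using x(1) by (simp add: Q_def flip: conj_assoc)
      qed
      from this[OF that(1,3)] this[OF Y.is_max_pts[OF that(2)]] show ?thesis by simp
    qed
    have "\<exists>q\<in>Fm ?Y. \<forall>s\<in>Y.W. q \<in> s \<longleftrightarrow> s \<in> Q u" for u
    proof (rule Y.definable_upset)
      show "s' \<in> Q u" if "s \<in> Q u" "s' \<in> Y.W" "s \<subseteq> s'" for s s'
      proof -
        obtain m where m: "Y.is_max m" "s' \<subseteq> m" using Y.max_above \<open>s' \<in> Y.W\<close> by blast
        have "s \<in> Y.W" using that(1) by (simp add: Q_def)
        then show ?thesis using Q_top[OF _ m(1)] m that by blast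
      qed
    qed (auto simp: Q_def)
    then obtain q where q: "\<And>u. q u \<in> Fm ?Y" "\<And>u s. s \<in> Y.W \<Longrightarrow> q u \<in> s \<longleftrightarrow> s \<in> Q u" by metis
    define \<alpha> where "\<alpha> x = (if x < N then \<mu> x else if x = N then DY else if x = N + 1 then EY
      else q (set_decode (x - (N + 2))))" for x
    \<comment> \<open>The variables \<open>N\<close>, \<open>N + 1\<close>, \<open>z u\<close> record maximality, depth at most two, and whether the
      colour \<open>u\<close> is realized at depth two below the same maximal point. Without them, forks over
      points whose lifts lie below different maximal points could not be lifted.\<close>
    have \<alpha>_simps: "x < N \<Longrightarrow> \<alpha> x = \<mu> x" "\<alpha> N = DY" "\<alpha> (N + 1) = EY"
      "u \<subseteq> {..<N} \<Longrightarrow> \<alpha> (z u) = q u" for x u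
      using finite_subset[of u "{..<N}"] by (auto simp: \<alpha>_def z_def)
    have \<mu>_Fm: "\<mu> x \<in> Fm ?Y" if "x < N" for x using that by (auto simp: Fm_def)
    interpret substitution L ?X ?Y \<alpha>
      by unfold_locales (use \<mu>_Fm q(1) in \<open>auto simp: \<alpha>_def\<close>)
    have "X.ext_at exact w" if "w \<in> X.W" for w
    proof (rule X.ext_at_stratified[OF _ that])
      fix w assume w: "w \<in> X.W" and up: "\<And>v. v \<in> X.W \<Longrightarrow> w \<subset> v \<Longrightarrow> E \<in> v"
      obtain t where t: "X.is_max t" "w \<subseteq> t" using X.max_above[OF w] by blast
      have tW: "t \<in> X.W" using X.is_max_pts[OF t(1)] .
      have v_t: "v \<subseteq> t" if v: "v \<in> X.W" "w \<subseteq> v" for v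
      proof -
        obtain m where m: "X.is_max m" "v \<subseteq> m" using X.max_above[OF v(1)] by blast
        then have "m = t" using X.unique_max_above[OF om(1) w t(1) m(1) t(2)] v(2) by blast
        then show ?thesis using m(2) by blast
      qed
      \<comment> \<open>Strictly above \<open>w\<close> there is at most an antichain with the one
        top \<open>t\<close> over it.\<close>
      have above: "v \<subseteq> u \<longleftrightarrow> u = v \<or> u = t" if v: "v \<in> X.W" "w \<subset> v" and u: "u \<in> X.W" for u v
      proof
        assume vu: "v \<subseteq> u"
        show "u = v \<or> u = t"
        proof (cases "D \<in> u")
          case True
          then have "X.is_max u" using D[OF u] by simp
          moreover have "u \<subseteq> t" using v_t[OF u] v(2) vu by blast
          ultimately show ?thesis using X.is_max_eq[OF _ tW] by blast
        next
          case False
          then show ?thesis using X.mid_antichain[OF v(1) u vu up[OF v]] by blast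
        qed
      next
        assume "u = v \<or> u = t"
        then show "v \<subseteq> u" using v_t[OF v(1)] v(2) by blast
      qed
      show "X.ext_at exact w"
        unfolding X.ext_at_def
      proof (intro allI impI)
        fix k assume k: "\<forall>v\<in>X.W. w \<subset> v \<longrightarrow> X.mono_above v k \<and> X.sat k v exact"
        show "\<exists>c. (\<forall>v\<in>X.W. w \<subset> v \<longrightarrow> c \<subseteq> k v) \<and> X.sat (k(w := c)) w exact"
        proof (cases "w = t")
          case True
          \<comment> \<open>Nothing lies strictly above \<open>w\<close>, so the empty colouring
            serves as the lift.\<close>
          then have no: "\<not> w \<subset> v" if "v \<in> X.W" for v using X.is_max_eq[OF t(1) that] by blast
          show ?thesis
            by (rule extend_by_lift[OF w, of k "\<lambda>_. {}"]) (use no in \<open>auto simp: X.mono_above_def\<close>)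
        next
          case False
          then have wt: "w \<subset> t" using t(2) by blast
          let ?th = "\<lambda>v. {A\<in>Fm ?X. X.sat k v A}"
          have mono: "X.mono_above v k" if "v \<in> X.W" "w \<subset> v" for v using k that by blast
          have th: "?th v \<in> X.W" if "v \<in> X.W" "w \<subset> v" for v
            using X.sat_theory[OF that(1) mono[OF that]] .
          have \<Theta>_th: "\<Theta> \<subseteq> ?th v" if v: "v \<in> X.W" "w \<subset> v" for v
          proof -
            have "exact \<in> ?th v" using k v exact_Fm by blast
            then show ?thesis using exact_iff[OF th[OF v]] by blast
          qed
          have th_above: "u = ?th v \<or> u = ?th t"
            if v: "v \<in> X.W" "w \<subset> v" and u: "u \<in> X.W" "?th v \<subseteq> u" for u v
          proof -
            obtain v' where v': "v' \<in> X.W" "v \<subseteq> v'" "?th v' = u"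
              using X.sat_theory_zag[OF v(1) mono[OF v] u] by blast
            then have "v' = v \<or> v' = t" using above[OF v v'(1)] by blast
            then show ?thesis using v'(3) by blast
          qed
          have th_t: "?th v \<subseteq> ?th t" if v: "v \<in> X.W" "w \<subset> v" for v
            using X.sat_mono[OF mono[OF v] v(1) _ tW v_t[OF v(1)]] v(2) by blast
          have pb_top: "pb m = ?th t"
            if v: "v \<in> X.W" "w \<subset> v" and m: "Y.is_max m" "?th v \<subseteq> pb m" for v m
          proof -
            have "pb m = ?th v \<or> pb m = ?th t"
              using th_above[OF v pb_pts[OF Y.is_max_pts[OF m(1)]] m(2)] .
            then show ?thesis
            proof
              assume "pb m = ?th v"
              then show ?thesis using X.is_max_eq[OF pb_max[OF m(1)] th[OF tW wt]] th_t[OF v] by simp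
            qed
          qed
          \<comment> \<open>The top is lifted first, to \<open>m\<close>; every other lift must then
            be found below this same \<open>m\<close>.\<close>
          obtain st where st: "st \<in> Y.W" "pb st = ?th t"
            using pb_surj[OF th[OF tW wt] \<Theta>_th[OF tW wt]] by blast
          obtain m where m: "Y.is_max m" "st \<subseteq> m" using Y.max_above[OF st(1)] by blast
          have mW: "m \<in> Y.W" using Y.is_max_pts[OF m(1)] .
          have pb_m: "pb m = ?th t"
            using pb_top[OF tW wt m(1)] pb_mono[OF m(2)] st(2) by simp
          have m_above: "m \<subseteq> u \<longleftrightarrow> u = m" if "u \<in> Y.W" for u
            using Y.is_max_eq[OF m(1) that] by blast
          have k_th: "x \<in> k v \<longleftrightarrow> Var x \<in> ?th v" if "x < K" for x v using that by simp
          have m_lift: "\<alpha> x \<in> m \<longleftrightarrow> Var x \<in> ?th t" if "x < K" for x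
            using pb_Var[of x m] that pb_m by simp
          have "\<exists>s1\<in>Y.W. s1 \<subseteq> m \<and> (\<forall>u\<in>Y.W. s1 \<subseteq> u \<longleftrightarrow> u = s1 \<or> u = m) \<and>
              (\<forall>x<K. \<alpha> x \<in> s1 \<longleftrightarrow> x \<in> k v) \<and> (v = t \<longrightarrow> s1 = m)" (is "\<exists>s1\<in>_. ?lift s1")
            if v: "v \<in> X.W" "w \<subset> v" for v
          proof (cases "?th v = ?th t")
            case True
            \<comment> \<open>A point with the theory of the top may be lifted to \<open>m\<close>
              itself.\<close>
            have "?lift m" using m_above m_lift k_th[of _ v] True by simp
            then show ?thesis using mW by blast
          next
            case ne: False
            then have vt: "v \<noteq> t" by blast
            obtain s where s: "s \<in> Y.W" "pb s = ?th v"
              using pb_surj[OF th[OF v] \<Theta>_th[OF v]] by blast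
            obtain m' where m': "Y.is_max m'" "s \<subseteq> m'" using Y.max_above[OF s(1)] by blast
            have pb_m': "pb m' = ?th t" using pb_top[OF v m'(1)] pb_mono[OF m'(2)] s(2) by simp
            have Ds: "DY \<notin> s"
            proof
              assume "DY \<in> s"
              then have "Y.is_max s" using DY[OF s(1)] by simp
              then have "m' = s" using Y.is_max_eq[OF _ Y.is_max_pts[OF m'(1)] m'(2)] by blast
              then show False using s(2) pb_m' ne by simp
            qed
            have Dm: "DY \<in> m" using DY[OF mW] m(1) by simp
            have K: "N < K" "N + 1 < K" by (auto simp: K_def)
            \<comment> \<open>Otherwise an antichain member \<open>s'\<close> above \<open>s\<close>
              pulls back to the theory of \<open>v\<close> or to that of \<open>t\<close>; the
              variable \<open>N + 1\<close> excludes the former, the variable \<open>N\<close> the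
              latter.\<close>
            have Es: "EY \<in> s"
            proof (rule ccontr)
              assume Es: "EY \<notin> s"
              obtain s' where s': "s' \<in> Y.W" "s \<subseteq> s'" "EY \<in> s'" "DY \<notin> s'"
                using Y.mid_above[OF s(1) Ds] by blast
              have "?th v \<subseteq> pb s'" using pb_mono[OF s'(2)] s(2) by simp
              then have "pb s' = pb s \<or> pb s' = pb m"
                using th_above[OF v pb_pts[OF s'(1)]] s(2) pb_m by simp
              moreover have "Var (N + 1) \<in> pb s'" "Var (N + 1) \<notin> pb s" "Var N \<notin> pb s'" "Var N \<in> pb m"
                using pb_Var \<alpha>_simps(2,3) K Es s' Dm by simp_all
              ultimately show False by blast
            qed
            define u where "u = {x. x < N \<and> \<mu> x \<in> s}"
            have uN: "u \<subseteq> {..<N}" by (auto simp: u_def)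
            have "s \<in> Q u" using s(1) m' Ds Es by (auto simp: Q_def u_def)
            then have "q u \<in> s" using q(2)[OF s(1)] by simp
            \<comment> \<open>The lift \<open>s\<close> of \<open>v\<close> may lie below a wrong
              maximal point. That its colour \<open>u\<close> occurs there is recorded by
              \<open>z u\<close>; this passes up from \<open>v\<close> to the top and thereby to
              \<open>m\<close>, giving a substitute \<open>s1\<close> below
              \<open>m\<close>.\<close>
            then have "Var (z u) \<in> ?th v"
              using pb_Var[of "z u" s] zK[OF uN] \<alpha>_simps(4)[OF uN] s(2) by simp
            then have "Var (z u) \<in> pb m" using th_t[OF v] pb_m by blast
            then have "q u \<in> m" using pb_Var[of "z u" m] zK[OF uN] \<alpha>_simps(4)[OF uN] by simp
            then have "m \<in> Q u" using q(2)[OF mW] by simp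
            then obtain m1 s1 where m1: "Y.is_max m1" "m \<subseteq> m1" and s1: "s1 \<in> Y.W" "s1 \<subseteq> m1"
                "EY \<in> s1" "DY \<notin> s1" "{x. x < N \<and> \<mu> x \<in> s1} = u"
              by (auto simp: Q_def)
            have "m1 = m" using m_above[OF Y.is_max_pts[OF m1(1)]] m1(2) by simp
            then have s1m: "s1 \<subseteq> m" using s1(2) by simp
            have s1_above: "s1 \<subseteq> u \<longleftrightarrow> u = s1 \<or> u = m" if u: "u \<in> Y.W" for u
            proof
              assume su: "s1 \<subseteq> u"
              show "u = s1 \<or> u = m"
              proof (cases "DY \<in> u")
                case True
                then have "Y.is_max u" using DY[OF u] by simp
                then show ?thesis using Y.unique_max_above[OF om(1) s1(1) m(1) _ s1m su] by blast
              next
                case False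
                then show ?thesis using Y.mid_antichain[OF s1(1) u su s1(3)] by blast
              qed
            next
              assume "u = s1 \<or> u = m"
              then show "s1 \<subseteq> u" using s1m by blast
            qed
            have "\<alpha> x \<in> s1 \<longleftrightarrow> \<alpha> x \<in> s" if x: "x < K" for x
            proof -
              \<comment> \<open>Variables below \<open>N\<close> agree by the choice of
                \<open>s1\<close>, the level variables since both points have depth two, the
                recording ones since they are decided at \<open>m\<close> and \<open>m'\<close>,
                which pull back to the same theory.\<close>
              consider "x < N" | "x = N" | "x = N + 1" | "\<alpha> x = q (set_decode (x - (N + 2)))"
                unfolding \<alpha>_def by presburger
              then show ?thesis
              proof cases
                case 1
                then have "\<mu> x \<in> s1 \<longleftrightarrow> x \<in> u" using s1(5) by blast
                then show ?thesis using \<alpha>_simps(1)[OF 1] 1 by (simp add: u_def)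
              next
                case 2
                then show ?thesis using \<alpha>_simps(2) s1(4) Ds by simp
              next
                case 3
                then show ?thesis using \<alpha>_simps(3) s1(3) Es by simp
              next
                case 4
                let ?q = "q (set_decode (x - (N + 2)))"
                have "?q \<in> s1 \<longleftrightarrow> ?q \<in> m" using Q_top[OF s1(1) m(1) s1m] q(2)[OF s1(1)] q(2)[OF mW] by simp
                also have "\<dots> \<longleftrightarrow> ?q \<in> m'" using pb_Var[of x m] pb_Var[of x m'] pb_m pb_m' x 4 by simp
                also have "\<dots> \<longleftrightarrow> ?q \<in> s"
                  using Q_top[OF s(1) m'] q(2)[OF s(1)] q(2)[OF Y.is_max_pts[OF m'(1)]] by simp
                finally show ?thesis using 4 by simp
              qed
            qed
            moreover have "\<alpha> x \<in> s \<longleftrightarrow> x \<in> k v" if "x < K" for x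
              using pb_Var[of x s] that s(2) by simp
            ultimately have "?lift s1" using s1m s1_above vt by simp
            then show ?thesis using s1(1) by blast
          qed
          then obtain f where f: "\<And>v. v \<in> X.W \<Longrightarrow> w \<subset> v \<Longrightarrow> f v \<in> Y.W \<and> ?lift v (f v)"
            by metis
          define k' where "k' v = (if v = w then {} else col ?Y (f v))" for v
          have ft: "f t = m" using f[OF tW wt] by blast
          show ?thesis
          proof (rule extend_by_lift[OF w, of k k'])
            show "X.mono_above v k" if "v \<in> X.W" "w \<subset> v" for v using mono[OF that] .
            show "X.mono_above w k'"
              unfolding X.mono_above_def
            proof (intro ballI impI)
              fix a b assume ab: "a \<in> X.W" "b \<in> X.W" "w \<subseteq> a" "a \<subseteq> b"
              show "k' a \<subseteq> k' b"
              proof (cases "a = w")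
                case False
                then have wa: "w \<subset> a" using ab(3) by blast
                then have "b \<noteq> w" using ab(4) by blast
                have "b = a \<or> b = t" using above[OF ab(1) wa ab(2)] ab(4) by blast
                moreover have "f a \<subseteq> f t" using f[OF ab(1) wa] ft by blast
                then have "col ?Y (f a) \<subseteq> col ?Y (f t)" by (rule Y.col_mono)
                ultimately show ?thesis using False \<open>b \<noteq> w\<close> by (auto simp: k'_def)
              qed (simp add: k'_def)
            qed
            fix v x assume v: "v \<in> X.W" "w \<subset> v" and x: "x \<in> ?X"
            have fv: "f v \<in> Y.W" "\<And>u. u \<in> Y.W \<Longrightarrow> f v \<subseteq> u \<longleftrightarrow> u = f v \<or> u = m"
              "\<alpha> x \<in> f v \<longleftrightarrow> x \<in> k v"
              using f[OF v] x by blast+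
            have "X.sat k' v (\<alpha> x) \<longleftrightarrow> \<alpha> x \<in> f v"
            proof (rule sat_chain[OF v(1) tW _ _ fv(1) mW])
              show "v \<subseteq> u \<longleftrightarrow> u = v \<or> u = t" if "u \<in> X.W" for u using above[OF v that] .
              show "t \<subseteq> u \<longleftrightarrow> u = t" if "u \<in> X.W" for u using X.is_max_eq[OF t(1) that] by blast
              show "k' v = col ?Y (f v)" using v by (auto simp: k'_def)
              show "k' t = col ?Y m" using wt ft by (auto simp: k'_def)
              show "\<alpha> x \<in> Fm ?Y" using \<alpha>_Fm[OF x] .
            qed (use fv(2) m_above in blast)+
            then show "x \<in> k v \<longleftrightarrow> X.sat k' v (\<alpha> x)" using fv(3) by blast
          qed
        qed
      qed
    qed
    then have "\<exists>\<epsilon>. ?pu exact \<epsilon>" using X.projective_if_ext_at[OF exact_Fm] by blast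
    moreover have "derives L {exact} A"
    proof -
      have "subst \<alpha> A = subst \<mu> A" by (rule subst_cong) (use N \<alpha>_simps(1) in auto)
      moreover have "A \<in> Fm ?X" using N by (auto simp: Fm_def K_def)
      ultimately have "A \<in> \<Theta>" using \<mu> by (simp add: \<Theta>_def unifier_def)
      then show ?thesis using exact_derives by simp
    qed
    moreover have "exact \<in> X.definer ` Pow (X.W)" unfolding exact_def by (rule imageI) blast
    ultimately have BP: "exact \<in> ?P" by blast
    \<comment> \<open>Continues \<alpha> to the fresh variables of \<open>e'\<close> so that \<mu>
      is restored from \<open>N\<close> on.\<close>
    define \<alpha>' where "\<alpha>' v = (if v < K then \<alpha> v else \<mu> (v - K))" for v
    have "unifier L exact \<alpha>" using exact_unified by (simp add: unifier_def)
    then have absorb: "Iff (subst \<alpha> (e exact x)) (\<alpha> x) \<in> L" for x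
      using projective_unifier_absorb[OF L e(1)[OF BP]] by blast
    have "Iff (subst \<alpha>' (e' exact x)) (\<mu> x) \<in> L" for x
    proof (cases "x < N")
      case True
      then have "x < K" by (simp add: K_def)
      have "subst \<alpha>' (e' exact x) = subst \<alpha> (e exact x)"
        unfolding e'_def if_P[OF True]
        by (rule subst_cong) (use e(2)[OF BP \<open>x < K\<close>] in \<open>auto simp: \<alpha>'_def Fm_def\<close>)
      then show ?thesis using absorb[of x] \<alpha>_simps(1)[OF True] by simp
    next
      case False
      then show ?thesis using Iff_refl_in[OF L] by (simp add: e'_def \<alpha>'_def)
    qed
    then have "more_general L (e' exact) \<mu>"
      unfolding more_general_def subst_eq_def subst_comp_def by blast
    then show ?thesis using BP by blast
  qed
  moreover have "finite (e' ` ?P)" using X.finite_pts by simp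
  ultimately show ?thesis by (intro exI[of _ "e' ` ?P"]) (auto simp: complete_unifiers_def)
qed

section \<open>From finitely many unifiers to one\<close>

lemma subst_subst: "subst \<alpha> (subst \<beta> A) = subst (\<lambda>x. subst \<alpha> (\<beta> x)) A"
  by (induction A) auto

lemma subst_Var: "subst Var A = A"
  by (induction A) auto

lemma Fm_UNIV: "A \<in> Fm UNIV"
  by (simp add: Fm_def)

lemma in_logic_iff:
  assumes L: "intermediate_logic L"
  shows "A \<in> L \<longleftrightarrow> (\<forall>t\<in>pts L UNIV. A \<in> t)"
proof -
  interpret canonical L UNIV by unfold_locales (rule L)
  show ?thesis using pts_logic pts_complete Fm_UNIV by blast
qed

lemma Iff_in_logic_iff:
  assumes L: "intermediate_logic L"
  shows "Iff A B \<in> L \<longleftrightarrow> (\<forall>t\<in>pts L UNIV. A \<in> t \<longleftrightarrow> B \<in> t)"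
proof -
  interpret canonical L UNIV by unfold_locales (rule L)
  have "Iff A B \<in> t \<longleftrightarrow> (\<forall>s\<in>pts L UNIV. t \<subseteq> s \<longrightarrow> (A \<in> s \<longleftrightarrow> B \<in> s))" if "t \<in> pts L UNIV" for t
    unfolding pts_And[OF that Fm_UNIV Fm_UNIV] pts_Imp[OF that Fm_UNIV Fm_UNIV] by blast
  then show ?thesis unfolding in_logic_iff[OF L] by blast
qed

lemma subst_mem_cong:
  assumes L: "intermediate_logic L" and "t \<in> pts L UNIV"
    and "\<And>s x. s \<in> pts L UNIV \<Longrightarrow> t \<subseteq> s \<Longrightarrow> \<sigma> x \<in> s \<longleftrightarrow> \<tau> x \<in> s"
  shows "subst \<sigma> A \<in> t \<longleftrightarrow> subst \<tau> A \<in> t"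
proof -
  interpret canonical L UNIV by unfold_locales (rule L)
  show ?thesis
    using assms(2,3)
  proof (induction A arbitrary: t)
    case (Imp A B)
    have "(subst \<sigma> A \<in> s \<longleftrightarrow> subst \<tau> A \<in> s) \<and> (subst \<sigma> B \<in> s \<longleftrightarrow> subst \<tau> B \<in> s)"
      if s: "s \<in> W" "t \<subseteq> s" for s
    proof -
      have "\<sigma> x \<in> s' \<longleftrightarrow> \<tau> x \<in> s'" if "s' \<in> W" "s \<subseteq> s'" for s' x
        using Imp.prems(2)[of s' x] that s by blast
      then show ?thesis using Imp.IH s(1) by blast
    qed
    then show ?case using pts_Imp[OF Imp.prems(1) Fm_UNIV Fm_UNIV] by simp
  qed (simp_all add: Fm_UNIV)
qed

lemma more_general_trans:
  assumes L: "intermediate_logic L" and "more_general L \<epsilon> \<mu>" "more_general L \<mu> \<nu>"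
  shows "more_general L \<epsilon> \<nu>"
proof -
  obtain \<alpha> \<beta> where \<alpha>: "\<And>x. Iff (subst \<alpha> (\<epsilon> x)) (\<mu> x) \<in> L" and \<beta>: "\<And>x. Iff (subst \<beta> (\<mu> x)) (\<nu> x) \<in> L"
    using assms(2,3) by (auto simp: more_general_def subst_eq_def subst_comp_def)
  have "Iff (subst (\<lambda>v. subst \<beta> (\<alpha> v)) (\<epsilon> x)) (\<nu> x) \<in> L" for x
  proof -
    have "Iff (subst \<beta> (subst \<alpha> (\<epsilon> x))) (subst \<beta> (\<mu> x)) \<in> L"
      using intermediate_logic_subst[OF L \<alpha>, of \<beta> x] by simp
    then show ?thesis using \<beta>[of x] unfolding Iff_in_logic_iff[OF L] subst_subst by simp
  qed
  then show ?thesis unfolding more_general_def subst_eq_def subst_comp_def by blast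
qed

text \<open>Each point has a single maximal point above it; whether that contains \<open>A\<close>
  decides between the two disjuncts.\<close>

lemma weak_excluded_middle:
  assumes L: "intermediate_logic L" and om: "omits L F2"
  shows "Or (Imp A Bot) (Imp (Imp A Bot) Bot) \<in> L"
proof -
  let ?X = "vars A"
  interpret finite_canonical L ?X by unfold_locales (use L finite_vars in auto)
  have A: "A \<in> Fm ?X" by (simp add: Fm_def)
  show ?thesis
  proof (rule pts_complete)
    show "Or (Imp A Bot) (Imp (Imp A Bot) Bot) \<in> Fm ?X" using A by simp
    fix t assume t: "t \<in> W"
    have "Imp A Bot \<in> t" if nn: "Imp (Imp A Bot) Bot \<notin> t"
    proof -
      obtain s where s: "s \<in> W" "t \<subseteq> s" "Imp A Bot \<in> s"
        using nn pts_neg[OF t, of "Imp A Bot"] A by auto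
      obtain m where m: "is_max m" "s \<subseteq> m" using max_above[OF s(1)] by blast
      have "A \<notin> m" using is_max_neg[OF m(1) A] m(2) s(3) by blast
      have "A \<notin> s'" if s': "s' \<in> W" "t \<subseteq> s'" for s'
      proof -
        obtain m' where m': "is_max m'" "s' \<subseteq> m'" using max_above[OF s'(1)] by blast
        have "m' = m" using unique_max_above[OF om t m(1) m'(1)] m(2) m'(2) s(2) s'(2) by blast
        then show ?thesis using \<open>A \<notin> m\<close> m'(2) by blast
      qed
      then show ?thesis using pts_neg[OF t A] by blast
    qed
    then show "Or (Imp A Bot) (Imp (Imp A Bot) Bot) \<in> t" using pts_Or[OF t] A by auto
  qed
qed

text \<open>Unification is filtering: a fresh variable chooses, by weak excluded middle, between two given unifiers.\<close>

lemma common_unifier: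
  assumes L: "intermediate_logic L" and om: "omits L F2"
    and u: "unifier L A \<epsilon>\<^sub>1" "unifier L A \<epsilon>\<^sub>2"
  shows "\<exists>\<epsilon>. unifier L A \<epsilon> \<and> more_general L \<epsilon> \<epsilon>\<^sub>1 \<and> more_general L \<epsilon> \<epsilon>\<^sub>2"
proof -
  interpret canonical L UNIV by unfold_locales (rule L)
  \<comment> \<open>The shift frees variable 0 for the choice between the two unifiers.\<close>
  define \<rho> where "\<rho> v = Var (Suc v)" for v
  let ?n = "Imp (Var 0) Bot" and ?nn = "Imp (Imp (Var 0) Bot) Bot"
  define \<epsilon> where "\<epsilon> x = Or (And ?n (subst \<rho> (\<epsilon>\<^sub>1 x))) (And ?nn (subst \<rho> (\<epsilon>\<^sub>2 x)))" for x
  have \<epsilon>: "\<epsilon> x \<in> t \<longleftrightarrow> ?n \<in> t \<and> subst \<rho> (\<epsilon>\<^sub>1 x) \<in> t \<or> ?nn \<in> t \<and> subst \<rho> (\<epsilon>\<^sub>2 x) \<in> t" if "t \<in> W" for t x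
    using that by (simp add: \<epsilon>_def Fm_UNIV)
  have not_both: "\<not> (?n \<in> t \<and> ?nn \<in> t)" if "t \<in> W" for t
    using pts_neg[OF that, of ?n] that by (auto simp: Fm_UNIV)
  have "subst \<epsilon> A \<in> t" if t: "t \<in> W" for t
  proof -
    have ins: "subst (\<lambda>x. subst \<rho> (\<epsilon>\<^sub>i x)) A \<in> t" if "unifier L A \<epsilon>\<^sub>i" for \<epsilon>\<^sub>i
    proof -
      have "subst \<rho> (subst \<epsilon>\<^sub>i A) \<in> L"
        using that intermediate_logic_subst[OF L] by (simp add: unifier_def)
      then show ?thesis using pts_logic[OF t Fm_UNIV] by (simp add: subst_subst)
    qed
    have "?n \<in> t \<or> ?nn \<in> t"
      using pts_logic[OF t Fm_UNIV weak_excluded_middle[OF L om, of "Var 0"]] pts_Or[OF t Fm_UNIV Fm_UNIV] by blast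
    then show ?thesis
    proof
      assume n: "?n \<in> t"
      have "\<epsilon> x \<in> s \<longleftrightarrow> subst \<rho> (\<epsilon>\<^sub>1 x) \<in> s" if "s \<in> W" "t \<subseteq> s" for s x
        using \<epsilon>[OF that(1)] not_both[OF that(1)] n that(2) by blast
      then show ?thesis using subst_mem_cong[OF L t, of \<epsilon> "\<lambda>x. subst \<rho> (\<epsilon>\<^sub>1 x)"] ins[OF u(1)] by simp
    next
      assume nn: "?nn \<in> t"
      have "\<epsilon> x \<in> s \<longleftrightarrow> subst \<rho> (\<epsilon>\<^sub>2 x) \<in> s" if "s \<in> W" "t \<subseteq> s" for s x
        using \<epsilon>[OF that(1)] not_both[OF that(1)] nn that(2) by blast
      then show ?thesis using subst_mem_cong[OF L t, of \<epsilon> "\<lambda>x. subst \<rho> (\<epsilon>\<^sub>2 x)"] ins[OF u(2)] by simp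
    qed
  qed
  then have "unifier L A \<epsilon>" unfolding unifier_def in_logic_iff[OF L] by blast
  \<comment> \<open>Replacing the choosing variable by \<open>Bot\<close> recovers the first
    unifier, by \<open>Top\<close> the second.\<close>
  moreover have "more_general L \<epsilon> \<epsilon>\<^sub>i"
    if C: "C \<in> {Bot, Top}" and \<epsilon>\<^sub>i: "\<epsilon>\<^sub>i = (if C = Bot then \<epsilon>\<^sub>1 else \<epsilon>\<^sub>2)" for C \<epsilon>\<^sub>i
  proof -
    define \<alpha> where "\<alpha> v = (case v of 0 \<Rightarrow> C | Suc v \<Rightarrow> Var v)" for v
    have "subst \<alpha> (subst \<rho> B) = B" for B
      unfolding subst_subst by (simp add: \<rho>_def \<alpha>_def subst_Var)
    then have \<alpha>\<epsilon>: "subst \<alpha> (\<epsilon> x) = Or (And (Imp C Bot) (\<epsilon>\<^sub>1 x)) (And (Imp (Imp C Bot) Bot) (\<epsilon>\<^sub>2 x))" for x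
      by (simp add: \<epsilon>_def \<alpha>_def)
    have "subst \<alpha> (\<epsilon> x) \<in> t \<longleftrightarrow> \<epsilon>\<^sub>i x \<in> t" if t: "t \<in> W" for t x
    proof -
      have "Imp C Bot \<in> s \<longleftrightarrow> C = Bot" if "s \<in> W" for s
        using pts_neg[OF that Fm_UNIV, of C] pts_Top pts_Bot C that by auto
      moreover from this have "Imp (Imp C Bot) Bot \<in> t \<longleftrightarrow> C \<noteq> Bot"
        using pts_neg[OF t Fm_UNIV, of "Imp C Bot"] t by auto
      ultimately show ?thesis using t by (simp add: \<alpha>\<epsilon> \<epsilon>\<^sub>i Fm_UNIV)
    qed
    then show ?thesis
      unfolding more_general_def subst_eq_def subst_comp_def Iff_in_logic_iff[OF L] by blast
  qed
  from this[of Bot \<epsilon>\<^sub>1] this[of Top \<epsilon>\<^sub>2] have "more_general L \<epsilon> \<epsilon>\<^sub>1" "more_general L \<epsilon> \<epsilon>\<^sub>2"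
    by simp_all
  ultimately show ?thesis by blast
qed

theorem unitary_unification_if_omits:
  assumes L: "intermediate_logic L" and om: "omits L F2" "omits L (add_top R2)" "omits L (add_top G3)"
  shows "unitary_unification L"
  unfolding unitary_unification_def
proof (intro allI impI)
  fix A assume "unifiable L A"
  then obtain \<mu>\<^sub>0 where \<mu>\<^sub>0: "unifier L A \<mu>\<^sub>0" by (auto simp: unifiable_def)
  obtain S where S: "finite S" "complete_unifiers L A S"
    using finite_complete_unifiers_if_omits[OF L om] by blast
  have "\<exists>\<epsilon>. unifier L A \<epsilon> \<and> (\<forall>\<epsilon>'\<in>T. more_general L \<epsilon> \<epsilon>')" if "T \<subseteq> S" for T
    using finite_subset[OF that S(1)] that
  proof (induction T)
    case empty
    then show ?case using \<mu>\<^sub>0 by blast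
  next
    case (insert \<epsilon>\<^sub>2 T)
    then obtain \<epsilon>\<^sub>1 where 1: "unifier L A \<epsilon>\<^sub>1" "\<forall>\<epsilon>'\<in>T. more_general L \<epsilon>\<^sub>1 \<epsilon>'" by blast
    have "unifier L A \<epsilon>\<^sub>2" using insert.prems S(2) by (auto simp: complete_unifiers_def)
    from common_unifier[OF L om(1) 1(1) this] show ?case
      using 1(2) more_general_trans[OF L] by blast
  qed
  from this[of S] obtain \<epsilon> where \<epsilon>: "unifier L A \<epsilon>" "\<And>\<epsilon>'. \<epsilon>' \<in> S \<Longrightarrow> more_general L \<epsilon> \<epsilon>'" by blast
  have "more_general L \<epsilon> \<mu>" if \<mu>: "unifier L A \<mu>" for \<mu>
  proof -
    obtain \<epsilon>' where "\<epsilon>' \<in> S" "more_general L \<epsilon>' \<mu>"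
      using S(2) \<mu> unfolding complete_unifiers_def by blast
    then show ?thesis using more_general_trans[OF L \<epsilon>(2)] by blast
  qed
  then show "\<exists>\<epsilon>. unifier L A \<epsilon> \<and> (\<forall>\<mu>. unifier L A \<mu> \<longrightarrow> more_general L \<epsilon> \<mu>)"
    using \<epsilon>(1) by blast
qed

text \<open>A projective unifier is most general for its own formula, being the identity modulo it;
  together these finitely many unifiers are complete for \<open>A\<close>.\<close>

lemma finitary_if_projective_approximation:
  assumes L: "intermediate_logic L" and "projective_approximation L"
  shows "finitary_unification L \<or> unitary_unification L"
proof -
  have "\<exists>S. finite S \<and> complete_unifiers L A S" for A
  proof -
    obtain P where P: "finite P" "\<And>B. B \<in> P \<Longrightarrow> (\<exists>\<epsilon>. projective_unifier L B \<epsilon>) \<and> derives L {B} A"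
        "\<And>\<mu>. unifier L A \<mu> \<Longrightarrow> \<exists>B\<in>P. unifier L B \<mu>"
      using assms(2) unfolding projective_approximation_def by meson
    obtain e where e: "\<And>B. B \<in> P \<Longrightarrow> projective_unifier L B (e B)" using P(2) by metis
    have "unifier L A (e B)" if "B \<in> P" for B
      using derives_subst[OF L, of B A "e B"] P(2)[OF that] e[OF that]
      by (simp add: projective_unifier_def unifier_def)
    moreover have "more_general L (e B) \<mu>" if "B \<in> P" "unifier L B \<mu>" for B \<mu>
      using projective_unifier_absorb[OF L e[OF that(1)] that(2)]
      unfolding more_general_def subst_eq_def subst_comp_def by blast
    ultimately have "complete_unifiers L A (e ` P)" using P(3) by (fastforce simp: complete_unifiers_def)
    then show ?thesis using P(1) by blast
  qed
  then show ?thesis by (auto simp: finitary_unification_def)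
qed

lemma IPC_sound:
  assumes "A \<in> IPC" and F: "reflp F" "transp F" and V: "\<And>x. upset F (V x)"
  shows "forces F V w A"
  using assms(1)
proof (induction arbitrary: w rule: IPC.induct)
  case (ax_K A B)
  then show ?case using forces_mono[of F V, OF F(2) V] by simp
next
  case (ax_S A B C)
  show ?case
    unfolding forces.simps
  proof (intro allI impI)
    fix v1 v2 v3
    assume 1: "\<forall>v. F v1 v \<longrightarrow> forces F V v A \<longrightarrow> (\<forall>u. F v u \<longrightarrow> forces F V u B \<longrightarrow> forces F V u C)"
      and 2: "\<forall>v. F v2 v \<longrightarrow> forces F V v A \<longrightarrow> forces F V v B"
      and 3: "F v1 v2" "F v2 v3" "forces F V v3 A"
    have "F v1 v3" using transpD[OF F(2) 3(1,2)] .
    then show "forces F V v3 C" using 1 2 3 reflpD[OF F(1), of v3] by blast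
  qed
next
  case (ax_andI A B)
  then show ?case using forces_mono[of F V, OF F(2) V] by simp
next
  case (ax_orE A C B)
  then show ?case using F by simp (meson transpD)
next
  case (MP A B)
  then show ?case using F(1) by (auto dest: reflpD)
qed auto

lemma intermediate_logic_of:
  fixes F :: "('a::finite) frame"
  assumes "is_frame F"
  shows "intermediate_logic (logic_of F)"
proof -
  have F: "reflp F" "transp F" using assms by (auto simp: is_frame_def)
  have "IPC \<subseteq> logic_of F" using IPC_sound[OF _ F] by (auto simp: logic_of_def)
  moreover have "B \<in> logic_of F" if "Imp A B \<in> logic_of F" "A \<in> logic_of F" for A B
    using that reflpD[OF F(1)] unfolding logic_of_def by simp blast
  moreover have "subst \<sigma> A \<in> logic_of F" if A: "A \<in> logic_of F" for \<sigma> A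
    unfolding logic_of_def
  proof (intro CollectI allI impI)
    fix V :: "nat \<Rightarrow> 'a set" and w assume V: "\<forall>x. upset F (V x)"
    have up: "upset F {v. forces F V v (\<sigma> x)}" for x
      unfolding upset_def using forces_mono[of F V] F(2) V by blast
    have A': "forces F V' w A" if "\<And>x. upset F (V' x)" for V' :: "nat \<Rightarrow> 'a set"
      using A that by (simp add: logic_of_def)
    show "forces F V w (subst \<sigma> A)" unfolding forces_subst by (rule A') (rule up)
  qed
  ultimately show ?thesis by (auto simp: intermediate_logic_def)
qed

section \<open>Logics with nullary unification\<close>

lemma forces_foldr_And:
  "forces F V w (foldr And As Top) \<longleftrightarrow> (\<forall>A\<in>set As. forces F V w A)"
  by (induction As) auto

text \<open>Violated at a fork over two members of the antichain \<open>base\<close>. The shift by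
  \<open>Suc\<close> keeps variable 0 free for \<open>dummett_unifier\<close>.\<close>

definition comparable :: "nat \<Rightarrow> fm" where
  "comparable k = foldr And
     [Or (Imp (Var (Suc i)) (Var (Suc j))) (Imp (Var (Suc j)) (Var (Suc i))). i \<leftarrow> [0..<k], j \<leftarrow> [0..<k]] Top"

lemma forces_comparable:
  "forces F V w (comparable k) \<longleftrightarrow> (\<forall>i<k. \<forall>j<k.
     forces F V w (Imp (Var (Suc i)) (Var (Suc j))) \<or> forces F V w (Imp (Var (Suc j)) (Var (Suc i))))"
  by (force simp: comparable_def forces_foldr_And)

definition dummett :: fm where
  "dummett = Or (Imp (Var 0) (Var 1)) (Imp (Var 1) (Var 0))"

text \<open>With p for \<open>Var 0\<close> and q for \<open>comparable k\<close>, the instance of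
  \<open>dummett\<close> reads \<open>((p --> q) --> p) | (p --> (p --> q))\<close>. It is valid on
  a rooted frame if q can fail only at the root.\<close>

definition dummett_unifier :: "nat \<Rightarrow> nat \<Rightarrow> fm" where
  "dummett_unifier k x = (if x = 0 then Imp (Var 0) (comparable k) else Var 0)"

lemma subst_dummett: "subst \<sigma> dummett = Or (Imp (\<sigma> 0) (\<sigma> 1)) (Imp (\<sigma> 1) (\<sigma> 0))"
  by (simp add: dummett_def)

text \<open>Above any point but the root the frame is a chain, so \<^term>\<open>comparable k\<close> can only fail at the root.\<close>

lemma dummett_unifier_valid:
  fixes F :: "('a::finite) frame"
  assumes F: "is_frame F" and chain: "\<And>w u v. \<not> F w r \<Longrightarrow> F w u \<Longrightarrow> F w v \<Longrightarrow> F u v \<or> F v u"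
    and root: "\<And>w. F r w"
  shows "subst (dummett_unifier k) dummett \<in> logic_of F"
  unfolding logic_of_def
proof (intro CollectI allI impI)
  fix V :: "nat \<Rightarrow> 'a set" and w assume V: "\<forall>x. upset F (V x)"
  have refl: "F v v" and trans: "F u v \<Longrightarrow> F v v' \<Longrightarrow> F u v'" for u v v'
    using F by (auto simp: is_frame_def dest: reflpD transpD)
  have cmp: "forces F V v (comparable k)" if v: "\<not> F v r" for v
    unfolding forces_comparable
  proof (intro allI impI)
    fix i j
    show "forces F V v (Imp (Var (Suc i)) (Var (Suc j))) \<or> forces F V v (Imp (Var (Suc j)) (Var (Suc i)))"
    proof (rule ccontr)
      assume "\<not> ?thesis"
      then obtain u u' where "F v u" "u \<in> V (Suc i)" "u \<notin> V (Suc j)"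
          "F v u'" "u' \<in> V (Suc j)" "u' \<notin> V (Suc i)" by auto
      then show False using chain[OF v, of u u'] V unfolding upset_def by blast
    qed
  qed
  have "forces F V w (Imp (Imp (Var 0) (comparable k)) (Var 0)) \<or>
      forces F V w (Imp (Var 0) (Imp (Var 0) (comparable k)))"
  proof (rule ccontr)
    assume "\<not> ?thesis"
    then obtain v u u' where v: "F w v" "v \<notin> V 0" and u: "F w u" "u \<in> V 0" and u': "F u u'"
        "\<not> forces F V u' (comparable k)" by auto
    then have "F w r" using cmp trans by blast
    \<comment> \<open>The failure of \<open>comparable k\<close> at \<open>u'\<close> forces
      \<open>u'\<close> to see the root, so \<open>u\<close> sees every point, and
      \<open>Var 0\<close>, true at \<open>u\<close>, is true at \<open>v\<close>.\<close>
    have "F u v" using trans[OF u'(1) trans[of u' r v]] cmp u'(2) root by blast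
    then show False using V u(2) v(2) unfolding upset_def by blast
  qed
  then show "forces F V w (subst (dummett_unifier k) dummett)"
    by (simp add: subst_dummett dummett_unifier_def)
qed

section \<open>Finite trees as Kripke models\<close>

datatype tree = Node (lab: "nat set") (children: "tree list")

text \<open>Trees themselves are the points, so equal subtrees are one point: two branches ending in
  the same leaf form a diamond, and two equal children are a single successor.\<close>

inductive subtree :: "tree frame" where
  subtree_refl: "subtree t t"
| subtree_step: "s \<in> set ts \<Longrightarrow> subtree s u \<Longrightarrow> subtree (Node c ts) u"

lemma subtree_iff [simp]: "subtree (Node c ts) u \<longleftrightarrow> u = Node c ts \<or> (\<exists>s\<in>set ts. subtree s u)"
  by (subst subtree.simps) auto

lemma subtree_trans: "subtree t s \<Longrightarrow> subtree s u \<Longrightarrow> subtree t u"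
  by (induction rule: subtree.induct) (auto intro: subtree.intros)

definition holds :: "tree \<Rightarrow> fm \<Rightarrow> bool" where
  "holds t A \<longleftrightarrow> forces subtree (\<lambda>x. {t. x \<in> lab t}) t A"

lemma holds_simps [simp]:
  "holds t (Var x) \<longleftrightarrow> x \<in> lab t"
  "\<not> holds t Bot"
  "holds t (And A B) \<longleftrightarrow> holds t A \<and> holds t B"
  "holds t (Or A B) \<longleftrightarrow> holds t A \<or> holds t B"
  by (auto simp: holds_def)

lemma holds_Imp: "holds t (Imp A B) \<longleftrightarrow> (\<forall>s. subtree t s \<longrightarrow> holds s A \<longrightarrow> holds s B)"
  by (simp add: holds_def)

lemma holds_comparable:
  "holds t (comparable k) \<longleftrightarrow> (\<forall>i<k. \<forall>j<k.
     holds t (Imp (Var (Suc i)) (Var (Suc j))) \<or> holds t (Imp (Var (Suc j)) (Var (Suc i))))"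
  unfolding holds_def by (rule forces_comparable)

text \<open>The model in which a formula is evaluated instead of its \<alpha>-instance. Subtrees of
  the same shape that \<alpha> colours alike on \<open>M\<close> become equal.\<close>

primrec image_tree :: "(nat \<Rightarrow> fm) \<Rightarrow> nat set \<Rightarrow> tree \<Rightarrow> tree" where
  "image_tree \<alpha> M (Node c ts) = Node {x\<in>M. holds (Node c ts) (\<alpha> x)} (map (image_tree \<alpha> M) ts)"

lemma lab_image_tree: "lab (image_tree \<alpha> M t) = {x\<in>M. holds t (\<alpha> x)}"
  by (cases t) simp

lemma subtree_image: "subtree t u \<Longrightarrow> subtree (image_tree \<alpha> M t) (image_tree \<alpha> M u)"
  by (induction rule: subtree.induct) (auto intro: subtree.intros)

lemma subtree_of_image: "subtree (image_tree \<alpha> M t) s \<Longrightarrow> \<exists>u. subtree t u \<and> s = image_tree \<alpha> M u"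
proof (induction t)
  case (Node c ts)
  then consider "s = image_tree \<alpha> M (Node c ts)" | t where "t \<in> set ts" "subtree (image_tree \<alpha> M t) s"
    by auto
  then show ?case
  proof cases
    case 1
    then show ?thesis by (intro exI[of _ "Node c ts"]) simp
  next
    case 2
    then obtain u where "subtree t u" "s = image_tree \<alpha> M u" using Node.IH by blast
    then show ?thesis using 2(1) by (intro exI[of _ u]) auto
  qed
qed

lemma holds_subst:
  assumes "vars A \<subseteq> M"
  shows "holds t (subst \<alpha> A) \<longleftrightarrow> holds (image_tree \<alpha> M t) A"
proof -
  have "forces subtree (\<lambda>x. {v. holds v (\<alpha> x)}) t A \<longleftrightarrow> holds (image_tree \<alpha> M t) A"
    unfolding holds_def[of "image_tree \<alpha> M t"]
  proof (rule forces_bisim[where X = M and R = "\<lambda>s s'. s' = image_tree \<alpha> M s"])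
    show "w \<in> {v. holds v (\<alpha> x)} \<longleftrightarrow> w' \<in> {t. x \<in> lab t}" if "w' = image_tree \<alpha> M w" "x \<in> M" for w w' x
      using that by (simp add: lab_image_tree)
  qed (use assms subtree_image subtree_of_image in blast)+
  then show ?thesis unfolding holds_def forces_subst by simp
qed

text \<open>Used where two members of the antichain have received the same image: the fork over them
  then counts as a single branch.\<close>

lemma holds_dup: "holds (Node c [s, s]) A \<longleftrightarrow> holds (Node c [s]) A"
  unfolding holds_def
proof (rule forces_bisim[where X = UNIV and R = "\<lambda>a b. a = b \<or> a = Node c [s, s] \<and> b = Node c [s]"])
qed auto

definition persistent :: "tree \<Rightarrow> bool" where
  "persistent t \<longleftrightarrow> (\<forall>u v. subtree t u \<longrightarrow> subtree u v \<longrightarrow> lab u \<subseteq> lab v)"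

lemma holds_mono:
  assumes "persistent t" "subtree t u" "subtree u v" "holds u A"
  shows "holds v A"
  using assms(2-)
proof (induction A)
  case (Var x)
  then show ?case using assms(1) by (auto simp: persistent_def)
next
  case (Imp A B)
  then show ?case unfolding holds_Imp using subtree_trans by blast
qed auto

definition valid_in :: "fm set \<Rightarrow> tree \<Rightarrow> bool" where
  "valid_in L t \<longleftrightarrow> (\<forall>A\<in>L. holds t A)"

text \<open>\<open>h\<close> is a p-morphism into the tree model, and the labels are pulled back
  along it to a valuation on \<open>F\<close>.\<close>

lemma valid_in_frame:
  assumes L: "L \<subseteq> logic_of F"
    and lab: "\<And>w v. F w v \<Longrightarrow> lab (h w) \<subseteq> lab (h v)"
    and zig: "\<And>w v. F w v \<Longrightarrow> subtree (h w) (h v)"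
    and zag: "\<And>w s. subtree (h w) s \<Longrightarrow> \<exists>v. F w v \<and> h v = s"
  shows "valid_in L (h w)"
  unfolding valid_in_def
proof
  fix A assume "A \<in> L"
  define V where "V x = {w. x \<in> lab (h w)}" for x
  have "upset F (V x)" for x using lab by (auto simp: upset_def V_def)
  then have "forces F V w A" using L \<open>A \<in> L\<close> by (auto simp: logic_of_def)
  moreover have "forces F V w A \<longleftrightarrow> holds (h w) A"
    unfolding holds_def
  proof (rule forces_bisim[where X = UNIV and R = "\<lambda>w t. t = h w"])
    show "\<exists>v'. subtree w' v' \<and> v' = h v" if "w' = h w" "F w v" for w w' v using zig that by blast
    show "\<exists>v. F w v \<and> v' = h v" if "w' = h w" "subtree w' v'" for w w' v' using zag that by blast
  qed (auto simp: V_def)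
  ultimately show "holds (h w) A" by simp
qed

text \<open>The flag \<open>b\<close> tells whether a top point \<open>W\<close> is present, so that
  frames with and without top share one argument.\<close>

definition chain_tree :: "bool \<Rightarrow> nat set \<Rightarrow> nat set \<Rightarrow> tree" where
  "chain_tree b c W = (if b then Node c [Node W []] else Node c [])"

lemma image_chain_tree:
  "image_tree \<alpha> M (chain_tree b c W) =
     chain_tree b {x\<in>M. holds (chain_tree b c W) (\<alpha> x)} {x\<in>M. holds (Node W []) (\<alpha> x)}"
  by (simp add: chain_tree_def)

text \<open>The antichain \<open>base 0, \<dots>, base (k-1)\<close> consists of the colours at which \<open>dummett_unifier k\<close> is tested.\<close>

definition base :: "nat \<Rightarrow> nat set" where
  "base i = {0, Suc i}"

text \<open>\<open>fork\<close> supplies the test models, \<open>recombine\<close> the refuting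
  ones. In its first alternative two collapsed forks are joined (shape \<open>R2\<close>, with top
  \<open>R2+\<close>), in the second a plain chain and a collapsed fork (shape \<open>G3\<close>,
  with top \<open>G3+\<close>).\<close>

context
  fixes L :: "fm set" and b :: bool
  assumes L: "intermediate_logic L"
    and fork: "\<And>\<rho> c c' W. \<rho> \<subseteq> c \<Longrightarrow> \<rho> \<subseteq> c' \<Longrightarrow> c \<subseteq> W \<Longrightarrow> c' \<subseteq> W \<Longrightarrow>
      valid_in L (Node \<rho> [chain_tree b c W, chain_tree b c' W])"
    and recombine: "(\<forall>U\<^sub>1 U\<^sub>2 c W. U\<^sub>1 \<subseteq> c \<longrightarrow> U\<^sub>2 \<subseteq> c \<longrightarrow> c \<subseteq> W \<longrightarrow>
        valid_in L (Node {} [Node U\<^sub>1 [chain_tree b c W], Node U\<^sub>2 [chain_tree b c W]])) \<or>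
      (\<forall>c\<^sub>0 U c W. c\<^sub>0 \<subseteq> W \<longrightarrow> U \<subseteq> c \<longrightarrow> c \<subseteq> W \<longrightarrow>
        valid_in L (Node {} [chain_tree b c\<^sub>0 W, Node U [chain_tree b c W]]))"
begin

text \<open>For larger \<open>k\<close>, two test colours have the same image over the variables
  \<open>M\<close> of \<epsilon>. The fork over them then looks to \<epsilon> like a single branch,
  which fits into a model of \<open>L\<close> where the instance of \<open>dummett\<close>
  fails.\<close>

lemma dummett_unifier_bound:
  assumes \<epsilon>: "unifier L dummett \<epsilon>" and gen: "more_general L \<epsilon> (dummett_unifier k)"
  shows "k \<le> 2 ^ card (vars (\<epsilon> 0) \<union> vars (\<epsilon> 1))"
proof (rule ccontr)
  define M where "M = vars (\<epsilon> 0) \<union> vars (\<epsilon> 1)"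
  assume "\<not> ?thesis"
  then have k: "2 ^ card M < k" by (simp add: M_def)
  have finM: "finite M" by (simp add: M_def finite_vars)
  obtain \<alpha> where \<alpha>: "\<And>x. Iff (subst \<alpha> (\<epsilon> x)) (dummett_unifier k x) \<in> L"
    using gen by (auto simp: more_general_def subst_eq_def subst_comp_def)
  let ?im = "image_tree \<alpha> M"
  have transfer: "holds (?im s) (\<epsilon> x) \<longleftrightarrow> holds s (dummett_unifier k x)"
    if t: "valid_in L t" "subtree t s" and x: "x = 0 \<or> x = 1" for t s x
  proof -
    have "holds t (Iff (subst \<alpha> (\<epsilon> x)) (dummett_unifier k x))"
      using \<alpha>[of x] t(1) unfolding valid_in_def by blast
    then have "holds s (subst \<alpha> (\<epsilon> x)) \<longleftrightarrow> holds s (dummett_unifier k x)"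
      using t(2) by (auto simp: holds_Imp)
    moreover have "vars (\<epsilon> x) \<subseteq> M" using x by (auto simp: M_def)
    ultimately show ?thesis using holds_subst by blast
  qed
  \<comment> \<open>All variables of \<open>comparable k\<close> are true at the top, so it cannot
    separate any of them.\<close>
  define W where "W = {0..k}"
  have base_W: "base i \<subseteq> W" if "i < k" for i using that by (auto simp: base_def W_def)
  define c where "c i = {x\<in>M. holds (chain_tree b (base i) W) (\<alpha> x)}" for i
  have "c ` {..<k} \<subseteq> Pow M" by (auto simp: c_def)
  then have "card (c ` {..<k}) \<le> 2 ^ card M" using card_mono[of "Pow M"] finM by (simp add: card_Pow)
  then have "\<not> inj_on c {..<k}" using k card_image[of c "{..<k}"] by auto
  then obtain i j where ij: "i < k" "j < k" "i \<noteq> j" "c i = c j" by (auto simp: inj_on_def)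
  define W' where "W' = {x\<in>M. holds (Node W []) (\<alpha> x)}"
  define s where "s = chain_tree b (c i) W'"
  have im_base: "?im (chain_tree b (base i) W) = s" "?im (chain_tree b (base j) W) = s"
    by (simp_all add: image_chain_tree s_def W'_def c_def[symmetric] ij(4))
  have chain_cmp: "holds u (comparable k)" if "subtree (chain_tree b a W) u" "a \<subseteq> W" for a u
  proof -
    have "holds u (Imp (Var (Suc p)) (Var (Suc q))) \<or> holds u (Imp (Var (Suc q)) (Var (Suc p)))"
      if pq: "p < k" "q < k" for p q
    proof -
      have W: "Suc p \<in> W" "Suc q \<in> W" using pq by (auto simp: W_def)
      show ?thesis using W \<open>subtree (chain_tree b a W) u\<close>
        by (auto simp: holds_Imp chain_tree_def split: if_splits)
    qed
    then show ?thesis by (simp add: holds_comparable)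
  qed
  \<comment> \<open>Label \<open>{0}\<close> makes component 1 of \<open>dummett_unifier\<close>
    true and component 0 false at this root; the empty label does the reverse. Both are allowed
    because 0 belongs to every \<open>base i\<close>.\<close>
  define t where "t \<rho> = Node \<rho> [chain_tree b (base i) W, chain_tree b (base j) W]" for \<rho>
  have t_valid: "valid_in L (t \<rho>)" if "\<rho> \<subseteq> {0}" for \<rho>
    unfolding t_def by (rule fork) (use that base_W ij in \<open>auto simp: base_def\<close>)
  define U where "U \<rho> = lab (?im (t \<rho>))" for \<rho>
  have U_holds: "holds (Node (U \<rho>) [s]) (\<epsilon> x) \<longleftrightarrow> holds (t \<rho>) (dummett_unifier k x)"
    if "\<rho> \<subseteq> {0}" "x = 0 \<or> x = 1" for \<rho> x
  proof -
    have "?im (t \<rho>) = Node (U \<rho>) [s, s]"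
      using im_base by (simp add: t_def U_def)
    moreover have "holds (?im (t \<rho>)) (\<epsilon> x) \<longleftrightarrow> holds (t \<rho>) (dummett_unifier k x)"
      by (rule transfer[OF t_valid[OF that(1)] subtree_refl that(2)])
    ultimately show ?thesis using holds_dup by simp
  qed
  have per: "persistent (t \<rho>)" if "\<rho> \<subseteq> {0}" for \<rho>
    using that base_W[OF ij(1)] base_W[OF ij(2)]
    by (auto simp: persistent_def t_def base_def chain_tree_def split: if_splits)
  have U_c: "U \<rho> \<subseteq> c i" if "\<rho> \<subseteq> {0}" for \<rho>
    using holds_mono[OF per[OF that] subtree_refl, of "chain_tree b (base i) W"]
    by (auto simp: U_def lab_image_tree c_def t_def subtree_refl)
  have c_W': "{x\<in>M. holds (chain_tree b a W) (\<alpha> x)} \<subseteq> W'" if "a \<subseteq> W" "b" for a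
    using holds_mono[of "chain_tree b a W" "chain_tree b a W" "Node W []"] that
    by (auto simp: W'_def persistent_def chain_tree_def)
  have u0: "\<not> holds (Node (U {0}) [s]) (\<epsilon> 0)"
  proof -
    have "\<not> holds (t {0}) (comparable k)"
    proof -
      have "\<not> holds (t {0}) (Imp (Var (Suc p)) (Var (Suc q)))" if "p = i \<and> q = j \<or> p = j \<and> q = i" for p q
      proof -
        have "subtree (t {0}) (chain_tree b (base p) W)"
          using that by (auto simp: t_def subtree_refl)
        moreover have "lab (chain_tree b (base p) W) = base p" by (simp add: chain_tree_def)
        then have "holds (chain_tree b (base p) W) (Var (Suc p))"
          "\<not> holds (chain_tree b (base p) W) (Var (Suc q))"
          using that ij(3) by (auto simp: base_def)
        ultimately show ?thesis unfolding holds_Imp by blast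
      qed
      then show ?thesis using ij(1,2) unfolding holds_comparable by blast
    qed
    then have "\<not> holds (t {0}) (dummett_unifier k 0)"
      by (auto simp: dummett_unifier_def holds_Imp t_def)
    then show ?thesis using U_holds[of "{0}" 0] by simp
  qed
  have u1: "holds (Node (U {0}) [s]) (\<epsilon> 1)"
    using U_holds[of "{0}" 1] by (simp add: dummett_unifier_def t_def)
  \<comment> \<open>Two branches on which \<open>\<epsilon> 0\<close> and
    \<open>\<epsilon> 1\<close> differ in opposite ways refute both disjuncts at the root.\<close>
  have clash: False
    if "valid_in L (Node {} [t\<^sub>1, t\<^sub>2])" "holds t\<^sub>1 (\<epsilon> 0)" "\<not> holds t\<^sub>1 (\<epsilon> 1)"
      "holds t\<^sub>2 (\<epsilon> 1)" "\<not> holds t\<^sub>2 (\<epsilon> 0)" for t\<^sub>1 t\<^sub>2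
  proof -
    have "holds (Node {} [t\<^sub>1, t\<^sub>2]) (subst \<epsilon> dummett)"
      using that(1) \<epsilon> unfolding valid_in_def unifier_def by blast
    then show False using that(2-) by (auto simp: subst_dummett holds_Imp subtree_refl)
  qed
  define c\<^sub>0 where "c\<^sub>0 = {x\<in>M. holds (chain_tree b {} W) (\<alpha> x)}"
  \<comment> \<open>\<open>recombine\<close> demands inclusions in the top colour. For
    \<open>b\<close> false the top does not occur in the trees and may be enlarged; for
    \<open>b\<close> true this is \<open>W'\<close> again.\<close>
  define W'' where "W'' = W' \<union> c i \<union> c\<^sub>0"
  have W'': "chain_tree b (c i) W' = chain_tree b (c i) W''" "chain_tree b c\<^sub>0 W' = chain_tree b c\<^sub>0 W''"
    using c_W'[of "base i"] c_W'[of "{}"] base_W[OF ij(1)]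
    by (auto simp: chain_tree_def W''_def c_def c\<^sub>0_def)
  show False
    using recombine
  proof
    assume R: "\<forall>U\<^sub>1 U\<^sub>2 c W. U\<^sub>1 \<subseteq> c \<longrightarrow> U\<^sub>2 \<subseteq> c \<longrightarrow> c \<subseteq> W \<longrightarrow>
        valid_in L (Node {} [Node U\<^sub>1 [chain_tree b c W], Node U\<^sub>2 [chain_tree b c W]])"
    have "valid_in L (Node {} [Node (U {}) [s], Node (U {0}) [s]])"
      unfolding s_def W''
      by (rule R[rule_format]) (use U_c[of "{}"] U_c[of "{0}"] in \<open>auto simp: W''_def\<close>)
    moreover have "holds (t {}) (dummett_unifier k 0)"
      using chain_cmp[of "base i"] chain_cmp[of "base j"] base_W[OF ij(1)] base_W[OF ij(2)]
      by (auto simp: dummett_unifier_def holds_Imp t_def)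
    then have "holds (Node (U {}) [s]) (\<epsilon> 0)" using U_holds[of "{}" 0] by simp
    moreover have "\<not> holds (Node (U {}) [s]) (\<epsilon> 1)"
      using U_holds[of "{}" 1] by (simp add: dummett_unifier_def t_def)
    ultimately show False using clash u0 u1 by blast
  next
    assume R: "\<forall>c\<^sub>0 U c W. c\<^sub>0 \<subseteq> W \<longrightarrow> U \<subseteq> c \<longrightarrow> c \<subseteq> W \<longrightarrow>
        valid_in L (Node {} [chain_tree b c\<^sub>0 W, Node U [chain_tree b c W]])"
    \<comment> \<open>Replaces the fork with empty label: \<open>Var 0\<close> fails at this chain,
      while \<open>comparable k\<close> holds.\<close>
    let ?e = "chain_tree b {} W"
    have "valid_in L (Node {} [chain_tree b c\<^sub>0 W', Node (U {0}) [s]])"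
      unfolding s_def W''
      by (rule R[rule_format]) (use U_c[of "{0}"] in \<open>auto simp: W''_def\<close>)
    \<comment> \<open>Doubling the chain brings it under \<open>fork\<close>, so that
      \<open>transfer\<close> applies to it.\<close>
    moreover have "valid_in L (Node {} [?e, ?e])" by (rule fork) simp_all
    then have "holds (?im ?e) (\<epsilon> x) \<longleftrightarrow> holds ?e (dummett_unifier k x)" if "x = 0 \<or> x = 1" for x
      using transfer[of "Node {} [?e, ?e]" ?e x] that by (simp add: subtree_refl)
    then have e: "holds (chain_tree b c\<^sub>0 W') (\<epsilon> x) \<longleftrightarrow> holds ?e (dummett_unifier k x)" if "x = 0 \<or> x = 1" for x
      using that by (simp add: image_chain_tree c\<^sub>0_def W'_def)
    have "holds ?e (dummett_unifier k 0)"
      using chain_cmp[of "{}"] by (simp add: dummett_unifier_def holds_Imp)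
    then have "holds (chain_tree b c\<^sub>0 W') (\<epsilon> 0)" using e by simp
    moreover have "lab ?e = {}" by (simp add: chain_tree_def)
    then have "\<not> holds (chain_tree b c\<^sub>0 W') (\<epsilon> 1)" using e[of 1] by (simp add: dummett_unifier_def)
    ultimately show False using clash u0 u1 by blast
  qed
qed

text \<open>A finite complete set for \<open>dummett\<close> would bound \<open>k\<close> by the
  numbers of variables in its members, while unifiers exist for every \<open>k\<close>.\<close>

theorem nullary_if_fork:
  assumes uni: "\<And>k. subst (dummett_unifier k) dummett \<in> L"
  shows "\<not> finitary_unification L \<and> \<not> unitary_unification L"
proof -
  have unifiable: "unifiable L dummett" using uni by (auto simp: unifiable_def unifier_def)
  have no: False if S: "finite S" "complete_unifiers L dummett S" for S
  proof -
    define n where "n \<epsilon> = (2::nat) ^ card (vars (\<epsilon> 0) \<union> vars (\<epsilon> 1))" for \<epsilon> :: "nat \<Rightarrow> fm"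
    obtain k where k: "\<forall>i\<in>n ` S. i < k"
      using finite_nat_set_iff_bounded[of "n ` S"] S(1) by auto
    have "unifier L dummett (dummett_unifier k)" using uni by (simp add: unifier_def)
    then obtain \<epsilon> where \<epsilon>: "\<epsilon> \<in> S" "unifier L dummett \<epsilon>" "more_general L \<epsilon> (dummett_unifier k)"
      using S(2) unfolding complete_unifiers_def by blast
    have "k \<le> n \<epsilon>"
      unfolding n_def by (rule dummett_unifier_bound[OF \<epsilon>(2,3)])
    then show False using k \<epsilon>(1) by auto
  qed
  have "\<not> unitary_unification L"
  proof
    assume "unitary_unification L"
    then obtain \<epsilon> where "complete_unifiers L dummett {\<epsilon>}"
      using unifiable by (auto simp: unitary_unification_def complete_unifiers_def)
    then show False using no[of "{\<epsilon>}"] by simp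
  qed
  moreover have "\<not> finitary_unification L"
    using unifiable no by (auto simp: finitary_unification_def)
  ultimately show ?thesis by blast
qed

end

section \<open>Four logics without finitary or unitary unification\<close>

lemma intermediate_logic_Int:
  "intermediate_logic L \<Longrightarrow> intermediate_logic L' \<Longrightarrow> intermediate_logic (L \<inter> L')"
  unfolding intermediate_logic_def by blast

lemma ex_fork: "(\<exists>x. P x) \<longleftrightarrow> P Fork_r \<or> P Fork_a \<or> P Fork_b"
  by (metis fork.exhaust)

lemma ex_g3: "(\<exists>x. P x) \<longleftrightarrow> P G3_r \<or> P G3_a \<or> P G3_b \<or> P G3_c"
  by (metis g3.exhaust)

lemma omits_mono: "omits L F \<Longrightarrow> L \<subseteq> L' \<Longrightarrow> omits L' F"
  by (auto simp: omits_def)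

lemma fork_valid_F2:
  assumes "L \<subseteq> logic_of F2" "\<rho> \<subseteq> c" "\<rho> \<subseteq> c'"
  shows "valid_in L (Node \<rho> [Node c [], Node c' []])"
proof -
  define h where "h x = (case x of Fork_r \<Rightarrow> Node \<rho> [Node c [], Node c' []]
    | Fork_a \<Rightarrow> Node c [] | Fork_b \<Rightarrow> Node c' [])" for x
  have "valid_in L (h Fork_r)"
  proof (rule valid_in_frame[OF assms(1)])
    show "lab (h w) \<subseteq> lab (h v)" if "F2 w v" for w v
      using that assms by (cases w; cases v) (auto simp: h_def F2_def)
    show "subtree (h w) (h v)" if "F2 w v" for w v
      using that by (cases w; cases v) (auto simp: h_def F2_def)
    show "\<exists>v. F2 w v \<and> h v = s" if "subtree (h w) s" for w s
      using that
      by (cases w) (auto simp: h_def F2_def intro: exI[of _ Fork_a] exI[of _ Fork_b] exI[of _ Fork_r])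
  qed
  then show ?thesis by (simp add: h_def)
qed

lemma R2_simps [simp]:
  "R2 None q \<longleftrightarrow> q = None"
  "R2 p None"
  "R2 (Some x) (Some y) \<longleftrightarrow> F2 x y"
  by (auto simp: R2_def add_top_def split: option.splits)

lemma add_top_simps [simp]:
  "add_top F None q \<longleftrightarrow> q = None"
  "add_top F p None"
  "add_top F (Some x) (Some y) \<longleftrightarrow> F x y"
  by (auto simp: add_top_def split: option.splits)

lemma diamond_valid_R2:
  assumes "L \<subseteq> logic_of R2" "\<rho> \<subseteq> c" "\<rho> \<subseteq> c'" "c \<subseteq> W" "c' \<subseteq> W"
  shows "valid_in L (Node \<rho> [Node c [Node W []], Node c' [Node W []]])"
proof -
  define h where "h x = (case x of None \<Rightarrow> Node W [] | Some Fork_r \<Rightarrow> Node \<rho> [Node c [Node W []], Node c' [Node W []]]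
    | Some Fork_a \<Rightarrow> Node c [Node W []] | Some Fork_b \<Rightarrow> Node c' [Node W []])" for x
  have "valid_in L (h (Some Fork_r))"
  proof (rule valid_in_frame[OF assms(1)])
    show "lab (h w) \<subseteq> lab (h v)" if "R2 w v" for w v
      using that assms(2-) by (auto simp: h_def F2_def split: option.splits fork.splits)
    show "subtree (h w) (h v)" if "R2 w v" for w v
      using that by (auto simp: h_def F2_def split: option.splits fork.splits)
    show "\<exists>v. R2 w v \<and> h v = s" if "subtree (h w) s" for w s
      using that
      by (auto simp: h_def F2_def split_option_ex ex_fork split: option.splits fork.splits)
  qed
  then show ?thesis by (simp add: h_def)
qed

lemma top_diamond_valid:
  assumes "L \<subseteq> logic_of (add_top R2)" "\<rho> \<subseteq> U" "\<rho> \<subseteq> U'" "U \<subseteq> c" "U' \<subseteq> c" "c \<subseteq> W"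
  shows "valid_in L (Node \<rho> [Node U [Node c [Node W []]], Node U' [Node c [Node W []]]])"
proof -
  let ?t = "Node c [Node W []]"
  define h where "h x = (case x of None \<Rightarrow> Node W [] | Some None \<Rightarrow> ?t
    | Some (Some Fork_r) \<Rightarrow> Node \<rho> [Node U [?t], Node U' [?t]]
    | Some (Some Fork_a) \<Rightarrow> Node U [?t] | Some (Some Fork_b) \<Rightarrow> Node U' [?t])" for x
  have "valid_in L (h (Some (Some Fork_r)))"
    by (rule valid_in_frame[OF assms(1)]) (use assms(2-) in \<open>auto simp: h_def F2_def split_option_ex ex_fork split: option.splits fork.splits\<close>)
  then show ?thesis by (simp add: h_def)
qed

text \<open>The two upper points of the frame are both mapped to the leaf \<open>W\<close>.\<close>

lemma diamond_valid_top_R2: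
  assumes "L \<subseteq> logic_of (add_top R2)" "\<rho> \<subseteq> c" "\<rho> \<subseteq> c'" "c \<subseteq> W" "c' \<subseteq> W"
  shows "valid_in L (Node \<rho> [Node c [Node W []], Node c' [Node W []]])"
proof -
  define h where "h x = (case x of None \<Rightarrow> Node W [] | Some None \<Rightarrow> Node W []
    | Some (Some Fork_r) \<Rightarrow> Node \<rho> [Node c [Node W []], Node c' [Node W []]]
    | Some (Some Fork_a) \<Rightarrow> Node c [Node W []] | Some (Some Fork_b) \<Rightarrow> Node c' [Node W []])" for x
  have "valid_in L (h (Some (Some Fork_r)))"
    by (rule valid_in_frame[OF assms(1)]) (use assms(2-) in \<open>auto simp: h_def F2_def split_option_ex ex_fork split: option.splits fork.splits\<close>)
  then show ?thesis by (simp add: h_def)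
qed

lemma G3_tree_valid:
  assumes "L \<subseteq> logic_of G3" "\<rho> \<subseteq> a" "\<rho> \<subseteq> b" "b \<subseteq> c"
  shows "valid_in L (Node \<rho> [Node a [], Node b [Node c []]])"
proof -
  define h where "h x = (case x of G3_r \<Rightarrow> Node \<rho> [Node a [], Node b [Node c []]]
    | G3_a \<Rightarrow> Node a [] | G3_b \<Rightarrow> Node b [Node c []] | G3_c \<Rightarrow> Node c [])" for x
  have "valid_in L (h G3_r)"
    by (rule valid_in_frame[OF assms(1)]) (use assms(2-) in \<open>auto simp: h_def G3_def ex_g3 split: g3.splits\<close>)
  then show ?thesis by (simp add: h_def)
qed

text \<open>The chain \<open>G3_b\<close>, \<open>G3_c\<close> is collapsed to one leaf.\<close>

lemma fork_valid_G3:
  assumes "L \<subseteq> logic_of G3" "\<rho> \<subseteq> c" "\<rho> \<subseteq> c'"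
  shows "valid_in L (Node \<rho> [Node c [], Node c' []])"
proof -
  define h where "h x = (case x of G3_r \<Rightarrow> Node \<rho> [Node c [], Node c' []]
    | G3_a \<Rightarrow> Node c [] | G3_b \<Rightarrow> Node c' [] | G3_c \<Rightarrow> Node c' [])" for x
  have "valid_in L (h G3_r)"
    by (rule valid_in_frame[OF assms(1)]) (use assms(2-) in \<open>auto simp: h_def G3_def ex_g3 split: g3.splits\<close>)
  then show ?thesis by (simp add: h_def)
qed

lemma top_G3_tree_valid:
  assumes "L \<subseteq> logic_of (add_top G3)" "\<rho> \<subseteq> a" "\<rho> \<subseteq> b" "b \<subseteq> c" "a \<subseteq> W" "c \<subseteq> W"
  shows "valid_in L (Node \<rho> [Node a [Node W []], Node b [Node c [Node W []]]])"
proof -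
  let ?c = "Node c [Node W []]"
  define h where "h x = (case x of None \<Rightarrow> Node W [] | Some G3_r \<Rightarrow> Node \<rho> [Node a [Node W []], Node b [?c]]
    | Some G3_a \<Rightarrow> Node a [Node W []] | Some G3_b \<Rightarrow> Node b [?c] | Some G3_c \<Rightarrow> ?c)" for x
  have "valid_in L (h (Some G3_r))"
    by (rule valid_in_frame[OF assms(1)]) (use assms(2-) in \<open>auto simp: h_def G3_def split_option_ex ex_g3 split: option.splits g3.splits\<close>)
  then show ?thesis by (simp add: h_def)
qed

text \<open>Again \<open>G3_b\<close> and \<open>G3_c\<close> are merged, now below the top.\<close>

lemma diamond_valid_top_G3:
  assumes "L \<subseteq> logic_of (add_top G3)" "\<rho> \<subseteq> c" "\<rho> \<subseteq> c'" "c \<subseteq> W" "c' \<subseteq> W"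
  shows "valid_in L (Node \<rho> [Node c [Node W []], Node c' [Node W []]])"
proof -
  define h where "h x = (case x of None \<Rightarrow> Node W [] | Some G3_r \<Rightarrow> Node \<rho> [Node c [Node W []], Node c' [Node W []]]
    | Some G3_a \<Rightarrow> Node c [Node W []] | Some G3_b \<Rightarrow> Node c' [Node W []] | Some G3_c \<Rightarrow> Node c' [Node W []])" for x
  have "valid_in L (h (Some G3_r))"
    by (rule valid_in_frame[OF assms(1)]) (use assms(2-) in \<open>auto simp: h_def G3_def split_option_ex ex_g3 split: option.splits g3.splits\<close>)
  then show ?thesis by (simp add: h_def)
qed

lemma is_frame_R2: "is_frame R2"
  unfolding R2_def by (intro is_frame_add_top is_frame_F2)

lemma dummett_unifier_in:
  "subst (dummett_unifier k) dummett \<in> logic_of F2"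
  "subst (dummett_unifier k) dummett \<in> logic_of R2"
  "subst (dummett_unifier k) dummett \<in> logic_of (add_top R2)"
  "subst (dummett_unifier k) dummett \<in> logic_of G3"
  "subst (dummett_unifier k) dummett \<in> logic_of (add_top G3)"
proof -
  show "subst (dummett_unifier k) dummett \<in> logic_of F2"
    by (rule dummett_unifier_valid[OF is_frame_F2, of Fork_r]) (auto simp: F2_def)
  show "subst (dummett_unifier k) dummett \<in> logic_of R2"
  proof (rule dummett_unifier_valid[OF is_frame_R2, of "Some Fork_r"])
    show "R2 (Some Fork_r) w" for w by (cases w) (auto simp: F2_def)
    show "R2 u v \<or> R2 v u" if "\<not> R2 w (Some Fork_r)" "R2 w u" "R2 w v" for w u v
      using that by (cases w; cases u; cases v) (auto simp: F2_def)
  qed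
  show "subst (dummett_unifier k) dummett \<in> logic_of (add_top R2)"
  proof (rule dummett_unifier_valid[OF is_frame_add_top[OF is_frame_R2], of "Some (Some Fork_r)"])
    show "add_top R2 (Some (Some Fork_r)) w" for w
      by (auto simp: F2_def add_top_def R2_def split: option.splits)
    show "add_top R2 u v \<or> add_top R2 v u"
      if "\<not> add_top R2 w (Some (Some Fork_r))" "add_top R2 w u" "add_top R2 w v" for w u v
      using that by (auto simp: F2_def add_top_def R2_def split: option.splits)
  qed
  show "subst (dummett_unifier k) dummett \<in> logic_of G3"
    by (rule dummett_unifier_valid[OF is_frame_G3, of G3_r]) (auto simp: G3_def)
  show "subst (dummett_unifier k) dummett \<in> logic_of (add_top G3)"
  proof (rule dummett_unifier_valid[OF is_frame_add_top[OF is_frame_G3], of "Some G3_r"])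
    show "add_top G3 (Some G3_r) w" for w by (cases w) (auto simp: G3_def)
    show "add_top G3 u v \<or> add_top G3 v u"
      if "\<not> add_top G3 w (Some G3_r)" "add_top G3 w u" "add_top G3 w v" for w u v
      using that by (cases w; cases u; cases v) (auto simp: G3_def)
  qed
qed

text \<open>In the last case the two frames share the work: the forks come from \<open>F2\<close>,
  which is why \<open>b\<close> is false, and their recombination comes from
  \<open>R2\<close>.\<close>

theorem nullary_logics:
  assumes "L = logic_of (add_top R2) \<or> L = logic_of G3 \<or> L = logic_of (add_top G3) \<or>
    L = logic_of F2 \<inter> logic_of R2"
  shows "intermediate_logic L" "\<not> finitary_unification L \<and> \<not> unitary_unification L"
proof -
  show L: "intermediate_logic L"
    using assms intermediate_logic_Int intermediate_logic_of is_frame_add_top is_frame_R2 is_frame_G3 is_frame_F2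
    by metis
  have uni: "subst (dummett_unifier k) dummett \<in> L" for k
    using assms dummett_unifier_in by auto
  consider "L = logic_of (add_top R2)" | "L = logic_of G3" | "L = logic_of (add_top G3)"
    | "L = logic_of F2 \<inter> logic_of R2"
    using assms by blast
  then show "\<not> finitary_unification L \<and> \<not> unitary_unification L"
  proof cases
    case 1
    then show ?thesis
      by (intro nullary_if_fork[OF L _ _ uni, where b = True] disjI1)
        (auto simp: chain_tree_def intro!: diamond_valid_top_R2 top_diamond_valid)
  next
    case 2
    then show ?thesis
      by (intro nullary_if_fork[OF L _ _ uni, where b = False] disjI2)
        (auto simp: chain_tree_def intro!: fork_valid_G3 G3_tree_valid)
  next
    case 3
    then show ?thesis
      by (intro nullary_if_fork[OF L _ _ uni, where b = True] disjI2)
        (auto simp: chain_tree_def intro!: diamond_valid_top_G3 top_G3_tree_valid)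
  next
    case 4
    then show ?thesis
      by (intro nullary_if_fork[OF L _ _ uni, where b = False] disjI1)
        (auto simp: chain_tree_def intro!: fork_valid_F2 diamond_valid_R2)
  qed
qed

section \<open>Jankov's theorem\<close>

lemma finite_diagram: "finite (diagram (F :: ('w::finite) frame))"
proof -
  have *: "{f U V | U V. upset F U \<and> upset F V} = (\<lambda>(U, V). f U V) ` (Collect (upset F) \<times> Collect (upset F))"
    for f :: "'w set \<Rightarrow> 'w set \<Rightarrow> fm"
    by auto
  show ?thesis unfolding diagram_def * by simp
qed

lemma forces_big_conj:
  assumes "finite S"
  shows "forces F V w (big_conj S) \<longleftrightarrow> (\<forall>A\<in>S. forces F V w A)"
proof -
  have "set (SOME As. set As = S) = S" using finite_list[OF assms] by (rule someI_ex)
  then show ?thesis by (simp add: big_conj_def forces_foldr_And)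
qed

lemma root_above: "is_frame F \<Longrightarrow> F (root F) w"
proof -
  assume F: "is_frame F"
  then obtain r where r: "\<forall>w. F r w" by (auto simp: is_frame_def)
  have "root F = r"
    unfolding root_def
  proof (rule the_equality)
    show "r' = r" if "\<forall>w. F r' w" for r'
      using antisympD[of F r' r] F r that by (auto simp: is_frame_def)
  qed (rule r)
  then show ?thesis using r by simp
qed

text \<open>Interpreting each variable by the up-set it names satisfies the diagram and refutes the
  formula at the root. Conversely, a theorem refuted on \<open>F\<close> is instantiated with names
  of up-sets; modulo the diagram the instance reduces to the name of its truth set, which lacks the
  root.\<close>

theorem jankov:
  fixes F :: "('w::finite) frame"
  assumes L: "intermediate_logic L" and F: "is_frame F"
  shows "jankov F \<in> L \<longleftrightarrow> omits L F"
proof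
  have refl: "F v v" and trans: "F u v \<Longrightarrow> F v v' \<Longrightarrow> F u v'" and anti: "F u v \<Longrightarrow> F v u \<Longrightarrow> u = v" for u v v'
    using F by (auto simp: is_frame_def dest: reflpD transpD antisympD)
  \<comment> \<open>Numbers that do not code an up-set receive the empty one, so that every value is
    an up-set.\<close>
  define V :: "nat \<Rightarrow> 'w set" where "V x = (if upset F (from_nat x) then from_nat x else {})" for x
  have var: "forces F V w (upset_var U) \<longleftrightarrow> w \<in> U" if "upset F U" for U w
    using that by (simp add: upset_var_def V_def)
  have imp: "upset F (upset_imp F U U')" for U U'
    unfolding upset_def upset_imp_def using trans by blast
  assume "jankov F \<in> L"
  moreover have "jankov F \<notin> logic_of F"
  proof
    assume "jankov F \<in> logic_of F"
    moreover have "upset F (V x)" for x by (simp add: V_def upset_def)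
    ultimately have "forces F V (root F) (jankov F)" by (simp add: logic_of_def)
    moreover have "forces F V w A" if "A \<in> diagram F" for A w
    proof -
      have "upset F {}" "\<And>U U'. upset F U \<Longrightarrow> upset F U' \<Longrightarrow> upset F (U \<inter> U')"
        "\<And>U U'. upset F U \<Longrightarrow> upset F U' \<Longrightarrow> upset F (U \<union> U')"
        by (auto simp: upset_def)
      then show ?thesis
        using that imp by (auto simp: diagram_def var upset_imp_def)
    qed
    then have "forces F V (root F) (big_conj (diagram F))"
      by (simp add: forces_big_conj[OF finite_diagram])
    ultimately have "forces F V (root F) (upset_var (UNIV - {root F}))"
      using refl[of "root F"] by (simp add: jankov_def)
    moreover have "upset F (UNIV - {root F})"
      unfolding upset_def using anti root_above[OF F] by blast
    ultimately show False using var by simp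
  qed
  ultimately show "omits L F" by (auto simp: omits_def)
next
  have trans: "transp F" and anti: "F u v \<Longrightarrow> F v u \<Longrightarrow> u = v" for u v
    using F by (auto simp: is_frame_def dest: antisympD)
  assume "omits L F"
  then obtain A w and V :: "nat \<Rightarrow> 'w set" where A: "A \<in> L" and V: "\<And>x. upset F (V x)" and w: "\<not> forces F V w A"
    by (auto simp: omits_def logic_of_def)
  \<comment> \<open>Each variable is replaced by the name of its truth set under the refuting
    valuation.\<close>
  define \<sigma> where "\<sigma> x = upset_var (V x)" for x
  define T where "T C = {w. forces F V w C}" for C
  have T: "upset F (T C)" for C
    unfolding T_def upset_def using forces_mono[of F V, OF trans V] by blast
  interpret canonical L UNIV by unfold_locales (rule L)
  have "upset_var (UNIV - {root F}) \<in> s" if s: "s \<in> W" "big_conj (diagram F) \<in> s" for s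
  proof -
    have "forces (ord W) (\<lambda>x. {t. Var x \<in> t}) s (big_conj (diagram F))"
      using pts_truth[OF s(1) Fm_UNIV] s(2) by simp
    then have "C \<in> s" if "C \<in> diagram F" for C
      using that pts_truth[OF s(1) Fm_UNIV] by (simp add: forces_big_conj[OF finite_diagram])
    then have dia: "X \<in> u \<longleftrightarrow> Y \<in> u" if "Iff X Y \<in> diagram F" "u \<in> W" "s \<subseteq> u" for X Y u
      using that pts_And[OF s(1) Fm_UNIV Fm_UNIV] pts_Imp[OF s(1) Fm_UNIV Fm_UNIV] by blast
    have \<sigma>: "subst \<sigma> C \<in> u \<longleftrightarrow> upset_var (T C) \<in> u" if "u \<in> W" "s \<subseteq> u" for C u
      using that
    proof (induction C arbitrary: u)
      case (Var x)
      then show ?case by (simp add: \<sigma>_def T_def)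
    next
      case Bot
      have "T Bot = {}" by (simp add: T_def)
      moreover have "Iff (upset_var ({} :: 'w set)) Bot \<in> diagram F" by (simp add: diagram_def)
      ultimately show ?case using dia[OF _ Bot] by simp
    next
      case (And A B)
      have "T (And A B) = T A \<inter> T B" by (auto simp: T_def)
      moreover have "Iff (upset_var (T A \<inter> T B)) (And (upset_var (T A)) (upset_var (T B))) \<in> diagram F"
        using T by (auto simp: diagram_def)
      ultimately show ?case
        using dia[OF _ And.prems] And.IH[OF And.prems] And.prems(1) by (simp add: Fm_UNIV)
    next
      case (Or A B)
      have "T (Or A B) = T A \<union> T B" by (auto simp: T_def)
      moreover have "Iff (upset_var (T A \<union> T B)) (Or (upset_var (T A)) (upset_var (T B))) \<in> diagram F"
        using T by (auto simp: diagram_def)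
      ultimately show ?case
        using dia[OF _ Or.prems] Or.IH[OF Or.prems] Or.prems(1) by (simp add: Fm_UNIV)
    next
      case (Imp A B)
      have "T (Imp A B) = upset_imp F (T A) (T B)" by (auto simp: T_def upset_imp_def)
      moreover have "Iff (upset_var (upset_imp F (T A) (T B))) (Imp (upset_var (T A)) (upset_var (T B))) \<in> diagram F"
        using T by (auto simp: diagram_def)
      ultimately have "upset_var (T (Imp A B)) \<in> u \<longleftrightarrow> Imp (upset_var (T A)) (upset_var (T B)) \<in> u"
        using dia[OF _ Imp.prems] by simp
      also have "\<dots> \<longleftrightarrow> (\<forall>v\<in>W. u \<subseteq> v \<longrightarrow> upset_var (T A) \<in> v \<longrightarrow> upset_var (T B) \<in> v)"
        using pts_Imp[OF Imp.prems(1) Fm_UNIV Fm_UNIV] .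
      also have "\<dots> \<longleftrightarrow> (\<forall>v\<in>W. u \<subseteq> v \<longrightarrow> subst \<sigma> A \<in> v \<longrightarrow> subst \<sigma> B \<in> v)"
        using Imp.IH Imp.prems(2) by (meson subset_trans)
      also have "\<dots> \<longleftrightarrow> subst \<sigma> (Imp A B) \<in> u"
        using pts_Imp[OF Imp.prems(1) Fm_UNIV Fm_UNIV] by simp
      finally show ?case by blast
    qed
    have "subst \<sigma> A \<in> s" using pts_logic[OF s(1) Fm_UNIV intermediate_logic_subst[OF L A]] .
    then have TA: "upset_var (T A) \<in> s" using \<sigma>[OF s(1)] by blast
    let ?R = "UNIV - {root F}"
    have "root F \<notin> T A"
      using T[of A] w root_above[OF F] unfolding upset_def by (auto simp: T_def)
    \<comment> \<open>The truth set of \<open>A\<close> is thus included in the second greatest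
      up-set, whose name follows by the diagram equation for the intersection.\<close>
    then have "T A \<inter> ?R = T A" by blast
    moreover have "upset F ?R" unfolding upset_def using anti root_above[OF F] by blast
    then have "Iff (upset_var (T A \<inter> ?R)) (And (upset_var (T A)) (upset_var ?R)) \<in> diagram F"
      using T[of A] by (auto simp: diagram_def)
    ultimately have "And (upset_var (T A)) (upset_var ?R) \<in> s"
      using dia[of "upset_var (T A)" "And (upset_var (T A)) (upset_var ?R)" s] s(1) TA by simp
    then show ?thesis using s(1) by (simp add: Fm_UNIV)
  qed
  then have "Imp (big_conj (diagram F)) (upset_var (UNIV - {root F})) \<in> t" if t: "t \<in> W" for t
    using pts_Imp[OF t Fm_UNIV Fm_UNIV] by blast
  then show "jankov F \<in> L" by (intro pts_complete) (auto simp: Fm_UNIV jankov_def)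
qed

text \<open>The disjunction stems from the intersection of the logics of \<open>F2\<close> and
  \<open>R2\<close>: it extends every logic that omits neither frame. In the converse direction,
  omitting \<open>R2\<close> leads to projective approximation, omitting \<open>F2\<close> to
  unitary unification, and both conditions pass to extensions.\<close>

theorem theorem5p18:
  fixes L :: "fm set"
  assumes "intermediate_logic L"
  shows
    "(hereditary_finitary_unification L \<longleftrightarrow>
        hereditary_projective_approximation L \<or> hereditary_unitary_unification L) \<and>
     (hereditary_finitary_unification L \<longleftrightarrow>
        omits L (add_top R2) \<and> omits L G3 \<and> omits L (add_top G3) \<and>
        (omits L F2 \<or> omits L R2)) \<and>
     (hereditary_finitary_unification L \<longleftrightarrow>
        jankov G3 \<in> L \<and> jankov (add_top G3) \<in> L \<and> jankov (add_top R2) \<in> L \<and>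
        (jankov R2 \<in> L \<or> jankov F2 \<in> L))"
proof -
  let ?om = "omits L (add_top R2) \<and> omits L G3 \<and> omits L (add_top G3) \<and> (omits L F2 \<or> omits L R2)"
  have 1: "?om" if fin: "hereditary_finitary_unification L"
  proof -
    have "\<not> L \<subseteq> L'" if "L' = logic_of (add_top R2) \<or> L' = logic_of G3 \<or>
        L' = logic_of (add_top G3) \<or> L' = logic_of F2 \<inter> logic_of R2" for L'
      using fin nullary_logics[OF that] by (auto simp: hereditary_finitary_unification_def hereditary_def)
    then show ?om unfolding omits_def by (metis le_inf_iff)
  qed
  have 2: "hereditary_projective_approximation L \<or> hereditary_unitary_unification L" if om: ?om
  proof (cases "omits L R2")
    case True
    have "projective_approximation L'" if "intermediate_logic L'" "L \<subseteq> L'" for L'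
      by (intro projective_approximation_if_omits[OF that(1)] omits_mono[OF _ that(2)]) (use om True in auto)
    then show ?thesis by (simp add: hereditary_projective_approximation_def hereditary_def)
  next
    case False
    have "unitary_unification L'" if "intermediate_logic L'" "L \<subseteq> L'" for L'
      by (intro unitary_unification_if_omits[OF that(1)] omits_mono[OF _ that(2)]) (use om False in auto)
    then show ?thesis by (simp add: hereditary_unitary_unification_def hereditary_def)
  qed
  have 3: "hereditary_finitary_unification L"
    if "hereditary_projective_approximation L \<or> hereditary_unitary_unification L"
    using that finitary_if_projective_approximation
    by (auto simp: hereditary_projective_approximation_def hereditary_unitary_unification_def
        hereditary_finitary_unification_def hereditary_def)
  have "jankov G3 \<in> L \<longleftrightarrow> omits L G3" "jankov (add_top G3) \<in> L \<longleftrightarrow> omits L (add_top G3)"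
    "jankov (add_top R2) \<in> L \<longleftrightarrow> omits L (add_top R2)" "jankov R2 \<in> L \<longleftrightarrow> omits L R2"
    "jankov F2 \<in> L \<longleftrightarrow> omits L F2"
    using jankov[OF assms] is_frame_add_top is_frame_R2 is_frame_G3 is_frame_F2 by blast+
  then show ?thesis using 1 2 3 by blast
qed

end
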